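(* Let $G=(V,E)$ be a finite graph, $\beta>0$, and let $a,b\in V$ be distinct. Then $$\langle\sigma_a\bar\sigma_b\rangle_{G,\beta}^2=\tilde{\mathbf E}_{G,\beta}\Big[\frac{m_{a,b}}{m_{a,b}+1}\Big],$$ and in particular $$\tfrac12\,\tilde{\mathbf P}_{G,\beta}(m_{a,b}>0)\le\langle\sigma_a\bar\sigma_b\rangle_{G,\beta}^2\le\tilde{\mathbf P}_{G,\beta}(m_{a,b}>0).$$
   Context: XY model: $\langle\cdot\rangle_{G,\beta}$ is the expectation with respect to the probability measure $d\mu_{G,\beta}(\sigma)\propto\exp\big(\tfrac12\beta\sum_{vv'\in E}(\sigma_v\bar\sigma_{v'}+\bar\sigma_v\sigma_{v'})\big)\prod_vd\sigma_v$ on $\mathbb S^V$, with $\mathbb S$ the complex unit circle and $d\sigma_v$ the uniform probability measure. Coloured loop configurations: a submultigraph $\mathcal M$ of $G$ is obtained by taking $\mathcal M_e\in\{0,1,2,\dots\}$ (labelled, distinguishable) parallel copies of each edge $e\in E$. A (sourceless) coloured loop configuration on $\mathcal M$ consists of an assignment of a colour, red or blue, to each edge of $\mathcal M$, together with a collection of unrooted directed loops on $\mathcal M$ (which may use edges of both colours) such that every edge of $\mathcal M$ is traversed exactly once by a loop. Let $\tilde{\mathcal L}_0$ be the set of those coloured loop configurations, over all submultigraphs $\mathcal M$, for which at every vertex the number of outgoing red edges equals the number of incoming red edges and the number of outgoing blue edges equals the number of incoming blue edges (edges oriented as traversed by the loops). The weight of $\omega\in\tilde{\mathcal L}_0$ with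 underlying multigraph $\mathcal M$ is $$\tilde\lambda_\beta(\omega)=\prod_{v\in V}\frac1{(\deg_{\mathcal M}(v)/2)!}\prod_{e\in E}\frac1{\mathcal M_e!}\Big(\frac\beta2\Big)^{\mathcal M_e},$$ and $\tilde{\mathbf P}_{G,\beta}$ (with expectation $\tilde{\mathbf E}_{G,\beta}$) is the probability measure on $\tilde{\mathcal L}_0$ proportional to $\tilde\lambda_\beta$. For $\omega\in\tilde{\mathcal L}_0$, $m_{a,b}(\omega)$ is the number of pieces of loops of $\omega$ (directed subpaths of loops, regardless of colours) that go from $a$ to $b$ and do not visit $a$ or $b$ except at their start and end vertex. *)

theory Defs
  imports "HOL-Probability.Probability" "HOL-Library.Sublist"
begin

definition finite_graph :: "'v set \<Rightarrow> 'v set set \<Rightarrow> bool" where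
  "finite_graph V E \<longleftrightarrow>
     finite V \<and> E \<subseteq> {{v, w} | v w. v \<in> V \<and> w \<in> V \<and> v \<noteq> w}"

(* The probability measure proportional to a finite nonzero measure. *)
definition normalised :: "'a measure \<Rightarrow> 'a measure" where
  "normalised M = uniform_measure M (space M)"

(* Uniform probability measure on the complex unit circle. *)
definition circle_measure :: "complex measure" where
  "circle_measure =
     distr (uniform_measure lborel {0..<2 * pi}) (restrict_space borel (sphere 0 1)) cis"

(* For an edge e with endpoints v and w, the inner sum has exactly the two terms
   of the ordered pairs (v, w) and (w, v); it is a real number. *)
definition xy_density :: "'v set set \<Rightarrow> real \<Rightarrow> ('v \<Rightarrow> complex) \<Rightarrow> real" where
  "xy_density E \<beta> \<sigma> =
     exp (1/2 * \<beta> * Re (\<Sum>e\<in>E. \<Sum>(v, w) | {v, w} = e. \<sigma> v * cnj (\<sigma> w)))"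

definition xy_measure :: "'v set \<Rightarrow> 'v set set \<Rightarrow> real \<Rightarrow> ('v \<Rightarrow> complex) measure" where
  "xy_measure V E \<beta> =
     normalised (density (\<Pi>\<^sub>M v\<in>V. circle_measure) (\<lambda>\<sigma>. ennreal (xy_density E \<beta> \<sigma>)))"

definition xy_expectation ::
    "'v set \<Rightarrow> 'v set set \<Rightarrow> real \<Rightarrow> (('v \<Rightarrow> complex) \<Rightarrow> complex) \<Rightarrow> complex" where
  "xy_expectation V E \<beta> f = (\<integral>\<sigma>. f \<sigma> \<partial>xy_measure V E \<beta>)"

datatype colour = Red | Blue

(* A traversal, from src to tgt, of the copy number lab of the edge {src, tgt}. *)
datatype 'v step = Step (src: 'v) (tgt: 'v) (lab: nat)

definition step_edge :: "'v step \<Rightarrow> 'v set \<times> nat" where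
  "step_edge s = ({src s, tgt s}, lab s)"

(* A submultigraph is given by its multiplicities M; its edges are the pairs (e, i)
   with i < M e. *)
definition submultigraph :: "'v set set \<Rightarrow> ('v set \<Rightarrow> nat) \<Rightarrow> bool" where
  "submultigraph E M \<longleftrightarrow> (\<forall>e. e \<notin> E \<longrightarrow> M e = 0)"

definition medges :: "('v set \<Rightarrow> nat) \<Rightarrow> ('v set \<times> nat) set" where
  "medges M = {(e, i). i < M e}"

definition mdegree :: "'v set set \<Rightarrow> ('v set \<Rightarrow> nat) \<Rightarrow> 'v \<Rightarrow> nat" where
  "mdegree E M v = (\<Sum>e | e \<in> E \<and> v \<in> e. M e)"

(* Rooted directed loops; vertices may be visited repeatedly, edges may not. *)
definition rooted_loop :: "('v set \<Rightarrow> nat) \<Rightarrow> 'v step list \<Rightarrow> bool" where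
  "rooted_loop M xs \<longleftrightarrow>
     xs \<noteq> [] \<and> step_edge ` set xs \<subseteq> medges M \<and> distinct (map step_edge xs) \<and>
     (\<forall>i < length xs. tgt (xs ! i) = src (xs ! (Suc i mod length xs)))"

(* Forgetting the root: a loop is identified with the set of all its rootings. *)
definition unroot :: "'v step list \<Rightarrow> 'v step list set" where
  "unroot xs = {rotate n xs | n. True}"

definition loops_on :: "('v set \<Rightarrow> nat) \<Rightarrow> 'v step list set set" where
  "loops_on M = unroot ` {xs. rooted_loop M xs}"

definition steps :: "'v step list set \<Rightarrow> 'v step set" where
  "steps l = (\<Union>xs\<in>l. set xs)"

record 'v loop_config =
  mult :: "'v set \<Rightarrow> nat"
  colouring :: "'v set \<times> nat \<Rightarrow> colour"
  loops :: "'v step list set set"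

definition coloured_loop_config :: "'v set set \<Rightarrow> 'v loop_config \<Rightarrow> bool" where
  "coloured_loop_config E \<omega> \<longleftrightarrow>
     submultigraph E (mult \<omega>) \<and>
     colouring \<omega> \<in> medges (mult \<omega>) \<rightarrow>\<^sub>E UNIV \<and>
     loops \<omega> \<subseteq> loops_on (mult \<omega>) \<and>
     (\<forall>d \<in> medges (mult \<omega>). \<exists>!l. l \<in> loops \<omega> \<and> d \<in> step_edge ` steps l)"

definition out_degree :: "'v loop_config \<Rightarrow> colour \<Rightarrow> 'v \<Rightarrow> nat" where
  "out_degree \<omega> c v =
     card {s \<in> (\<Union>l\<in>loops \<omega>. steps l). src s = v \<and> colouring \<omega> (step_edge s) = c}"

definition in_degree :: "'v loop_config \<Rightarrow> colour \<Rightarrow> 'v \<Rightarrow> nat" where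
  "in_degree \<omega> c v =
     card {s \<in> (\<Union>l\<in>loops \<omega>. steps l). tgt s = v \<and> colouring \<omega> (step_edge s) = c}"

definition balanced_configs :: "'v set \<Rightarrow> 'v set set \<Rightarrow> 'v loop_config set" where
  "balanced_configs V E =
     {\<omega>. coloured_loop_config E \<omega> \<and>
        (\<forall>v\<in>V. out_degree \<omega> Red v = in_degree \<omega> Red v \<and>
               out_degree \<omega> Blue v = in_degree \<omega> Blue v)}"

(* All degrees of a loop configuration are even, so that div is exact here. *)
definition loop_weight :: "'v set \<Rightarrow> 'v set set \<Rightarrow> real \<Rightarrow> 'v loop_config \<Rightarrow> real" where
  "loop_weight V E \<beta> \<omega> =
     (\<Prod>v\<in>V. 1 / fact (mdegree E (mult \<omega>) v div 2)) *
     (\<Prod>e\<in>E. 1 / fact (mult \<omega> e) * (\<beta> / 2) ^ mult \<omega> e)"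

definition loop_measure :: "'v set \<Rightarrow> 'v set set \<Rightarrow> real \<Rightarrow> 'v loop_config measure" where
  "loop_measure V E \<beta> =
     normalised (density (count_space (balanced_configs V E))
       (\<lambda>\<omega>. ennreal (loop_weight V E \<beta> \<omega>)))"

(* A subpath of a loop visiting its start vertex only once is a prefix of some rooting,
   and since no edge is traversed twice, its list of steps determines its position
   in the loop; so counting lists counts subpaths. *)
definition pieces :: "'v \<Rightarrow> 'v \<Rightarrow> 'v loop_config \<Rightarrow> 'v step list set" where
  "pieces a b \<omega> =
     {p. (\<exists>l\<in>loops \<omega>. \<exists>xs\<in>l. prefix p xs) \<and>
         p \<noteq> [] \<and> src (hd p) = a \<and> tgt (last p) = b \<and>
         (\<forall>s \<in> set (tl p). src s \<noteq> a \<and> src s \<noteq> b)}"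

definition num_pieces :: "'v \<Rightarrow> 'v \<Rightarrow> 'v loop_config \<Rightarrow> nat" where
  "num_pieces a b \<omega> = card (pieces a b \<omega>)"

end

(* Expanding the exponentials of two independent copies of the model, one red and one blue, over the
   labelled copies of the edges turns the squares of the partition function and of its two-point
   version into weighted numbers of pairs (S, col): an orientation S and a colouring of the copies such that
   each colour class is a flow, sourceless in the first case and from b to a in the second. In the
   sourceless case, the directed edges can be linked to form loops in prod_v (deg v / 2)! ways.
   Link them only at the vertices other than a and b. The resulting structures
   decompose into closed loops and segments between a and b. Reversing a segment from b to a and
   flipping its colours subtracts it from both colour classes, hence sends structures with red and
   blue flow from b to a, having m + 1 segments from b to a and m - 1 from a to b, to sourceless
   structures with m segments in each direction, with a marked segment from a to b. Double counting
   gives the factor m / (m + 1). *)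
theory Submission
  imports Defs
begin

section \<open>Chains and cycles of a partial injection\<close>

text \<open>The weight contains 1 / (deg v / 2)!, which counting linkings can cancel only at
  vertices whose in- and out-degree agree. With one unit of each colour going from \<open>b\<close>
  to \<open>a\<close>, these degrees differ by 2 at \<open>a\<close> and \<open>b\<close>, so no
  linking exists there, while every other vertex has the same number of linkings in both kinds of
  structures. Hence the cut at exactly these two vertices. In the sourceless case the linkings at
  \<open>a\<close> and \<open>b\<close> are a free choice that leaves the segments alone, and they
  supply the two missing factorials. Two copies of the model are needed because a red edge of a
  reversed segment becomes a blue edge in the opposite direction: red loses its flow, blue gains the
  opposite flow, so that both colours drop by the same amount. Segments are maximal chains of a
  partial injection on steps; removing or inserting one is then a set operation on relations.
  Finiteness and positivity of the total loop weight are inherited from the spin integrals, which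
  are bounded and positive.\<close>

abbreviation chain :: "('a \<times> 'a) set \<Rightarrow> 'a list \<Rightarrow> bool" where
  "chain F \<equiv> successively (\<lambda>s t. (s, t) \<in> F)"

text \<open>These are the open components of the graph of \<open>F\<close>: a closed orbit contains
  no element outside \<open>Range F\<close> at which a list could start. Distinctness is not
  demanded, as it follows when \<open>F\<close> is a finite partial injection.\<close>

definition max_chains :: "('a \<times> 'a) set \<Rightarrow> 'a set \<Rightarrow> 'a list set" where
  "max_chains F S =
     {p. p \<noteq> [] \<and> set p \<subseteq> S \<and> chain F p \<and> hd p \<notin> Range F \<and> last p \<notin> Domain F}"

definition cycles :: "('a \<times> 'a) set \<Rightarrow> 'a list set" where
  "cycles F = {xs. xs \<noteq> [] \<and> distinct xs \<and> chain F xs \<and> (last xs, hd xs) \<in> F}"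

lemma chain_prefix:
  assumes "single_valued F" "chain F p" "chain F q" "p \<noteq> []" "q \<noteq> []" "hd p = hd q"
    and "length p \<le> length q"
  shows "prefix p q"
  using assms(2-)
proof (induction p arbitrary: q)
  case (Cons x p)
  then obtain q' where q: "q = x # q'" by (cases q) auto
  show ?case
  proof (cases "p = []")
    case False
    then have "q' \<noteq> []" using Cons.prems q by auto
    have "hd p = hd q'"
      using Cons.prems q False \<open>q' \<noteq> []\<close> assms(1)
      by (auto simp: successively_Cons dest: single_valuedD)
    then show ?thesis
      using Cons.IH[of q'] Cons.prems q False \<open>q' \<noteq> []\<close> by (auto simp: successively_Cons)
  qed (simp add: q)
qed simp

text \<open>By determinism the shorter chain is a prefix of the longer one, and a proper prefix
  would end in an element that still has a successor.\<close>

lemma chain_eqI: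
  assumes "single_valued F" "chain F p" "chain F q" "p \<noteq> []" "q \<noteq> []" "hd p = hd q"
    and "last p \<notin> Domain F" "last q \<notin> Domain F"
  shows "p = q"
proof -
  have *: "p = q" if "prefix p q" "chain F q" "last p \<notin> Domain F" "p \<noteq> []" for p q
  proof -
    obtain r where r: "q = p @ r" using \<open>prefix p q\<close> by (auto simp: prefix_def)
    show ?thesis using that r by (cases r) (auto simp: successively_append_iff)
  qed
  show ?thesis
  proof (cases "length p \<le> length q")
    case True
    then show ?thesis using chain_prefix[of F p q] assms by (intro *) auto
  next
    case False
    then have "q = p" using chain_prefix[of F q p] assms by (intro *) auto
    then show ?thesis by simp
  qed
qed

lemma chain_rev: "chain F (rev p) \<longleftrightarrow> chain (F\<inverse>) p"
  by simp

lemma max_chains_converse: "rev p \<in> max_chains (F\<inverse>) S \<longleftrightarrow> p \<in> max_chains F S"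
  by (auto simp: max_chains_def hd_rev last_rev)

lemma max_chain_eqI_hd:
  assumes "single_valued F" "p \<in> max_chains F S" "q \<in> max_chains F S" "hd p = hd q"
  shows "p = q"
  using assms by (auto simp: max_chains_def intro: chain_eqI)

lemma max_chain_eqI_last:
  assumes "single_valued (F\<inverse>)" "p \<in> max_chains F S" "q \<in> max_chains F S" "last p = last q"
  shows "p = q"
  using max_chain_eqI_hd[of "F\<inverse>" "rev p" S "rev q"] assms
  by (simp add: max_chains_converse hd_rev)

text \<open>Common source of open chains and of cycles: a longest distinct chain from
  \<open>s\<close> can only stop or close up at \<open>s\<close>. If \<open>s\<close> has no
  predecessor, it must stop; if every element has a successor, it must close up.\<close>

lemma long_chain_exists:
  assumes "finite S" "F \<subseteq> S \<times> S" "single_valued (F\<inverse>)" "s \<in> S"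
  obtains p where "p \<noteq> []" "hd p = s" "distinct p" "chain F p" "set p \<subseteq> S"
    "\<And>t. (last p, t) \<in> F \<Longrightarrow> t = s"
proof -
  define Q where "Q = (\<lambda>p. p \<noteq> [] \<and> hd p = s \<and> distinct p \<and> chain F p \<and> set p \<subseteq> S)"
  have bound: "length p \<le> card S" if "Q p" for p
    using that assms(1) by (metis Q_def card_mono distinct_card)
  have "Q [s]" using assms by (simp add: Q_def)
  then obtain p where p: "Q p" and longest: "\<And>q. Q q \<Longrightarrow> length q \<le> length p"
    using ex_has_greatest_nat[of Q "[s]" length "Suc (card S)"] bound by (meson le_imp_less_Suc)
  have "t = s" if t: "(last p, t) \<in> F" for t
  proof -
    have "t \<in> set p"
    proof (rule ccontr)
      assume "t \<notin> set p"
      then have "Q (p @ [t])"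
        using p t assms(2) by (auto simp: Q_def successively_append_iff)
      then show False using longest[of "p @ [t]"] by simp
    qed
    then obtain i where i: "i < length p" "p ! i = t" by (auto simp: in_set_conv_nth)
    show "t = s"
    proof (cases i)
      case 0
      then show ?thesis using i p by (auto simp: Q_def hd_conv_nth)
    next
      case (Suc j)
      then have "(p ! j, t) \<in> F"
        using p i successively_nth[of "\<lambda>s t. (s, t) \<in> F" p j] by (auto simp: Q_def)
      \<comment> \<open>If the successor \<open>t\<close> sits at a position \<open>Suc j\<close>,
        then \<open>p ! j\<close> and \<open>last p\<close> both precede \<open>t\<close>, so
        injectivity identifies them and no room is left for position \<open>Suc j\<close>.\<close>
      then have "p ! j = last p" using t assms(3) by (auto dest: single_valuedD)
      then have "p ! j = p ! (length p - 1)" using p by (auto simp: Q_def last_conv_nth)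
      then have "j = length p - 1"
        using p i Suc nth_eq_iff_index_eq[of p j "length p - 1"] by (auto simp: Q_def)
      then show ?thesis using i Suc by simp
    qed
  qed
  then show ?thesis using p by (intro that[of p]) (auto simp: Q_def)
qed

lemma max_chain_exists_hd:
  assumes "finite S" "F \<subseteq> S \<times> S" "single_valued (F\<inverse>)" "s \<in> S" "s \<notin> Range F"
  obtains p where "p \<in> max_chains F S" "hd p = s" "distinct p"
proof -
  obtain p where "p \<noteq> []" "hd p = s" "distinct p" "chain F p" "set p \<subseteq> S"
    "\<And>t. (last p, t) \<in> F \<Longrightarrow> t = s"
    using long_chain_exists assms(1-4) by metis
  then show ?thesis using that[of p] assms(5) by (auto simp: max_chains_def)
qed

lemma max_chain_exists_last:
  assumes "finite S" "F \<subseteq> S \<times> S" "single_valued F" "s \<in> S" "s \<notin> Domain F"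
  obtains p where "p \<in> max_chains F S" "last p = s"
proof -
  obtain p where p: "p \<in> max_chains (F\<inverse>) S" "hd p = s"
    using max_chain_exists_hd[of S "F\<inverse>" s] assms by auto
  then have "rev p \<in> max_chains F S" "last (rev p) = s"
    using max_chains_converse[of "rev p" F S] by (auto simp: max_chains_def last_rev)
  then show ?thesis using that by blast
qed

lemma max_chain_distinct:
  assumes "finite S" "F \<subseteq> S \<times> S" "single_valued F" "single_valued (F\<inverse>)"
    and p: "p \<in> max_chains F S"
  shows "distinct p"
proof -
  have "hd p \<in> S" "hd p \<notin> Range F" using p by (auto simp: max_chains_def)
  then obtain q where "q \<in> max_chains F S" "hd q = hd p" "distinct q"
    using max_chain_exists_hd assms by metis
  then show ?thesis using max_chain_eqI_hd assms by metis
qed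

text \<open>Cutting both chains at the common element, the parts after it agree because
  \<open>F\<close> is single-valued, and the parts before it agree by the same argument for the
  converse relation.\<close>

lemma max_chain_eqI:
  assumes "single_valued F" "single_valued (F\<inverse>)"
    and p: "p \<in> max_chains F S" and q: "q \<in> max_chains F S"
    and x: "x \<in> set p" "x \<in> set q"
  shows "p = q"
proof -
  obtain p1 p2 where p12: "p = p1 @ x # p2" using x(1) by (auto simp: in_set_conv_decomp)
  obtain q1 q2 where q12: "q = q1 @ x # q2" using x(2) by (auto simp: in_set_conv_decomp)
  have "x # p2 = x # q2"
    by (rule chain_eqI[of F]) (use assms p12 q12 in
      \<open>auto simp: max_chains_def successively_append_iff successively_Cons split: if_splits\<close>)
  moreover have "hd p = hd (p1 @ [x])" "hd q = hd (q1 @ [x])"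
    using p12 q12 by (simp_all add: hd_append)
  have "rev (p1 @ [x]) = rev (q1 @ [x])"
  proof (rule chain_eqI[of "F\<inverse>"])
    show "chain (F\<inverse>) (rev (p1 @ [x]))" "chain (F\<inverse>) (rev (q1 @ [x]))"
      using p q p12 q12 unfolding chain_rev 
      by (auto simp: max_chains_def successively_append_iff successively_Cons)
    show "last (rev (p1 @ [x])) \<notin> Domain (F\<inverse>)" "last (rev (q1 @ [x])) \<notin> Domain (F\<inverse>)"
      using p q \<open>hd p = _\<close> \<open>hd q = _\<close> unfolding last_rev by (auto simp: max_chains_def)
  qed (use assms in auto)
  ultimately show ?thesis using p12 q12 by simp
qed

section \<open>Paths as sets of consecutive pairs\<close>

definition list_pairs :: "'a list \<Rightarrow> ('a \<times> 'a) set" where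
  "list_pairs p = set (zip p (tl p))"

lemma list_pairs_simps [simp]:
  "list_pairs [] = {}" "list_pairs [x] = {}"
  "list_pairs (x # y # p) = insert (x, y) (list_pairs (y # p))"
  by (simp_all add: list_pairs_def)

lemma list_pairs_append:
  "p \<noteq> [] \<Longrightarrow> q \<noteq> [] \<Longrightarrow>
     list_pairs (p @ q) = list_pairs p \<union> {(last p, hd q)} \<union> list_pairs q"
proof (induction p)
  case (Cons x p)
  then show ?case by (cases p; cases q) auto
qed simp

lemma list_pairs_rev: "list_pairs (rev p) = (list_pairs p)\<inverse>"
proof (induction p)
  case (Cons x p)
  show ?case
  proof (cases "p = []")
    case False
    then show ?thesis
      using Cons.IH list_pairs_append[of "[x]" p]
      by (simp add: list_pairs_append last_rev converse_Un) blast
  qed simp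
qed simp

lemma list_pairs_map: "list_pairs (map f p) = map_prod f f ` list_pairs p"
  by (induction p rule: induct_list012) auto

text \<open>Makes being a chain an inclusion of relations, so that cutting out a path or gluing one
  in can be done by difference and union of relations.\<close>

lemma chain_iff_list_pairs: "chain F p \<longleftrightarrow> list_pairs p \<subseteq> F"
  by (induction p rule: induct_list012) auto

lemma list_pairs_subset: "list_pairs p \<subseteq> set p \<times> set p"
  by (induction p rule: induct_list012) auto

lemma Domain_list_pairs: "p \<noteq> [] \<Longrightarrow> distinct p \<Longrightarrow> Domain (list_pairs p) = set p - {last p}"
proof (induction p rule: induct_list012)
  case (3 x y p)
  have "last (y # p) \<in> set (y # p)" by (rule last_in_set) simp
  then have "x \<noteq> last (y # p)" using 3 by force
  then show ?case using 3 by (simp add: insert_Diff_if)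
qed simp_all

lemma Range_list_pairs: "p \<noteq> [] \<Longrightarrow> distinct p \<Longrightarrow> Range (list_pairs p) = set p - {hd p}"
  using Domain_list_pairs[of "rev p"] by (simp add: list_pairs_rev last_rev)

lemma single_valued_list_pairs: "distinct p \<Longrightarrow> single_valued (list_pairs p)"
proof (induction p rule: induct_list012)
  case (3 x y p)
  then show ?case using list_pairs_subset[of "y # p"] by (auto simp: single_valued_def)
qed (simp_all)

lemma single_valued_list_pairs_converse: "distinct p \<Longrightarrow> single_valued ((list_pairs p)\<inverse>)"
  using single_valued_list_pairs[of "rev p"] by (simp add: list_pairs_rev)

lemma single_valued_Un:
  assumes "single_valued F" "single_valued G" "Domain F \<inter> Domain G = {}"
  shows "single_valued (F \<union> G)"
  using assms unfolding single_valued_def by blast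

text \<open>A path glued in on fresh elements forms a component of its own. A maximal chain that
  meets it equals it, and any other one stays inside \<open>S\<close> and uses links of
  \<open>F\<close> only.\<close>

lemma max_chains_Un_list_pairs:
  assumes F: "F \<subseteq> S \<times> S" and fin: "finite S"
    and sv: "single_valued F" "single_valued (F\<inverse>)"
    and p: "p \<noteq> []" "distinct p" "set p \<inter> S = {}"
  shows "max_chains (F \<union> list_pairs p) (S \<union> set p) = insert p (max_chains F S)"
proof -
  let ?F = "F \<union> list_pairs p"
  have DR: "Domain (list_pairs p) = set p - {last p}" "Range (list_pairs p) = set p - {hd p}"
    using p by (simp_all add: Domain_list_pairs Range_list_pairs)
  have lp: "list_pairs p \<subseteq> set p \<times> set p" by (rule list_pairs_subset)
  have "Domain F \<inter> Domain (list_pairs p) = {}" "Range F \<inter> Range (list_pairs p) = {}"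
    using F lp p(3) by blast+
  then have svF: "single_valued ?F" "single_valued (?F\<inverse>)"
    using single_valued_Un[OF sv(1) single_valued_list_pairs[OF p(2)]]
      single_valued_Un[OF sv(2) single_valued_list_pairs_converse[OF p(2)]]
    by (simp_all add: converse_Un)
  have pin: "p \<in> max_chains ?F (S \<union> set p)"
  proof -
    have "hd p \<notin> S" "last p \<notin> S" using p(1,3) hd_in_set[of p] last_in_set[of p] by blast+
    then have "hd p \<notin> Range ?F" "last p \<notin> Domain ?F" using DR F by auto
    moreover have "chain ?F p" unfolding chain_iff_list_pairs by simp
    ultimately show ?thesis using p(1) by (simp add: max_chains_def)
  qed
  show ?thesis
  proof (intro equalityI subsetI)
    fix q assume q: "q \<in> max_chains ?F (S \<union> set p)"
    show "q \<in> insert p (max_chains F S)"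
    proof (cases "set q \<inter> set p = {}")
      case True
      then have "set q \<subseteq> S" using q by (auto simp: max_chains_def)
      moreover have "list_pairs q \<subseteq> F"
        using q True list_pairs_subset[of q] lp
        unfolding max_chains_def chain_iff_list_pairs by blast
      ultimately show ?thesis
        using q unfolding max_chains_def chain_iff_list_pairs by auto
    next
      case False
      then show ?thesis using max_chain_eqI[OF svF q pin] by auto
    qed
  next
    fix q assume "q \<in> insert p (max_chains F S)"
    then show "q \<in> max_chains ?F (S \<union> set p)"
    proof
      assume q: "q \<in> max_chains F S"
      then have "hd q \<in> S" "last q \<in> S" by (auto simp: max_chains_def)
      then have "hd q \<notin> set p" "last q \<notin> set p" using p(3) by auto
      then show ?thesis
        using q lp unfolding max_chains_def chain_iff_list_pairs by auto
    qed (use pin in simp)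
  qed
qed


text \<open>A maximal chain is a full component: apart from its last element each of its elements
  has its only successor on the chain, and dually for predecessors. So no remaining link touches
  it.\<close>

lemma max_chains_Diff_list_pairs:
  assumes F: "F \<subseteq> S \<times> S" and fin: "finite S"
    and sv: "single_valued F" "single_valued (F\<inverse>)"
    and p: "p \<in> max_chains F S"
  shows "F - list_pairs p \<subseteq> (S - set p) \<times> (S - set p)" and "list_pairs p \<subseteq> F"
proof -
  have d: "distinct p" "p \<noteq> []" using max_chain_distinct[OF fin F sv p] p by (auto simp: max_chains_def)
  show sub: "list_pairs p \<subseteq> F" using p by (auto simp: max_chains_def chain_iff_list_pairs)
  have hl: "hd p \<notin> Range F" "last p \<notin> Domain F" using p by (auto simp: max_chains_def)
  have "s \<notin> set p \<and> t \<notin> set p" if st: "(s, t) \<in> F" "(s, t) \<notin> list_pairs p" for s t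
  proof (intro conjI notI)
    assume "s \<in> set p"
    then have "s \<in> Domain (list_pairs p)" using st hl d by (auto simp: Domain_list_pairs)
    then obtain u where u: "(s, u) \<in> list_pairs p" by auto
    then have "u = t" using st sub by (intro single_valuedD[OF sv(1), of s]) auto
    then show False using u st by simp
  next
    assume "t \<in> set p"
    then have "t \<in> Range (list_pairs p)" using st hl d by (auto simp: Range_list_pairs)
    then obtain u where u: "(u, t) \<in> list_pairs p" by auto
    then have "u = s" using st sub by (intro single_valuedD[OF sv(2), of t]) auto
    then show False using u st by simp
  qed
  then show "F - list_pairs p \<subseteq> (S - set p) \<times> (S - set p)" using F by blast
qed

section \<open>Cycles of a partial injection\<close>

lemma cycle_eqI_le:
  assumes sv: "single_valued F" and xs: "xs \<in> cycles F" and ys: "ys \<in> cycles F"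
    and h: "hd xs = hd ys" and le: "length xs \<le> length ys"
  shows "xs = ys"
proof -
  have ne: "xs \<noteq> []" "ys \<noteq> []" and d: "distinct ys" and l: "(last xs, hd xs) \<in> F"
    and c: "chain F xs" "chain F ys"
    using xs ys by (simp_all add: cycles_def)
  have "prefix xs ys" by (rule chain_prefix[OF sv c ne h le])
  then obtain r where r: "ys = xs @ r" by (rule prefixE)
  show ?thesis
  proof (cases r)
    case (Cons z r')
    have "(last xs, z) \<in> F"
      using c(2) ne r Cons by (simp add: successively_append_iff)
    \<comment> \<open>If \<open>ys\<close> went on after \<open>xs\<close>, its next element would
      be the closing successor \<open>hd xs\<close>, which \<open>ys\<close> has already
      visited.\<close>
    then have "z = hd xs" using l by (rule single_valuedD[OF sv])
    then show ?thesis using d ne r Cons by simp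
  qed (use r in simp)
qed

lemma cycle_eqI:
  assumes "single_valued F" "xs \<in> cycles F" "ys \<in> cycles F" "hd xs = hd ys"
  shows "xs = ys"
  using cycle_eqI_le[OF assms] cycle_eqI_le[OF assms(1,3,2) assms(4)[symmetric]]
  by (cases "length xs \<le> length ys") simp_all

lemma cycle_exists:
  assumes "finite S" "F \<subseteq> S \<times> S" "single_valued (F\<inverse>)" "Domain F = S" "s \<in> S"
  obtains xs where "xs \<in> cycles F" "hd xs = s" "set xs \<subseteq> S"
proof -
  obtain p where p: "p \<noteq> []" "hd p = s" "distinct p" "chain F p" "set p \<subseteq> S"
    and last: "\<And>t. (last p, t) \<in> F \<Longrightarrow> t = s"
    using long_chain_exists[OF assms(1-3,5)] by metis
  have "last p \<in> Domain F" using p assms(4) last_in_set[of p] by blast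
  then have "(last p, s) \<in> F" using last by blast
  then have "p \<in> cycles F" using p by (simp add: cycles_def)
  then show ?thesis using p that by blast
qed

lemma rotate1_cycle:
  assumes "xs \<in> cycles F"
  shows "rotate1 xs \<in> cycles F"
proof (cases xs)
  case (Cons x ys)
  then show ?thesis
    using assms by (cases "ys = []") (simp_all add: cycles_def successively_append_iff successively_Cons)
qed (use assms in simp)

lemma rotate_cycle: "xs \<in> cycles F \<Longrightarrow> rotate n xs \<in> cycles F"
  by (induction n) (simp_all add: rotate1_cycle)

section \<open>Loop configurations as linked orientations\<close>

text \<open>\<open>step_edge\<close> forgets the direction, so \<open>S\<close> is a section of it
  over \<open>D\<close>: every edge copy is traversed in exactly one of its two directions.\<close>

definition orientation :: "('v set \<times> nat) set \<Rightarrow> 'v step set \<Rightarrow> bool" where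
  "orientation D S \<longleftrightarrow> inj_on step_edge S \<and> step_edge ` S = D"

text \<open>With \<open>W = V\<close> these are the ways to join oriented edges to loops; leaving \<open>a\<close> and \<open>b\<close> out of
  \<open>W\<close> cuts the loops at these two vertices.\<close>

definition links :: "'v set \<Rightarrow> 'v step set \<Rightarrow> ('v step \<times> 'v step) set set" where
  "links W S =
     {F. F \<subseteq> S \<times> S \<and> single_valued F \<and> single_valued (F\<inverse>) \<and>
         (\<forall>(s, t)\<in>F. tgt s = src t) \<and>
         Domain F = {s \<in> S. tgt s \<in> W} \<and> Range F = {t \<in> S. src t \<in> W}}"

text \<open>The part of \<open>coloured_loop_config\<close> that concerns the loops alone, separated
  from the colouring because only this part corresponds to links.\<close>

definition covering_loops :: "('v set \<Rightarrow> nat) \<Rightarrow> 'v step list set set \<Rightarrow> bool" where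
  "covering_loops M L \<longleftrightarrow>
     L \<subseteq> loops_on M \<and> (\<forall>d \<in> medges M. \<exists>!l. l \<in> L \<and> d \<in> step_edge ` steps l)"

text \<open>A loop contains all its rootings, and the last step of a rooting precedes its first step
  along the loop. Ranging over rootings thus yields every pair of consecutive steps, without a
  special case for closing the loop.\<close>

definition successions :: "'v step list set set \<Rightarrow> ('v step \<times> 'v step) set" where
  "successions L = {(last xs, hd xs) | xs. xs \<in> \<Union>L}"

lemma unroot_self: "xs \<in> unroot xs"
  unfolding unroot_def by (rule CollectI, rule exI[of _ 0]) simp

lemma rotate_in_unroot: "rotate n xs \<in> unroot xs"
  unfolding unroot_def by blast

lemma unroot_rotate: "unroot (rotate n xs) = unroot xs"
proof -
  have *: "unroot (rotate n xs) \<subseteq> unroot xs" for n and xs :: "'a step list"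
    unfolding unroot_def by (auto simp: rotate_rotate)
  have "rotate (length xs - n mod length xs) (rotate n xs) = xs"
  proof (cases "xs = []")
    case False
    then have "length xs - n mod length xs + n mod length xs = length xs"
      by (simp add: less_imp_le)
    then have "(length xs - n mod length xs + n) mod length xs = 0"
      using mod_add_right_eq[of "length xs - n mod length xs" n "length xs"] by simp
    then show ?thesis by (simp add: rotate_rotate)
  qed simp
  then show ?thesis using *[of n xs] *[of "length xs - n mod length xs" "rotate n xs"] by auto
qed

lemma steps_unroot: "steps (unroot xs) = set xs"
  using unroot_self by (auto simp: steps_def unroot_def)

lemma rooted_loop_rotate:
  assumes "rooted_loop M xs"
  shows "rooted_loop M (rotate n xs)"
proof -
  have "tgt (rotate n xs ! i) = src (rotate n xs ! (Suc i mod length xs))"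
    if "i < length xs" for i
  proof -
    have "(n + i) mod length xs < length xs" using that by (intro mod_less_divisor) auto
    then have "tgt (xs ! ((n + i) mod length xs)) = src (xs ! (Suc ((n + i) mod length xs) mod length xs))"
      using assms by (auto simp: rooted_loop_def)
    moreover have "Suc i mod length xs < length xs" using that by (intro mod_less_divisor) auto
    ultimately show ?thesis using that by (simp add: nth_rotate mod_simps)
  qed
  then show ?thesis using assms by (simp add: rooted_loop_def flip: rotate_map)
qed

text \<open>Since no step is repeated, the first step fixes the rooting. This is what makes
  \<open>successions\<close> a partial injection.\<close>

lemma rotate_eq_if_hd_eq:
  assumes "distinct xs" "hd (rotate n xs) = hd xs"
  shows "rotate n xs = xs"
proof (cases "xs = []")
  case False
  then have "xs ! (n mod length xs) = xs ! 0"
    using assms hd_rotate_conv_nth[of xs n] hd_conv_nth[of xs] by simp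
  then have "n mod length xs = 0"
    using False assms(1) nth_eq_iff_index_eq[of xs "n mod length xs" 0] by simp
  then show ?thesis by simp
qed simp

lemma last_rotate1: "last (rotate1 xs) = hd xs" if "xs \<noteq> []"
  using that by (cases xs) simp_all

lemma rotate_eq_if_last_eq:
  assumes "distinct xs" "last (rotate n xs) = last xs"
  shows "rotate n xs = xs"
proof (cases "xs = []")
  case False
  obtain ys where ys: "xs = rotate1 ys" using surj_rotate1 by (metis surjD)
  then have "hd (rotate n ys) = hd ys"
    using False assms(2) by (simp add: last_rotate1 flip: rotate1_rotate_swap)
  then have "rotate n ys = ys" using assms(1) ys by (intro rotate_eq_if_hd_eq) auto
  then show ?thesis using ys by (simp flip: rotate1_rotate_swap)
qed simp

lemma ex_rotation_hd:
  assumes "s \<in> set xs"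
  obtains n where "hd (rotate n xs) = s"
proof -
  obtain i where "i < length xs" "xs ! i = s" using assms by (auto simp: in_set_conv_nth)
  then have "hd (rotate i xs) = s" by (subst hd_rotate_conv_nth) auto
  then show ?thesis using that by blast
qed

lemma ex_rotation_last:
  assumes "s \<in> set xs"
  obtains n where "last (rotate n xs) = s"
proof -
  obtain n where "hd (rotate n xs) = s" using assms by (rule ex_rotation_hd)
  moreover have "xs \<noteq> []" using assms by auto
  ultimately have "last (rotate (Suc n) xs) = s" by (simp add: last_rotate1)
  then show ?thesis using that by blast
qed

section \<open>From covering loops to links\<close>

context
  fixes M :: "'v set \<Rightarrow> nat" and L :: "'v step list set set"
  assumes cov: "covering_loops M L"
begin

lemma covering_loopsD:
  assumes "xs \<in> \<Union>L"
  shows "rooted_loop M xs" "unroot xs \<in> L" "rotate n xs \<in> \<Union>L"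
proof -
  obtain l where l: "l \<in> L" "xs \<in> l" using assms by auto
  then obtain ys where ys: "rooted_loop M ys" "l = unroot ys"
    using cov by (auto simp: covering_loops_def loops_on_def)
  then obtain k where k: "xs = rotate k ys" using l by (auto simp: unroot_def)
  show "rooted_loop M xs" using k ys by (simp add: rooted_loop_rotate)
  show u: "unroot xs \<in> L" using k ys l by (simp add: unroot_rotate)
  show "rotate n xs \<in> \<Union>L" using u rotate_in_unroot by blast
qed

lemma unroot_image_Union: "unroot ` \<Union>L = L"
proof (intro equalityI subsetI)
  fix l assume l: "l \<in> L"
  then obtain ys where ys: "l = unroot ys"
    using cov by (auto simp: covering_loops_def loops_on_def)
  then show "l \<in> unroot ` \<Union>L" using l unroot_self by blast
qed (use covering_loopsD in auto)

lemma covering_loops_distinct: "xs \<in> \<Union>L \<Longrightarrow> xs \<noteq> [] \<and> distinct xs"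
  using covering_loopsD(1) by (auto simp: rooted_loop_def distinct_map)

text \<open>Each edge copy belongs to a unique loop. The assumption compares edges and not steps, so
  it also covers traversals in opposite directions, as the injectivity of \<open>step_edge\<close>
  on all steps requires.\<close>

lemma covering_loops_share:
  assumes xs: "xs \<in> \<Union>L" and ys: "ys \<in> \<Union>L"
    and "s \<in> set xs" "t \<in> set ys" "step_edge s = step_edge t"
  obtains n where "ys = rotate n xs"
proof -
  let ?d = "step_edge s"
  have "?d \<in> medges M"
    using covering_loopsD(1)[OF xs] assms by (auto simp: rooted_loop_def)
  then have "\<exists>!l. l \<in> L \<and> ?d \<in> step_edge ` steps l"
    using cov by (simp add: covering_loops_def)
  moreover have "unroot xs \<in> L" "unroot ys \<in> L" using covering_loopsD(2) xs ys by auto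
  moreover have "?d \<in> step_edge ` steps (unroot xs)" "?d \<in> step_edge ` steps (unroot ys)"
    unfolding steps_unroot using assms(3,4)[THEN imageI, of step_edge] assms(5) by simp_all
  ultimately have "unroot xs = unroot ys" by blast
  then have "ys \<in> unroot xs" using unroot_self by blast
  then show ?thesis using that by (auto simp: unroot_def)
qed

lemma steps_Union: "\<Union>(steps ` L) = \<Union>(set ` \<Union>L)"
  by (auto simp: steps_def)

lemma single_valued_successions: "single_valued (successions L)"
proof (rule single_valuedI)
  fix s t u assume st: "(s, t) \<in> successions L" and su: "(s, u) \<in> successions L"
  obtain xs where xs: "xs \<in> \<Union>L" "s = last xs" "t = hd xs"
    using st unfolding successions_def by blast
  obtain ys where ys: "ys \<in> \<Union>L" "s = last ys" "u = hd ys"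
    using su unfolding successions_def by blast
  have ne: "xs \<noteq> []" "ys \<noteq> []" "distinct xs"
    using covering_loops_distinct xs(1) ys(1) by blast+
  have mem: "s \<in> set xs" unfolding xs(2) using ne by simp
  have mem': "s \<in> set ys" unfolding ys(2) using ne by simp
  obtain n where "ys = rotate n xs"
    using covering_loops_share[OF xs(1) ys(1) mem mem' refl] by blast
  then show "t = u" using rotate_eq_if_last_eq[of xs n] xs ys ne by simp
qed

lemma single_valued_successions_converse: "single_valued ((successions L)\<inverse>)"
proof (rule single_valuedI)
  fix s t u assume st: "(s, t) \<in> (successions L)\<inverse>" and su: "(s, u) \<in> (successions L)\<inverse>"
  obtain xs where xs: "xs \<in> \<Union>L" "t = last xs" "s = hd xs"
    using st unfolding successions_def by blast
  obtain ys where ys: "ys \<in> \<Union>L" "u = last ys" "s = hd ys"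
    using su unfolding successions_def by blast
  have ne: "xs \<noteq> []" "ys \<noteq> []" "distinct xs"
    using covering_loops_distinct xs(1) ys(1) by blast+
  have mem: "s \<in> set xs" unfolding xs(3) using ne by simp
  have mem': "s \<in> set ys" unfolding ys(3) using ne by simp
  obtain n where "ys = rotate n xs"
    using covering_loops_share[OF xs(1) ys(1) mem mem' refl] by blast
  then show "t = u" using rotate_eq_if_hd_eq[of xs n] xs ys ne by simp
qed

text \<open>Two traversals of one copy would lie on the same loop, where the edges are distinct, so
  they are the same step.\<close>

lemma orientation_steps: "orientation (medges M) (\<Union>(steps ` L))"
  unfolding orientation_def
proof
  show "inj_on step_edge (\<Union>(steps ` L))"
  proof (rule inj_onI)
    fix s t assume "s \<in> \<Union>(steps ` L)" "t \<in> \<Union>(steps ` L)" and e: "step_edge s = step_edge t"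
    then obtain xs ys where *: "xs \<in> \<Union>L" "s \<in> set xs" "ys \<in> \<Union>L" "t \<in> set ys"
      unfolding steps_Union by blast
    then obtain n where "ys = rotate n xs" using covering_loops_share e by blast
    then have "t \<in> set xs" using * by simp
    moreover have "inj_on step_edge (set xs)"
      using covering_loopsD(1)[OF *(1)] by (simp add: rooted_loop_def distinct_map)
    ultimately show "s = t" using * e by (meson inj_onD)
  qed
  show "step_edge ` \<Union>(steps ` L) = medges M"
  proof
    show "step_edge ` \<Union>(steps ` L) \<subseteq> medges M"
      unfolding steps_Union using covering_loopsD(1) by (fastforce simp: rooted_loop_def)
    show "medges M \<subseteq> step_edge ` \<Union>(steps ` L)"
      using cov unfolding covering_loops_def by blast
  qed
qed

lemma Domain_successions: "Domain (successions L) = \<Union>(steps ` L)"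
proof
  show "Domain (successions L) \<subseteq> \<Union>(steps ` L)"
    unfolding steps_Union successions_def using covering_loops_distinct last_in_set by fastforce
  show "\<Union>(steps ` L) \<subseteq> Domain (successions L)"
  proof
    fix s assume "s \<in> \<Union>(steps ` L)"
    then obtain xs where xs: "xs \<in> \<Union>L" "s \<in> set xs" unfolding steps_Union by blast
    obtain n where "last (rotate n xs) = s" using xs(2) by (rule ex_rotation_last)
    then show "s \<in> Domain (successions L)"
      using covering_loopsD(3)[OF xs(1), of n] unfolding successions_def by blast
  qed
qed

lemma Range_successions: "Range (successions L) = \<Union>(steps ` L)"
proof
  show "Range (successions L) \<subseteq> \<Union>(steps ` L)"
    unfolding steps_Union successions_def using covering_loops_distinct hd_in_set by fastforce
  show "\<Union>(steps ` L) \<subseteq> Range (successions L)"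
  proof
    fix s assume "s \<in> \<Union>(steps ` L)"
    then obtain xs where xs: "xs \<in> \<Union>L" "s \<in> set xs" unfolding steps_Union by blast
    obtain n where "hd (rotate n xs) = s" using xs(2) by (rule ex_rotation_hd)
    then show "s \<in> Range (successions L)"
      using covering_loopsD(3)[OF xs(1), of n] unfolding successions_def by blast
  qed
qed

lemma successions_links:
  assumes "\<And>s. step_edge s \<in> medges M \<Longrightarrow> src s \<in> V \<and> tgt s \<in> V"
  shows "successions L \<in> links V (\<Union>(steps ` L))"
proof -
  have "tgt (last xs) = src (hd xs)" if "xs \<in> \<Union>L" for xs
  proof -
    have r: "rooted_loop M xs" using that by (rule covering_loopsD)
    then have "length xs - 1 < length xs" by (simp add: rooted_loop_def)
    then have "tgt (xs ! (length xs - 1)) = src (xs ! (Suc (length xs - 1) mod length xs))"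
      using r unfolding rooted_loop_def by blast
    then show ?thesis using r by (simp add: rooted_loop_def last_conv_nth hd_conv_nth)
  qed
  then have "\<forall>(s, t)\<in>successions L. tgt s = src t" by (auto simp: successions_def)
  moreover have "src s \<in> V \<and> tgt s \<in> V" if "s \<in> \<Union>(steps ` L)" for s
  proof (rule assms)
    show "step_edge s \<in> medges M"
      using orientation_steps imageI[OF that, of step_edge] by (simp add: orientation_def)
  qed
  then have "{s \<in> \<Union>(steps ` L). tgt s \<in> V} = \<Union>(steps ` L)"
    "{s \<in> \<Union>(steps ` L). src s \<in> V} = \<Union>(steps ` L)"
    by blast+
  moreover have "successions L \<subseteq> \<Union>(steps ` L) \<times> \<Union>(steps ` L)"
  proof (rule subrelI)
    fix s t assume "(s, t) \<in> successions L"
    then have "s \<in> Domain (successions L)" "t \<in> Range (successions L)" by auto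
    then show "(s, t) \<in> \<Union>(steps ` L) \<times> \<Union>(steps ` L)"
      unfolding Domain_successions Range_successions by (rule SigmaI)
  qed
  ultimately show ?thesis
    using single_valued_successions single_valued_successions_converse
      Domain_successions Range_successions
    unfolding links_def by (intro CollectI conjI) simp_all
qed

lemma cycles_successions: "\<Union>L \<subseteq> cycles (successions L)"
proof
  fix xs assume xs: "xs \<in> \<Union>L"
  have "(xs ! i, xs ! Suc i) \<in> successions L" if i: "Suc i < length xs" for i
  proof -
    have "hd (rotate (Suc i) xs) = xs ! Suc i" using i by (subst hd_rotate_conv_nth) auto
    moreover have "last (rotate (Suc i) xs) = xs ! i"
    proof -
      have "xs \<noteq> []" using i by auto
      then show ?thesis using i hd_rotate_conv_nth[of xs i] by (simp add: last_rotate1)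
    qed
    ultimately show ?thesis
      using covering_loopsD(3)[OF xs, of "Suc i"] unfolding successions_def by force
  qed
  then show "xs \<in> cycles (successions L)"
    using covering_loops_distinct[OF xs] xs
    by (auto simp: cycles_def successively_conv_nth) (auto simp: successions_def)
qed

text \<open>The rootings can be recovered from the relation: a cycle is determined by its first
  step, and some rooting in \<open>L\<close> starts with that step.\<close>

lemma cycles_successions_eq: "cycles (successions L) = \<Union>L"
proof (intro equalityI cycles_successions subsetI)
  fix ys assume ys: "ys \<in> cycles (successions L)"
  then have "hd ys \<in> Range (successions L)" by (auto simp: cycles_def)
  then have "hd ys \<in> \<Union>(set ` \<Union>L)" using Range_successions unfolding steps_Union by simp
  then obtain zs where zs: "zs \<in> \<Union>L" "hd ys \<in> set zs" by blast
  obtain n where "hd (rotate n zs) = hd ys" using zs(2) by (rule ex_rotation_hd)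
  moreover have "rotate n zs \<in> \<Union>L" using zs(1) by (rule covering_loopsD)
  moreover from this have "rotate n zs \<in> cycles (successions L)" using cycles_successions by blast
  ultimately show "ys \<in> \<Union>L" using cycle_eqI[OF single_valued_successions ys] by metis
qed

end

section \<open>From links back to covering loops\<close>

context
  fixes M :: "'v set \<Rightarrow> nat" and V :: "'v set" and S :: "'v step set"
    and F :: "('v step \<times> 'v step) set"
  assumes fin: "finite S" and or: "orientation (medges M) S" and F: "F \<in> links V S"
    and V: "\<And>s. s \<in> S \<Longrightarrow> src s \<in> V \<and> tgt s \<in> V"
begin

lemma links_V: "F \<subseteq> S \<times> S" "single_valued F" "single_valued (F\<inverse>)" "Domain F = S" "Range F = S"
proof -
  have "{s \<in> S. tgt s \<in> V} = S" "{s \<in> S. src s \<in> V} = S" using V by blast+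
  then show "F \<subseteq> S \<times> S" "single_valued F" "single_valued (F\<inverse>)" "Domain F = S" "Range F = S"
    using F by (simp_all add: links_def)
qed

lemma cycles_subset: "xs \<in> cycles F \<Longrightarrow> set xs \<subseteq> S"
proof -
  assume xs: "xs \<in> cycles F"
  then have "hd xs \<in> S" using links_V(5) by (auto simp: cycles_def)
  then obtain ys where "ys \<in> cycles F" "hd ys = hd xs" "set ys \<subseteq> S"
    using cycle_exists[OF fin links_V(1,3,4)] by metis
  then show ?thesis using cycle_eqI[OF links_V(2) xs] by metis
qed

lemma cycle_rooted_loop:
  assumes xs: "xs \<in> cycles F"
  shows "rooted_loop M xs"
proof -
  have sub: "set xs \<subseteq> S" using xs by (rule cycles_subset)
  have ne: "xs \<noteq> []" and c: "chain F xs" "(last xs, hd xs) \<in> F" "distinct xs" using xs by (auto simp: cycles_def)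
  have "(xs ! i, xs ! (Suc i mod length xs)) \<in> F" if "i < length xs" for i
  proof (cases "Suc i < length xs")
    case True
    then show ?thesis using successively_nth[OF c(1)] by simp
  next
    case False
    then have "Suc i = length xs" using that by simp
    then have "i = length xs - 1" "Suc i mod length xs = 0" by simp_all
    then show ?thesis using c(2) ne by (simp add: last_conv_nth hd_conv_nth)
  qed
  then have "tgt (xs ! i) = src (xs ! (Suc i mod length xs))" if "i < length xs" for i
    using that F unfolding links_def by fastforce
  moreover have "distinct (map step_edge xs)"
    using c(3) sub or by (auto simp: distinct_map orientation_def intro: inj_on_subset)
  ultimately show ?thesis
    using sub or ne by (auto simp: rooted_loop_def orientation_def)
qed

lemma cycles_share:
  assumes xs: "xs \<in> cycles F" and ys: "ys \<in> cycles F" and s: "s \<in> set xs" "s \<in> set ys"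
  shows "unroot xs = unroot ys"
proof -
  obtain n where n: "hd (rotate n xs) = s" using s(1) by (rule ex_rotation_hd)
  obtain m where m: "hd (rotate m ys) = s" using s(2) by (rule ex_rotation_hd)
  have "rotate n xs = rotate m ys"
    using n m xs ys by (intro cycle_eqI[OF links_V(2)]) (simp_all add: rotate_cycle)
  then show ?thesis by (metis unroot_rotate)
qed

lemma Union_unroot_cycles: "\<Union>(unroot ` cycles F) = cycles F"
  using unroot_self rotate_cycle by (fastforce simp: unroot_def)

lemma steps_unroot_cycles: "\<Union>(steps ` unroot ` cycles F) = S"
proof
  show "\<Union>(steps ` unroot ` cycles F) \<subseteq> S" using cycles_subset by (auto simp: steps_unroot)
  show "S \<subseteq> \<Union>(steps ` unroot ` cycles F)"
  proof
    fix s assume "s \<in> S"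
    then obtain xs where "xs \<in> cycles F" "hd xs = s" using cycle_exists[OF fin links_V(1,3,4)] by metis
    then show "s \<in> \<Union>(steps ` unroot ` cycles F)" by (auto simp: steps_unroot cycles_def)
  qed
qed

text \<open>With links at all vertices of \<open>V\<close> the relation is a permutation of
  \<open>S\<close>, whose cycles partition the steps. As \<open>S\<close> is an orientation, they
  then partition the edge copies too.\<close>

lemma covering_loops_cycles: "covering_loops M (unroot ` cycles F)"
  unfolding covering_loops_def
proof (intro conjI ballI)
  show "unroot ` cycles F \<subseteq> loops_on M" using cycle_rooted_loop by (auto simp: loops_on_def)
  fix d assume "d \<in> medges M"
  then obtain s where s: "s \<in> S" "d = step_edge s" using or by (auto simp: orientation_def)
  have iff: "d \<in> step_edge ` steps (unroot xs) \<longleftrightarrow> s \<in> set xs" if "xs \<in> cycles F" for xs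
    using cycles_subset[OF that] s or by (auto simp: steps_unroot orientation_def dest: inj_onD)
  obtain xs where xs: "xs \<in> cycles F" "s \<in> set xs"
    using s(1) steps_unroot_cycles by (auto simp: steps_unroot)
  show "\<exists>!l. l \<in> unroot ` cycles F \<and> d \<in> step_edge ` steps l"
  proof (rule ex1I)
    show "unroot xs \<in> unroot ` cycles F \<and> d \<in> step_edge ` steps (unroot xs)"
      using xs iff by blast
    fix l assume "l \<in> unroot ` cycles F \<and> d \<in> step_edge ` steps l"
    then obtain ys where "ys \<in> cycles F" "l = unroot ys" "s \<in> set ys" using iff by auto
    then show "l = unroot xs" using cycles_share xs by metis
  qed
qed

lemma successions_cycles: "successions (unroot ` cycles F) = F"
proof (intro equalityI subrelI)
  fix s t assume "(s, t) \<in> successions (unroot ` cycles F)"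
  then show "(s, t) \<in> F"
    unfolding successions_def Union_unroot_cycles by (auto simp: cycles_def)
next
  fix s t assume st: "(s, t) \<in> F"
  then have "s \<in> S" using links_V(1) by auto
  then obtain xs where xs: "xs \<in> cycles F" "s \<in> set xs"
    using steps_unroot_cycles by (auto simp: steps_unroot)
  obtain n where n: "last (rotate n xs) = s" using xs(2) by (rule ex_rotation_last)
  have c: "rotate n xs \<in> cycles F" using xs by (simp add: rotate_cycle)
  then have "(s, hd (rotate n xs)) \<in> F" using n by (auto simp: cycles_def)
  then have "t = hd (rotate n xs)" using st links_V(2) by (auto dest: single_valuedD)
  then show "(s, t) \<in> successions (unroot ` cycles F)"
    using c n unfolding successions_def Union_unroot_cycles by blast
qed

end

lemma orientation_finite: "finite D \<Longrightarrow> orientation D S \<Longrightarrow> finite S"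
  by (auto simp: orientation_def dest: finite_imageD)

text \<open>Replaces families of unrooted loops by pairs of an orientation and a linking, which can
  be counted vertex by vertex and modified locally. The inverse takes the cycles of the
  linking.\<close>

lemma bij_betw_successions:
  assumes fin: "finite (medges M)"
    and V: "\<And>s. step_edge s \<in> medges M \<Longrightarrow> src s \<in> V \<and> tgt s \<in> V"
  shows "bij_betw (\<lambda>L. (\<Union>(steps ` L), successions L)) {L. covering_loops M L}
           (SIGMA S:{S. orientation (medges M) S}. links V S)"
proof (rule bij_betw_byWitness[where f' = "\<lambda>(S, F). unroot ` cycles F"])
  have V': "src s \<in> V \<and> tgt s \<in> V" if "orientation (medges M) S" "s \<in> S" for S s
    using that(1) imageI[OF that(2), of step_edge] V by (simp add: orientation_def)
  show "\<forall>L\<in>{L. covering_loops M L}. (case (\<Union>(steps ` L), successions L) of (S, F) \<Rightarrow> unroot ` cycles F) = L"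
    by (simp add: cycles_successions_eq unroot_image_Union)
  have inv: "successions (unroot ` cycles F) = F" "\<Union>(steps ` unroot ` cycles F) = S"
    "covering_loops M (unroot ` cycles F)"
    if "orientation (medges M) S" "F \<in> links V S" for S F
    using that V' orientation_finite[OF fin]
      successions_cycles[of S M F V] steps_unroot_cycles[of S M F V]
      covering_loops_cycles[of S M F V]
    by simp_all
  show "\<forall>x\<in>SIGMA S:{S. orientation (medges M) S}. links V S.
     (\<lambda>L. (\<Union>(steps ` L), successions L)) (case x of (S, F) \<Rightarrow> unroot ` cycles F) = x"
    using inv(1,2) by (simp add: split_beta)
  show "(\<lambda>(S, F). unroot ` cycles F) ` (SIGMA S:{S. orientation (medges M) S}. links V S)
          \<subseteq> {L. covering_loops M L}"
    using inv(3) by clarsimp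
  show "(\<lambda>L. (\<Union>(steps ` L), successions L)) ` {L. covering_loops M L}
          \<subseteq> (SIGMA S:{S. orientation (medges M) S}. links V S)"
    using orientation_steps successions_links[OF _ V] by auto
qed

lemma list_pairs_set_tl: "(s, t) \<in> list_pairs p \<Longrightarrow> t \<in> set (tl p)"
  unfolding list_pairs_def by (rule set_zip_rightD)

text \<open>A piece does not visit \<open>a\<close> or \<open>b\<close> in its interior, so all its
  links are at vertices of \<open>W\<close>; it starts and ends at unlinked vertices, so it cannot
  be extended. This identifies pieces of loops with open components after cutting at
  \<open>a\<close> and \<open>b\<close>.\<close>

lemma pieces_eq_max_chains:
  assumes fin: "finite (medges M)"
    and V: "\<And>s. step_edge s \<in> medges M \<Longrightarrow> src s \<in> V \<and> tgt s \<in> V"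
    and cov: "covering_loops M (loops \<omega>)"
    and W: "W = V - {a, b}"
  shows "pieces a b \<omega> =
    {p \<in> max_chains {(s, t) \<in> successions (loops \<omega>). tgt s \<in> W} (\<Union>(steps ` loops \<omega>)).
       src (hd p) = a \<and> tgt (last p) = b}"
proof -
  define L where "L = loops \<omega>"
  define S where "S = \<Union>(steps ` L)"
  define F where "F = successions L"
  let ?F = "{(s, t) \<in> F. tgt s \<in> W}"
  have cov: "covering_loops M L" using cov by (simp add: L_def)
  have cyc: "cycles F = \<Union>L" unfolding F_def using cov by (rule cycles_successions_eq)
  have or: "orientation (medges M) S" unfolding S_def using cov by (rule orientation_steps)
  have finS: "finite S" using fin or by (rule orientation_finite)
  have V': "src s \<in> V \<and> tgt s \<in> V" if "s \<in> S" for s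
    using or imageI[OF that, of step_edge] V by (simp add: orientation_def)
  have F: "F \<in> links V S" unfolding F_def S_def using cov V by (rule successions_links)
  have lV: "F \<subseteq> S \<times> S" "single_valued F" "single_valued (F\<inverse>)" "Domain F = S" "Range F = S"
    using links_V[OF finS or F V'] by simp_all
  have F_tgt: "tgt s = src t" if "(s, t) \<in> F" for s t using F that unfolding links_def by blast
  have sv: "single_valued ?F" "single_valued (?F\<inverse>)"
    using lV(2,3) unfolding single_valued_def by blast+
  have ends: "hd p \<notin> Range ?F" "last p \<notin> Domain ?F" if "src (hd p) = a" "tgt (last p) = b" for p
    using that F_tgt W by auto
  have "(\<exists>l\<in>L. \<exists>xs\<in>l. prefix p xs) \<and> (\<forall>s\<in>set (tl p). src s \<noteq> a \<and> src s \<noteq> b) \<longleftrightarrow> p \<in> max_chains ?F S"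
    if p: "p \<noteq> []" "src (hd p) = a" "tgt (last p) = b" for p
  proof
    assume asm: "(\<exists>l\<in>L. \<exists>xs\<in>l. prefix p xs) \<and> (\<forall>s\<in>set (tl p). src s \<noteq> a \<and> src s \<noteq> b)"
    then obtain xs r where xs: "xs \<in> cycles F" "xs = p @ r" using cyc by (auto simp: prefix_def)
    then have "set p \<subseteq> S" using cycles_subset[OF finS or F V' xs(1)] by auto
    moreover have "list_pairs p \<subseteq> F"
      using xs by (auto simp: cycles_def successively_append_iff simp flip: chain_iff_list_pairs)
    then have "list_pairs p \<subseteq> ?F"
      using list_pairs_set_tl[of _ _ p] F_tgt asm W V' lV(1) by fastforce
    ultimately show "p \<in> max_chains ?F S"
      using ends p unfolding max_chains_def chain_iff_list_pairs by blast
  next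
    assume mc: "p \<in> max_chains ?F S"
    have sub: "?F \<subseteq> S \<times> S" using lV(1) by auto
    have d: "distinct p" using finS sub sv mc by (rule max_chain_distinct)
    have lp: "list_pairs p \<subseteq> ?F" using mc unfolding max_chains_def chain_iff_list_pairs by blast
    then have cp: "chain F p" unfolding chain_iff_list_pairs by blast
    have "hd p \<in> S" using mc p by (auto simp: max_chains_def)
    \<comment> \<open>The loop rooted at the first step of \<open>p\<close>. Both lists follow the
      full linking from the same start, so one is a prefix of the other.\<close>
    then obtain xs where xs: "xs \<in> cycles F" "hd xs = hd p" using cycle_exists[OF finS lV(1,3,4)] by metis
    then have cx: "chain F xs" "xs \<noteq> []" "(last xs, hd xs) \<in> F" by (auto simp: cycles_def)
    have "prefix p xs"
    proof (cases "length p \<le> length xs")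
      case True
      then show ?thesis using chain_prefix[OF lV(2) cp cx(1) p(1) cx(2)] xs(2) by simp
    next
      case False
      then have "prefix xs p" using chain_prefix[OF lV(2) cx(1) cp cx(2) p(1) xs(2)] by simp
      then obtain r where r: "p = xs @ r" by (rule prefixE)
      with False obtain z r' where z: "r = z # r'" by (cases r) auto
      have "(last xs, z) \<in> F" using cp cx(2) r z by (simp add: successively_append_iff)
      then have "z = hd xs" using cx(3) by (rule single_valuedD[OF lV(2)])
      \<comment> \<open>Were \<open>p\<close> longer than the loop, it would run through its own
        first step again, although it is distinct.\<close>
      then show ?thesis using d r z cx(2) by simp
    qed
    then have "\<exists>l\<in>L. \<exists>xs\<in>l. prefix p xs" using xs(1) cyc by blast
    moreover have "src s \<noteq> a \<and> src s \<noteq> b" if s: "s \<in> set (tl p)" for s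
    proof -
      have "s \<in> set p - {hd p}" using s d p by (cases p) auto
      \<comment> \<open>Every step of \<open>p\<close> after the first is entered through a link,
        and the retained links sit at vertices of \<open>W\<close> only.\<close>
      then have "s \<in> Range (list_pairs p)" using p d by (simp add: Range_list_pairs)
      then obtain r where "(r, s) \<in> ?F" using lp by blast
      then show ?thesis using F_tgt W by auto
    qed
    ultimately show "(\<exists>l\<in>L. \<exists>xs\<in>l. prefix p xs) \<and> (\<forall>s\<in>set (tl p). src s \<noteq> a \<and> src s \<noteq> b)"
      by blast
  qed
  moreover have "p \<noteq> []" if "p \<in> max_chains ?F S" for p using that by (simp add: max_chains_def)
  ultimately show ?thesis
    unfolding pieces_def L_def[symmetric] S_def[symmetric] F_def[symmetric] by blast
qed

section \<open>Counting links and reversing segments\<close>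

text \<open>Relative to one fixed bijection \<open>g\<close> from \<open>A\<close> to
  \<open>B\<close>, the graphs of all bijections correspond to the permutations of
  \<open>A\<close>.\<close>

lemma card_bijective_relations:
  assumes fin: "finite A" "finite B" and card: "card A = card B"
  shows "card {F. single_valued F \<and> single_valued (F\<inverse>) \<and> Domain F = A \<and> Range F = B}
           = fact (card A)"
proof -
  let ?X = "{F. single_valued F \<and> single_valued (F\<inverse>) \<and> Domain F = A \<and> Range F = B}"
  obtain g where g: "bij_betw g A B" using finite_same_card_bij fin card by blast
  then have ginj: "inj_on g A" and gim: "g ` A = B" by (auto simp: bij_betw_def)
  let ?f = "\<lambda>p. (\<lambda>s. (s, g (p s))) ` A"
  have "bij_betw ?f {p. p permutes A} ?X"
  proof (rule bij_betw_imageI)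
    show "inj_on ?f {p. p permutes A}"
    proof (rule inj_onI)
      fix p q assume p: "p \<in> {p. p permutes A}" and q: "q \<in> {p. p permutes A}" and eq: "?f p = ?f q"
      show "p = q"
      proof
        fix s
        show "p s = q s"
        proof (cases "s \<in> A")
          case True
          then have "(s, g (p s)) \<in> ?f q" using eq by blast
          then have "g (p s) = g (q s)" by auto
          moreover have "p s \<in> A" "q s \<in> A" using p q True by (auto simp: permutes_in_image)
          ultimately show ?thesis using ginj by (auto dest: inj_onD)
        next
          case False
          then show ?thesis using p q by (simp add: permutes_not_in)
        qed
      qed
    qed
    show "?f ` {p. p permutes A} = ?X"
    proof (intro equalityI subsetI)
      fix F assume "F \<in> ?f ` {p. p permutes A}"
      then obtain p where p: "p permutes A" and F: "F = ?f p" by blast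
      have im: "p ` A = A" using p by (rule permutes_image)
      have "inj_on (\<lambda>s. g (p s)) A"
        using comp_inj_on[of p A g] permutes_inj_on[OF p, of A] ginj im by (simp add: o_def)
      then have "single_valued (F\<inverse>)" unfolding F by (auto simp: single_valued_def dest: inj_onD)
      moreover have "single_valued F" unfolding F by (auto simp: single_valued_def)
      moreover have "Domain F = A" unfolding F by (simp add: Domain_fst image_image)
      moreover have "Range F = (\<lambda>s. g (p s)) ` A" unfolding F by (simp add: Range_snd image_image)
      then have "Range F = B" using im gim by (metis image_image)
      ultimately show "F \<in> ?X" by simp
    next
      fix F assume "F \<in> ?X"
      then have sv: "single_valued F" "single_valued (F\<inverse>)" and D: "Domain F = A" "Range F = B" by auto
      define h where "h s = (THE t. (s, t) \<in> F)" for s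
      have h: "(s, t) \<in> F \<longleftrightarrow> t = h s" if s: "s \<in> A" for s t
      proof -
        obtain u where u: "(s, u) \<in> F" using s D by blast
        then have eq: "t = u" if "(s, t) \<in> F" for t using that by (rule single_valuedD[OF sv(1), rotated])
        then have "h s = u" unfolding h_def using u by (intro the_equality)
        then show ?thesis using u eq by blast
      qed
      have hbij: "bij_betw h A B"
      proof (rule bij_betw_imageI)
        show "inj_on h A"
        proof (rule inj_onI)
          fix s t assume "s \<in> A" "t \<in> A" "h s = h t"
          then have "(s, h s) \<in> F" "(t, h s) \<in> F" using h by simp_all
          then show "s = t" using single_valuedD[OF sv(2), of "h s"] by simp
        qed
        show "h ` A = B"
        proof (intro equalityI subsetI)
          fix t assume "t \<in> h ` A"
          then obtain s where "s \<in> A" "t = h s" by blast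
          then have "(s, t) \<in> F" using h by simp
          then show "t \<in> B" using D by blast
        next
          fix t assume "t \<in> B"
          then obtain s where s: "(s, t) \<in> F" using D by blast
          then have "s \<in> A" using D by blast
          then show "t \<in> h ` A" using s h by blast
        qed
      qed
      define p where "p s = (if s \<in> A then inv_into A g (h s) else s)" for s
      have "bij_betw (inv_into A g \<circ> h) A A"
        using hbij bij_betw_inv_into[OF g] by (rule bij_betw_trans)
      then have "bij_betw p A A"
        by (rule bij_betw_cong[THEN iffD1, rotated]) (simp add: p_def)
      then have perm: "p permutes A" by (rule bij_imp_permutes) (simp add: p_def)
      have gp: "g (p s) = h s" if "s \<in> A" for s
      proof -
        have "h s \<in> g ` A" using that hbij gim by (auto simp: bij_betw_def)
        then show ?thesis using that by (simp add: p_def f_inv_into_f)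
      qed
      have "F = ?f p"
      proof (intro equalityI subrelI)
        fix s t assume "(s, t) \<in> F"
        moreover from this have "s \<in> A" using D by blast
        ultimately show "(s, t) \<in> ?f p" using h gp by auto
      next
        fix s t assume "(s, t) \<in> ?f p"
        then show "(s, t) \<in> F" using h gp by auto
      qed
      then show "F \<in> ?f ` {p. p permutes A}" using perm by blast
    qed
  qed
  then have "card ?X = card {p. p permutes A}" by (simp add: bij_betw_same_card)
  also have "\<dots> = fact (card A)" using fin(1) by (simp add: card_permutations)
  finally show ?thesis .
qed

lemma linksD:
  assumes "F \<in> links W S"
  shows "F \<subseteq> S \<times> S" "single_valued F" "single_valued (F\<inverse>)" "(s, t) \<in> F \<Longrightarrow> tgt s = src t"
    "Domain F = {s \<in> S. tgt s \<in> W}" "Range F = {t \<in> S. src t \<in> W}"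
  using assms unfolding links_def by fast+

lemma linksI:
  assumes "single_valued F" "single_valued (F\<inverse>)" "\<And>s t. (s, t) \<in> F \<Longrightarrow> tgt s = src t"
    "Domain F = {s \<in> S. tgt s \<in> W}" "Range F = {t \<in> S. src t \<in> W}"
  shows "F \<in> links W S"
proof -
  have "F \<subseteq> Domain F \<times> Range F" by auto
  also have "\<dots> \<subseteq> S \<times> S" using assms(4,5) by blast
  finally show ?thesis using assms by (auto simp: links_def)
qed

lemma finite_links: "finite S \<Longrightarrow> finite (links W S)"
  by (rule finite_subset[of _ "Pow (S \<times> S)"]) (auto simp: links_def)

lemma links_empty: "links {} S = {{}}"
proof (intro equalityI subsetI)
  fix F assume "F \<in> links {} S"
  then have "Domain F = {}" using linksD(5) by fastforce
  then show "F \<in> {{}}" by (simp add: Domain_empty_iff)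
qed (auto simp: links_def)

text \<open>All steps into \<open>v\<close> may be followed by any step out of \<open>v\<close>, so
  the matching condition \<open>tgt s = src t\<close> is automatic and a linking is an arbitrary
  bijection.\<close>

lemma card_links_single:
  assumes "finite S" "card {s \<in> S. tgt s = v} = card {s \<in> S. src s = v}"
  shows "card (links {v} S) = fact (card {s \<in> S. src s = v})"
proof -
  have "links {v} S = {F. single_valued F \<and> single_valued (F\<inverse>) \<and>
          Domain F = {s \<in> S. tgt s = v} \<and> Range F = {s \<in> S. src s = v}}" (is "_ = ?X")
  proof (intro equalityI subsetI)
    fix F assume F: "F \<in> links {v} S"
    show "F \<in> ?X" using linksD(2,3,5,6)[OF F] by simp
  next
    fix F assume F: "F \<in> ?X"
    then have "tgt s = src t" if "(s, t) \<in> F" for s t using DomainI[OF that] RangeI[OF that] by simp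
    with F show "F \<in> links {v} S" by (intro linksI) auto
  qed
  then show ?thesis using card_bijective_relations[of "{s \<in> S. tgt s = v}" "{s \<in> S. src s = v}"] assms by simp
qed

definition links_at :: "'v set \<Rightarrow> ('v step \<times> 'v step) set \<Rightarrow> ('v step \<times> 'v step) set" where
  "links_at W F = {(s, t) \<in> F. tgt s \<in> W}"

lemma links_at_in: "F \<in> links W' S \<Longrightarrow> W \<subseteq> W' \<Longrightarrow> links_at W F \<in> links W S"
proof (rule linksI)
  assume F: "F \<in> links W' S" and W: "W \<subseteq> W'"
  note F = linksD[OF F]
  have sub: "links_at W F \<subseteq> F" by (auto simp: links_at_def)
  show "single_valued (links_at W F)" using F(2) sub by (rule single_valued_subset[rotated])
  show "single_valued ((links_at W F)\<inverse>)"
    using F(3) sub by (intro single_valued_subset[of "(links_at W F)\<inverse>" "F\<inverse>"]) auto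
  show "tgt s = src t" if "(s, t) \<in> links_at W F" for s t using that F(4) sub by blast
  show "Domain (links_at W F) = {s \<in> S. tgt s \<in> W}"
  proof (intro equalityI subsetI)
    fix s assume "s \<in> {s \<in> S. tgt s \<in> W}"
    then have s: "s \<in> S" "tgt s \<in> W" by auto
    then have "s \<in> Domain F" using F(5) W by blast
    then show "s \<in> Domain (links_at W F)" using s by (auto simp: links_at_def)
  next
    fix s assume "s \<in> Domain (links_at W F)"
    then have "s \<in> Domain F" "tgt s \<in> W" by (auto simp: links_at_def)
    then show "s \<in> {s \<in> S. tgt s \<in> W}" using F(5) by blast
  qed
  show "Range (links_at W F) = {s \<in> S. src s \<in> W}"
  proof (intro equalityI subsetI)
    fix t assume "t \<in> {s \<in> S. src s \<in> W}"
    then have t: "t \<in> S" "src t \<in> W" by auto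
    then have "t \<in> Range F" using F(6) W by blast
    then obtain s where s: "(s, t) \<in> F" by blast
    then have "tgt s \<in> W" using t F(4) by simp
    then show "t \<in> Range (links_at W F)" using s by (auto simp: links_at_def)
  next
    fix t assume "t \<in> Range (links_at W F)"
    then obtain s where s: "(s, t) \<in> F" "tgt s \<in> W" by (auto simp: links_at_def)
    then have "t \<in> Range F" "src t \<in> W" using F(4)[of s t] by auto
    then show "t \<in> {s \<in> S. src s \<in> W}" using F(6) by blast
  qed
qed

text \<open>A link sits at a single vertex, the target of its first and source of its second step.
  Choices at disjoint sets of vertices are therefore independent, which makes the number of linkings
  a product over the vertices.\<close>

lemma bij_betw_links_Un:
  assumes "W1 \<inter> W2 = {}"
  shows "bij_betw (\<lambda>F. (links_at W1 F, links_at W2 F)) (links (W1 \<union> W2) S) (links W1 S \<times> links W2 S)"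
proof (rule bij_betw_byWitness[where f' = "\<lambda>(F, G). F \<union> G"])
  have Un: "links_at W1 F \<union> links_at W2 F = F" if "F \<in> links (W1 \<union> W2) S" for F
  proof -
    have "tgt s \<in> W1 \<union> W2" if "(s, t) \<in> F" for s t
      using DomainI[OF that] linksD(5)[OF \<open>F \<in> _\<close>] by blast
    then show ?thesis by (auto simp: links_at_def)
  qed
  then show "\<forall>F\<in>links (W1 \<union> W2) S. (case (links_at W1 F, links_at W2 F) of (F, G) \<Rightarrow> F \<union> G) = F"
    by simp
  have at: "F \<union> G \<in> links (W1 \<union> W2) S \<and> links_at W1 (F \<union> G) = F \<and> links_at W2 (F \<union> G) = G"
    if F: "F \<in> links W1 S" and G: "G \<in> links W2 S" for F G
  proof -
    note F' = linksD[OF F] and G' = linksD[OF G]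
    have "Domain F \<inter> Domain G = {}" "Domain (F\<inverse>) \<inter> Domain (G\<inverse>) = {}"
      using F'(5,6) G'(5,6) assms by auto
    then have "single_valued (F \<union> G)" "single_valued ((F \<union> G)\<inverse>)"
      unfolding converse_Un using F'(2,3) G'(2,3) by (auto intro!: single_valued_Un)
    moreover have "tgt s = src t" if "(s, t) \<in> F \<union> G" for s t using that F'(4) G'(4) by blast
    moreover have "Domain (F \<union> G) = {s \<in> S. tgt s \<in> W1 \<union> W2}"
      "Range (F \<union> G) = {s \<in> S. src s \<in> W1 \<union> W2}"
      unfolding Domain_Un_eq Range_Un_eq F'(5,6) G'(5,6) by auto
    ultimately have "F \<union> G \<in> links (W1 \<union> W2) S" by (rule linksI)
    moreover have "tgt s \<in> W1 - W2" if "(s, t) \<in> F" for s t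
      using DomainI[OF that] F'(5) assms by blast
    moreover have "tgt s \<in> W2 - W1" if "(s, t) \<in> G" for s t
      using DomainI[OF that] G'(5) assms by blast
    ultimately show ?thesis by (auto simp: links_at_def)
  qed
  then show "\<forall>x\<in>links W1 S \<times> links W2 S.
      (\<lambda>F. (links_at W1 F, links_at W2 F)) (case x of (F, G) \<Rightarrow> F \<union> G) = x"
    by (simp add: split_beta mem_Times_iff)
  show "(\<lambda>(F, G). F \<union> G) ` (links W1 S \<times> links W2 S) \<subseteq> links (W1 \<union> W2) S"
    using at by auto
  show "(\<lambda>F. (links_at W1 F, links_at W2 F)) ` links (W1 \<union> W2) S \<subseteq> links W1 S \<times> links W2 S"
    using links_at_in by (auto simp: subset_eq)
qed

lemma card_links:
  assumes "finite W" "finite S" "\<And>v. v \<in> W \<Longrightarrow> card {s \<in> S. tgt s = v} = card {s \<in> S. src s = v}"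
  shows "card (links W S) = (\<Prod>v\<in>W. fact (card {s \<in> S. src s = v}))"
  using assms(1,3)
proof (induction W rule: finite_induct)
  case (insert v W)
  then have "{v} \<inter> W = {}" by simp
  then have "card (links ({v} \<union> W) S) = card (links {v} S) * card (links W S)"
    using bij_betw_same_card[OF bij_betw_links_Un[of "{v}" W S]] by (simp add: card_cartesian_product)
  then show ?case using insert card_links_single[OF assms(2)] by simp
qed (simp add: links_empty)

section \<open>Reversal of a segment\<close>

definition flip_colour :: "colour \<Rightarrow> colour" where
  "flip_colour c = (case c of Red \<Rightarrow> Blue | Blue \<Rightarrow> Red)"

lemma flip_colour_flip [simp]: "flip_colour (flip_colour c) = c"
  by (cases c) (simp_all add: flip_colour_def)

definition rev_step :: "'v step \<Rightarrow> 'v step" where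
  "rev_step s = Step (tgt s) (src s) (lab s)"

lemma rev_step_simps [simp]:
  "src (rev_step s) = tgt s" "tgt (rev_step s) = src s" "rev_step (rev_step s) = s"
  "step_edge (rev_step s) = step_edge s"
  by (simp_all add: rev_step_def step_edge_def insert_commute)

lemma inj_rev_step: "inj rev_step"
  by (rule inj_on_inverseI[of _ rev_step]) simp

definition rev_path :: "'v step list \<Rightarrow> 'v step list" where
  "rev_path p = rev (map rev_step p)"

lemma rev_path_simps [simp]:
  "rev_path (rev_path p) = p" "set (rev_path p) = rev_step ` set p"
  "distinct (rev_path p) = distinct p" "rev_path p = [] \<longleftrightarrow> p = []"
  by (simp_all add: rev_path_def rev_map comp_def distinct_map inj_on_subset[OF inj_rev_step])

lemma rev_path_ends:
  "p \<noteq> [] \<Longrightarrow> hd (rev_path p) = rev_step (last p)"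
  "p \<noteq> [] \<Longrightarrow> last (rev_path p) = rev_step (hd p)"
  by (simp_all add: rev_path_def hd_rev last_rev last_map hd_map)

lemma list_pairs_rev_path: "list_pairs (rev_path p) = {(rev_step t, rev_step s) | s t. (s, t) \<in> list_pairs p}"
  unfolding rev_path_def list_pairs_rev list_pairs_map by force

definition reverse_steps :: "'v step list \<Rightarrow> 'v step set \<Rightarrow> 'v step set" where
  "reverse_steps p S = (S - set p) \<union> set (rev_path p)"

definition reverse_links :: "'v step list \<Rightarrow> ('v step \<times> 'v step) set \<Rightarrow> ('v step \<times> 'v step) set" where
  "reverse_links p F = (F - list_pairs p) \<union> list_pairs (rev_path p)"

definition flip_colours ::
    "'v step list \<Rightarrow> ('v set \<times> nat \<Rightarrow> colour) \<Rightarrow> 'v set \<times> nat \<Rightarrow> colour" where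
  "flip_colours p col d = (if d \<in> step_edge ` set p then flip_colour (col d) else col d)"

lemma flip_colours_rev_path: "flip_colours (rev_path p) (flip_colours p col) = col"
  by (auto simp: flip_colours_def fun_eq_iff image_image)

text \<open>The setting for reversing one open component \<open>p\<close> of a linked orientation.
  The condition \<open>proper\<close> excludes edges from a vertex to itself, so that a step differs
  from its reversal.\<close>

context
  fixes D :: "('v set \<times> nat) set" and S W F p
  assumes fin: "finite S" and or: "orientation D S" and proper: "\<And>s. s \<in> S \<Longrightarrow> src s \<noteq> tgt s"
    and F: "F \<in> links W S" and p: "p \<in> max_chains F S"
begin

lemma reverse_path_basics:
  shows "p \<noteq> []" "distinct p" "set p \<subseteq> S" "list_pairs p \<subseteq> F"
    "F - list_pairs p \<subseteq> (S - set p) \<times> (S - set p)"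
    "set (rev_path p) \<inter> S = {}"
proof -
  show "p \<noteq> []" "set p \<subseteq> S" using p by (auto simp: max_chains_def)
  show "distinct p" using max_chain_distinct fin linksD(1-3)[OF F] p by blast
  show "list_pairs p \<subseteq> F" "F - list_pairs p \<subseteq> (S - set p) \<times> (S - set p)"
    using max_chains_Diff_list_pairs[OF linksD(1)[OF F] fin linksD(2,3)[OF F] p] by simp_all
  \<comment> \<open>A step and its reversal traverse the same copy, which an orientation does only
    once. So the reversed path consists of fresh steps and can be glued in as a new
    component.\<close>
  have "rev_step s \<notin> S" if "s \<in> S" for s
  proof
    assume "rev_step s \<in> S"
    then have "rev_step s = s"
      using or that inj_onD[of step_edge S "rev_step s" s] by (simp add: orientation_def)
    then have "src (rev_step s) = src s" by (rule arg_cong)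
    then show False using proper[OF that] by simp
  qed
  then show "set (rev_path p) \<inter> S = {}" using \<open>set p \<subseteq> S\<close> by auto
qed

lemma orientation_reverse: "orientation D (reverse_steps p S)"
proof -
  have inj: "inj_on step_edge S" using or by (simp add: orientation_def)
  then have "step_edge ` (S - set p) \<inter> step_edge ` set p = {}"
    using reverse_path_basics(3) by (subst inj_on_image_Int[OF inj, symmetric]) auto
  moreover have "inj_on step_edge (rev_step ` set p)"
    using inj_on_subset[OF inj reverse_path_basics(3)] by (intro inj_on_imageI) (simp add: comp_def)
  moreover have "inj_on step_edge (S - set p)" using inj by (rule inj_on_subset) blast
  moreover have "step_edge ` rev_step ` set p = step_edge ` set p" by (simp add: image_image)
  ultimately have "inj_on step_edge (reverse_steps p S)"
    unfolding reverse_steps_def inj_on_Un rev_path_simps by blast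
  moreover have "step_edge ` reverse_steps p S = step_edge ` S"
    using reverse_path_basics(3) by (auto simp: reverse_steps_def image_Un image_image)
  ultimately show ?thesis using or by (simp add: orientation_def)
qed

lemma links_reverse: "reverse_links p F \<in> links W (reverse_steps p S)"
proof (rule linksI)
  note b = reverse_path_basics and F' = linksD[OF F]
  let ?F1 = "F - list_pairs p" and ?G = "list_pairs (rev_path p)"
  have G: "?G \<subseteq> set (rev_path p) \<times> set (rev_path p)" by (rule list_pairs_subset)
  have disj: "Domain ?F1 \<inter> Domain ?G = {}" "Domain (?F1\<inverse>) \<inter> Domain (?G\<inverse>) = {}"
    using G b(5,6) by blast+
  have d: "distinct (rev_path p)" using b by simp
  have "single_valued ?F1" "single_valued (?F1\<inverse>)"
    using F'(2,3) by (auto intro: single_valued_subset)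
  then show "single_valued (reverse_links p F)" "single_valued ((reverse_links p F)\<inverse>)"
    unfolding reverse_links_def converse_Un
    using single_valued_Un[OF _ single_valued_list_pairs[OF d] disj(1)]
      single_valued_Un[OF _ single_valued_list_pairs_converse[OF d] disj(2)]
    by blast+
  show "tgt s = src t" if st: "(s, t) \<in> reverse_links p F" for s t
  proof -
    consider "(s, t) \<in> F" | u v where "(u, v) \<in> list_pairs p" "s = rev_step v" "t = rev_step u"
      using st unfolding reverse_links_def list_pairs_rev_path by blast
    then show ?thesis
    proof cases
      case 1
      then show ?thesis by (rule F'(4))
    next
      case 2
      then have "tgt u = src v" using b(4) F'(4) by blast
      then show ?thesis using 2 by simp
    qed
  qed
  \<comment> \<open>The ends of an open component are unlinked and thus outside \<open>W\<close>.
    Reversal exchanges the two ends, and only because both lie outside \<open>W\<close> does the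
    reversed path have exactly the required links.\<close>
  have hl: "src (hd p) \<notin> W" "tgt (last p) \<notin> W"
    using p F'(5,6) subsetD[OF b(3) hd_in_set[OF b(1)]] subsetD[OF b(3) last_in_set[OF b(1)]]
    by (auto simp: max_chains_def)
  have DR: "Domain (list_pairs p) = set p - {last p}" "Range (list_pairs p) = set p - {hd p}"
    using b by (simp_all add: Domain_list_pairs Range_list_pairs)
  have DR': "Domain ?G = rev_step ` (set p - {hd p})" "Range ?G = rev_step ` (set p - {last p})"
    unfolding list_pairs_rev_path DR[symmetric] by blast+
  have W_tgt: "tgt s \<in> W \<longleftrightarrow> s \<noteq> last p" if "s \<in> set p" for s
  proof
    assume "s \<noteq> last p"
    then have "s \<in> Domain F" using that DR(1) b(4) by blast
    then show "tgt s \<in> W" using F'(5) by simp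
  qed (use hl in auto)
  have W_src: "src s \<in> W \<longleftrightarrow> s \<noteq> hd p" if "s \<in> set p" for s
  proof
    assume "s \<noteq> hd p"
    then have "s \<in> Range F" using that DR(2) b(4) by blast
    then show "src s \<in> W" using F'(6) by simp
  qed (use hl in auto)
  have D1: "Domain ?F1 = {s \<in> S - set p. tgt s \<in> W}"
  proof (intro equalityI subsetI)
    fix s assume "s \<in> {s \<in> S - set p. tgt s \<in> W}"
    then have s: "s \<in> Domain F" "s \<notin> set p" using F'(5) by auto
    then obtain t where "(s, t) \<in> F" by blast
    moreover have "(s, t) \<notin> list_pairs p" using s(2) list_pairs_subset[of p] by blast
    ultimately show "s \<in> Domain ?F1" by blast
  next
    fix s assume "s \<in> Domain ?F1"
    then have "s \<in> Domain F" "s \<in> S - set p" using b(5) by blast+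
    then show "s \<in> {s \<in> S - set p. tgt s \<in> W}" using F'(5) by simp
  qed
  have R1: "Range ?F1 = {s \<in> S - set p. src s \<in> W}"
  proof (intro equalityI subsetI)
    fix t assume "t \<in> {s \<in> S - set p. src s \<in> W}"
    then have t: "t \<in> Range F" "t \<notin> set p" using F'(6) by auto
    then obtain s where "(s, t) \<in> F" by blast
    moreover have "(s, t) \<notin> list_pairs p" using t(2) list_pairs_subset[of p] by blast
    ultimately show "t \<in> Range ?F1" by blast
  next
    fix s assume "s \<in> Range ?F1"
    then have "s \<in> Range F" "s \<in> S - set p" using b(5) by blast+
    then show "s \<in> {s \<in> S - set p. src s \<in> W}" using F'(6) by simp
  qed
  show "Domain (reverse_links p F) = {s \<in> reverse_steps p S. tgt s \<in> W}"
    unfolding reverse_links_def reverse_steps_def Domain_Un_eq D1 DR' using W_src by auto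
  show "Range (reverse_links p F) = {s \<in> reverse_steps p S. src s \<in> W}"
    unfolding reverse_links_def reverse_steps_def Range_Un_eq R1 DR' using W_tgt by auto
qed

text \<open>\<open>F\<close> arises from \<open>F - list_pairs p\<close> by gluing in
  \<open>p\<close>, and the reversed relation arises from it by gluing in \<open>rev_path p\<close>;
  all other components are those of the common remainder.\<close>

lemma max_chains_reverse:
  "max_chains (reverse_links p F) (reverse_steps p S) = insert (rev_path p) (max_chains F S - {p})"
proof -
  note b = reverse_path_basics and F' = linksD[OF F]
  let ?F1 = "F - list_pairs p" and ?S1 = "S - set p"
  have sv: "single_valued ?F1" "single_valued (?F1\<inverse>)"
    using F'(2,3) by (auto intro: single_valued_subset)
  have "max_chains (?F1 \<union> list_pairs p) (?S1 \<union> set p) = insert p (max_chains ?F1 ?S1)"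
    using b fin sv by (intro max_chains_Un_list_pairs) auto
  moreover have "?F1 \<union> list_pairs p = F" "?S1 \<union> set p = S" using b(3,4) by blast+
  moreover have "p \<notin> max_chains ?F1 ?S1"
  proof
    assume "p \<in> max_chains ?F1 ?S1"
    then have "set p \<subseteq> ?S1" by (simp add: max_chains_def)
    then show False using hd_in_set[OF b(1)] by blast
  qed
  ultimately have "max_chains ?F1 ?S1 = max_chains F S - {p}" by simp
  moreover have "max_chains (?F1 \<union> list_pairs (rev_path p)) (?S1 \<union> set (rev_path p))
      = insert (rev_path p) (max_chains ?F1 ?S1)"
    using b fin sv by (intro max_chains_Un_list_pairs) auto
  ultimately show ?thesis by (simp add: reverse_links_def reverse_steps_def)
qed

lemma reverse_reverse:
  "reverse_steps (rev_path p) (reverse_steps p S) = S"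
  "reverse_links (rev_path p) (reverse_links p F) = F"
proof -
  note b = reverse_path_basics
  show "reverse_steps (rev_path p) (reverse_steps p S) = S"
    unfolding reverse_steps_def rev_path_simps(1) using b(3,6) by blast
  have "list_pairs (rev_path p) \<inter> F = {}"
    using list_pairs_subset[of "rev_path p"] b(1,6) linksD(1)[OF F] by blast
  then show "reverse_links (rev_path p) (reverse_links p F) = F"
    unfolding reverse_links_def rev_path_simps(1) using b(4) by blast
qed

end

section \<open>Double counting of marked segments\<close>

definition net_flow ::
    "'v step set \<Rightarrow> ('v set \<times> nat \<Rightarrow> colour) \<Rightarrow> colour \<Rightarrow> 'v \<Rightarrow> int" where
  "net_flow S col c v =
     (\<Sum>s\<in>S. of_bool (col (step_edge s) = c) * (of_bool (src s = v) - of_bool (tgt s = v)))"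

text \<open>\<open>k\<close> units of each colour flow from \<open>b\<close> to \<open>a\<close>:
  the net outflow is \<open>k\<close> at \<open>b\<close> and \<open>-k\<close> at \<open>a\<close>.
  This direction is dictated by inserting \<sigma> at \<open>a\<close> and its conjugate at
  \<open>b\<close>. Colourings are extensional on \<open>D\<close> so that there are finitely
  many.\<close>

definition flows ::
    "'v set \<Rightarrow> ('v set \<times> nat) set \<Rightarrow> 'v \<Rightarrow> 'v \<Rightarrow> int \<Rightarrow>
       ('v step set \<times> ('v set \<times> nat \<Rightarrow> colour)) set" where
  "flows V D a b k =
     {(S, col). orientation D S \<and> col \<in> D \<rightarrow>\<^sub>E UNIV \<and>
        (\<forall>v\<in>V. \<forall>c. net_flow S col c v = k * (of_bool (v = b) - of_bool (v = a)))}"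

text \<open>The cut at \<open>a\<close> and \<open>b\<close> is made for every \<open>k\<close>,
  also where linking there would be possible, so that the strengths 0 and 1 can be compared.\<close>

definition linked_flows where
  "linked_flows V D a b k = (SIGMA x:flows V D a b k. links (V - {a, b}) (fst x))"

definition segments where
  "segments F S u w = {p \<in> max_chains F S. src (hd p) = u \<and> tgt (last p) = w}"

lemma sum_list_telescope:
  assumes "p \<noteq> []" "\<And>s t. (s, t) \<in> list_pairs p \<Longrightarrow> tgt s = src t"
  shows "(\<Sum>s\<leftarrow>p. of_bool (src s = v) - of_bool (tgt s = v))
           = (of_bool (src (hd p) = v) - of_bool (tgt (last p) = v) :: int)"
  using assms
proof (induction p rule: induct_list012)
  case (3 x y p)
  have "tgt x = src y" using 3(4) by simp
  moreover have "(\<Sum>s\<leftarrow>y # p. of_bool (src s = v) - of_bool (tgt s = v))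
      = (of_bool (src (hd (y # p)) = v) - of_bool (tgt (last (y # p)) = v) :: int)"
    using 3(4) by (intro 3(2)) simp_all
  ultimately show ?case by simp
qed simp_all

text \<open>The change is the same for both colours: it is minus the net flow of the whole segment
  as an uncoloured path, which telescopes to its two ends.\<close>

lemma net_flow_reverse:
  assumes fin: "finite S" and or: "orientation D S" and proper: "\<And>s. s \<in> S \<Longrightarrow> src s \<noteq> tgt s"
    and F: "F \<in> links W S" and p: "p \<in> max_chains F S"
  shows "net_flow (reverse_steps p S) (flip_colours p col) c v
           = net_flow S col c v - (of_bool (src (hd p) = v) - of_bool (tgt (last p) = v))"
proof -
  note b = reverse_path_basics[OF fin or proper F p, simplified]
  define \<delta> :: "'a step \<Rightarrow> int" where "\<delta> s = of_bool (src s = v) - of_bool (tgt s = v)" for s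
  have inj: "inj_on step_edge S" using or by (simp add: orientation_def)
  have finp: "finite (set p)" by simp
  have disj: "(S - set p) \<inter> rev_step ` set p = {}" using b by auto
  have "net_flow (reverse_steps p S) (flip_colours p col) c v
      = (\<Sum>s\<in>S - set p. of_bool (flip_colours p col (step_edge s) = c) * \<delta> s)
        + (\<Sum>s\<in>rev_step ` set p. of_bool (flip_colours p col (step_edge s) = c) * \<delta> s)"
    unfolding net_flow_def reverse_steps_def rev_path_simps \<delta>_def[symmetric]
    using fin disj by (intro sum.union_disjoint) auto
  also have "(\<Sum>s\<in>S - set p. of_bool (flip_colours p col (step_edge s) = c) * \<delta> s)
      = (\<Sum>s\<in>S - set p. of_bool (col (step_edge s) = c) * \<delta> s)"
  proof (rule sum.cong)
    fix s assume s: "s \<in> S - set p"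
    then have "step_edge s \<notin> step_edge ` set p"
      using b(3) inj_on_image_mem_iff[OF inj] by blast
    then show "of_bool (flip_colours p col (step_edge s) = c) * \<delta> s = of_bool (col (step_edge s) = c) * \<delta> s"
      by (simp add: flip_colours_def)
  qed simp
  also have "(\<Sum>s\<in>rev_step ` set p. of_bool (flip_colours p col (step_edge s) = c) * \<delta> s)
      = (\<Sum>s\<in>set p. of_bool (flip_colour (col (step_edge s)) = c) * \<delta> (rev_step s))"
    by (subst sum.reindex) (auto simp: inj_on_subset[OF inj_rev_step] flip_colours_def intro!: sum.cong)
  \<comment> \<open>A step of colour \<open>c\<close> stops contributing, a loss of
    \<open>\<delta> s\<close>. A step of the other colour now has colour \<open>c\<close> and runs
    backwards, contributing \<open>- \<delta> s\<close>. Either way the change is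
    \<open>- \<delta> s\<close>.\<close>
  also have "\<dots> = (\<Sum>s\<in>set p. of_bool (col (step_edge s) = c) * \<delta> s - \<delta> s)"
  proof (rule sum.cong)
    fix s :: "'a step"
    have "flip_colour x = c \<longleftrightarrow> x \<noteq> c" for x
      by (cases x; cases c) (simp_all add: flip_colour_def)
    then show "of_bool (flip_colour (col (step_edge s)) = c) * \<delta> (rev_step s)
        = of_bool (col (step_edge s) = c) * \<delta> s - \<delta> s"
      by (simp add: \<delta>_def)
  qed simp
  also have "\<dots> = (\<Sum>s\<in>set p. of_bool (col (step_edge s) = c) * \<delta> s) - (\<Sum>s\<in>set p. \<delta> s)"
    by (rule sum_subtractf)
  also have "(\<Sum>s\<in>set p. \<delta> s) = (\<Sum>s\<leftarrow>p. \<delta> s)"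
    using b(2) by (simp add: sum_list_distinct_conv_sum_set)
  also have "\<dots> = of_bool (src (hd p) = v) - of_bool (tgt (last p) = v)"
    unfolding \<delta>_def using b(1,4) linksD(4)[OF F] by (intro sum_list_telescope) auto
  also have "(\<Sum>s\<in>S - set p. of_bool (col (step_edge s) = c) * \<delta> s) +
      ((\<Sum>s\<in>set p. of_bool (col (step_edge s) = c) * \<delta> s)
        - (of_bool (src (hd p) = v) - of_bool (tgt (last p) = v)))
    = net_flow S col c v - (of_bool (src (hd p) = v) - of_bool (tgt (last p) = v))"
    using sum.subset_diff[OF b(3) fin, of "\<lambda>s. of_bool (col (step_edge s) = c) * \<delta> s"]
    by (simp add: net_flow_def \<delta>_def)
  finally show ?thesis .
qed

lemma net_flow_total:
  assumes "finite S"
  shows "net_flow S col Red v + net_flow S col Blue v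
           = int (card {s \<in> S. src s = v}) - int (card {s \<in> S. tgt s = v})"
proof -
  have "of_bool (x = Red) * \<delta> + of_bool (x = Blue) * \<delta> = \<delta>" for x and \<delta> :: int by (cases x) simp_all
  then have "net_flow S col Red v + net_flow S col Blue v = (\<Sum>s\<in>S. of_bool (src s = v) - of_bool (tgt s = v))"
    unfolding net_flow_def by (simp add: sum.distrib[symmetric])
  also have "\<dots> = (\<Sum>s\<in>S. of_bool (src s = v)) - (\<Sum>s\<in>S. of_bool (tgt s = v))"
    by (rule sum_subtractf)
  also have "\<dots> = int (card {s \<in> S. src s = v}) - int (card {s \<in> S. tgt s = v})"
    using assms by (simp add: of_bool_def sum.If_cases Int_def conj_commute)
  finally show ?thesis .
qed

lemma net_flow_eq:
  assumes "finite S"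
  shows "net_flow S col c v = int (card {s \<in> S. src s = v \<and> col (step_edge s) = c})
           - int (card {s \<in> S. tgt s = v \<and> col (step_edge s) = c})"
proof -
  have "net_flow S col c v = (\<Sum>s\<in>S. of_bool (src s = v \<and> col (step_edge s) = c))
      - (\<Sum>s\<in>S. of_bool (tgt s = v \<and> col (step_edge s) = c))"
    unfolding net_flow_def sum_subtractf[symmetric] by (intro sum.cong) auto
  also have "\<dots> = int (card {s \<in> S. src s = v \<and> col (step_edge s) = c})
           - int (card {s \<in> S. tgt s = v \<and> col (step_edge s) = c})"
    using assms by (simp add: of_bool_def sum.If_cases Int_def conj_commute)
  finally show ?thesis .
qed

section \<open>Flows on a fixed finite set of edge copies\<close>

locale multigraph =
  fixes V :: "'v set" and D :: "('v set \<times> nat) set"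
  assumes finite_V: "finite V" and finite_D: "finite D"
    and proper: "step_edge s \<in> D \<Longrightarrow> src s \<in> V \<and> tgt s \<in> V \<and> src s \<noteq> tgt s"
begin

lemma orientationD:
  assumes "orientation D S"
  shows "finite S" "s \<in> S \<Longrightarrow> src s \<in> V \<and> tgt s \<in> V \<and> src s \<noteq> tgt s"
proof -
  show "finite S" using finite_D assms by (rule orientation_finite)
  show "src s \<in> V \<and> tgt s \<in> V \<and> src s \<noteq> tgt s" if "s \<in> S"
    using assms imageI[OF that, of step_edge] by (intro proper) (simp add: orientation_def)
qed

lemma finite_orientations: "finite {S. orientation D S}"
proof -
  have "S \<subseteq> (\<lambda>(v, w, i). Step v w i) ` (V \<times> V \<times> snd ` D)" if S: "orientation D S" for S
  proof
    fix s assume s: "s \<in> S"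
    then have "step_edge s \<in> D" using S by (auto simp: orientation_def)
    then have "lab s \<in> snd ` D" by (force simp: step_edge_def)
    then show "s \<in> (\<lambda>(v, w, i). Step v w i) ` (V \<times> V \<times> snd ` D)"
      using orientationD(2)[OF S s] by (intro image_eqI[of _ _ "(src s, tgt s, lab s)"]) auto
  qed
  then have "{S. orientation D S} \<subseteq> Pow ((\<lambda>(v, w, i). Step v w i) ` (V \<times> V \<times> snd ` D))" by blast
  then show ?thesis by (rule finite_subset) (simp add: finite_V finite_D)
qed

lemma UNIV_colour: "UNIV = {Red, Blue}"
  using colour.exhaust by blast

definition coloured_orientations :: "('v step set \<times> ('v set \<times> nat \<Rightarrow> colour)) set" where
  "coloured_orientations = {(S, col). orientation D S \<and> col \<in> D \<rightarrow>\<^sub>E UNIV}"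

lemma finite_coloured_orientations: "finite coloured_orientations"
proof (rule finite_subset)
  show "coloured_orientations \<subseteq> {S. orientation D S} \<times> (D \<rightarrow>\<^sub>E (UNIV :: colour set))"
    by (auto simp: coloured_orientations_def)
  show "finite ({S. orientation D S} \<times> (D \<rightarrow>\<^sub>E (UNIV :: colour set)))"
    using finite_orientations finite_D by (intro finite_cartesian_product finite_PiE) (auto simp: UNIV_colour)
qed

lemma finite_flows: "finite (flows V D a b k)"
  by (rule finite_subset[OF _ finite_coloured_orientations])
     (auto simp: flows_def coloured_orientations_def)

lemma finite_linked_flows: "finite (linked_flows V D a b k)"
  unfolding linked_flows_def
proof (rule finite_SigmaI[OF finite_flows])
  fix x assume "x \<in> flows V D a b k"
  then have "orientation D (fst x)" by (auto simp: flows_def)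
  then show "finite (links (V - {a, b}) (fst x))" by (intro finite_links orientationD)
qed

lemma flow_degrees:
  assumes "(S, col) \<in> flows V D a b k" "v \<in> V"
  shows "int (card {s \<in> S. src s = v}) - int (card {s \<in> S. tgt s = v})
           = 2 * k * (of_bool (v = b) - of_bool (v = a))"
proof -
  have "orientation D S" using assms by (simp add: flows_def)
  then show ?thesis
    using assms net_flow_total[OF orientationD(1), of S col v] by (simp add: flows_def)
qed

lemma finite_max_chains:
  assumes "orientation D S" "F \<in> links W S"
  shows "finite (max_chains F S)"
proof (rule finite_subset)
  have fin: "finite S" using assms(1) by (rule orientationD)
  show "max_chains F S \<subseteq> {p. set p \<subseteq> S \<and> distinct p}"
    using max_chain_distinct[OF fin linksD(1-3)[OF assms(2)]] by (auto simp: max_chains_def)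
  show "finite {p. set p \<subseteq> S \<and> distinct p}" using fin by (rule finite_subset_distinct)
qed

text \<open>Steps out of \<open>a\<close> are the first steps of segments from \<open>a\<close>, and
  steps into \<open>a\<close> are the last steps of segments to \<open>a\<close>. Segments from
  \<open>a\<close> back to \<open>a\<close> are counted on both sides and cancel.\<close>

lemma segment_count:
  assumes or: "orientation D S" and F: "F \<in> links (V - {a, b}) S" and ab: "a \<in> V" "b \<in> V" "a \<noteq> b"
  shows "int (card (segments F S b a)) - int (card (segments F S a b))
           = int (card {s \<in> S. tgt s = a}) - int (card {s \<in> S. src s = a})"
proof -
  note fin = orientationD(1)[OF or] and V = orientationD(2)[OF or] and F' = linksD[OF F]
  note finc = finite_max_chains[OF or F]
  \<comment> \<open>At any other vertex every incoming and outgoing step is linked, so components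
    start and stop only at the cut vertices.\<close>
  have ends: "src (hd p) \<in> {a, b}" "tgt (last p) \<in> {a, b}" if "p \<in> max_chains F S" for p
  proof -
    have p: "p \<noteq> []" "set p \<subseteq> S" "hd p \<notin> Range F" "last p \<notin> Domain F"
      using that by (simp_all add: max_chains_def)
    have "hd p \<in> S" "last p \<in> S" using hd_in_set[OF p(1)] last_in_set[OF p(1)] p(2) by blast+
    then show "src (hd p) \<in> {a, b}" "tgt (last p) \<in> {a, b}" using p(3,4) V F'(5,6) by auto
  qed
  have "bij_betw hd {p \<in> max_chains F S. src (hd p) = a} {s \<in> S. src s = a}"
  proof (rule bij_betw_imageI)
    show "inj_on hd {p \<in> max_chains F S. src (hd p) = a}"
      using max_chain_eqI_hd[OF F'(2)] by (auto intro: inj_onI)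
    show "hd ` {p \<in> max_chains F S. src (hd p) = a} = {s \<in> S. src s = a}"
    proof (intro equalityI subsetI)
      fix s assume s: "s \<in> {s \<in> S. src s = a}"
      then have "s \<in> S" "s \<notin> Range F" using F'(6) by auto
      then obtain p where "p \<in> max_chains F S" "hd p = s"
        using max_chain_exists_hd[OF fin F'(1,3)] by metis
      then show "s \<in> hd ` {p \<in> max_chains F S. src (hd p) = a}" using s by auto
    qed (auto simp: max_chains_def dest!: hd_in_set)
  qed
  then have out: "card {p \<in> max_chains F S. src (hd p) = a} = card {s \<in> S. src s = a}"
    by (rule bij_betw_same_card)
  have "bij_betw last {p \<in> max_chains F S. tgt (last p) = a} {s \<in> S. tgt s = a}"
  proof (rule bij_betw_imageI)
    show "inj_on last {p \<in> max_chains F S. tgt (last p) = a}"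
      using max_chain_eqI_last[OF F'(3)] by (auto intro: inj_onI)
    show "last ` {p \<in> max_chains F S. tgt (last p) = a} = {s \<in> S. tgt s = a}"
    proof (intro equalityI subsetI)
      fix s assume s: "s \<in> {s \<in> S. tgt s = a}"
      then have "s \<in> S" "s \<notin> Domain F" using F'(5) by auto
      then obtain p where "p \<in> max_chains F S" "last p = s"
        using max_chain_exists_last[OF fin F'(1,2)] by metis
      then show "s \<in> last ` {p \<in> max_chains F S. tgt (last p) = a}" using s by auto
    qed (auto simp: max_chains_def dest!: last_in_set)
  qed
  then have "in": "card {p \<in> max_chains F S. tgt (last p) = a} = card {s \<in> S. tgt s = a}"
    by (rule bij_betw_same_card)
  have fins: "finite (segments F S u w)" for u w using finc by (simp add: segments_def)
  have "{p \<in> max_chains F S. src (hd p) = a} = segments F S a a \<union> segments F S a b"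
    "{p \<in> max_chains F S. tgt (last p) = a} = segments F S a a \<union> segments F S b a"
    using ends by (auto simp: segments_def)
  moreover have "segments F S a a \<inter> segments F S a b = {}" "segments F S a a \<inter> segments F S b a = {}"
    using ab by (auto simp: segments_def)
  ultimately show ?thesis using fins out "in" by (simp add: card_Un_disjoint)
qed

text \<open>The equation on \<open>k\<close> and \<open>k'\<close> says that a segment from
  \<open>u\<close> to \<open>w\<close> carries \<open>k - k'\<close> units from \<open>b\<close> to
  \<open>a\<close>. Both uses are covered: from \<open>b\<close> to \<open>a\<close> lowering 1 to
  0, and from \<open>a\<close> to \<open>b\<close> raising 0 to 1.\<close>

lemma linked_flows_reverse:
  assumes x: "((S, col), F) \<in> linked_flows V D a b k" and p: "p \<in> segments F S u w"
    and k: "\<And>v. of_bool (u = v) - of_bool (w = v) = (k - k') * (of_bool (v = b) - of_bool (v = a))"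
  defines "S' \<equiv> reverse_steps p S" and "col' \<equiv> flip_colours p col" and "F' \<equiv> reverse_links p F"
  shows "((S', col'), F') \<in> linked_flows V D a b k'" "rev_path p \<in> segments F' S' w u"
    "max_chains F' S' = insert (rev_path p) (max_chains F S - {p})"
    "reverse_steps (rev_path p) S' = S" "flip_colours (rev_path p) col' = col"
    "reverse_links (rev_path p) F' = F"
proof -
  have or: "orientation D S" and F: "F \<in> links (V - {a, b}) S" and col: "col \<in> D \<rightarrow>\<^sub>E UNIV"
    and net: "\<And>v c. v \<in> V \<Longrightarrow> net_flow S col c v = k * (of_bool (v = b) - of_bool (v = a))"
    using x by (auto simp: linked_flows_def flows_def)
  have pm: "p \<in> max_chains F S" and ends: "src (hd p) = u" "tgt (last p) = w"
    using p by (simp_all add: segments_def)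
  have nl: "\<And>s. s \<in> S \<Longrightarrow> src s \<noteq> tgt s" using orientationD(2)[OF or] by blast
  note ctx = orientationD(1)[OF or] or nl F pm
  note b = reverse_path_basics[OF ctx, simplified]
  have "set p \<subseteq> S" "p \<noteq> []" using b by simp_all
  then have "flip_colours p col \<in> D \<rightarrow>\<^sub>E UNIV"
    using col or by (auto simp: PiE_def extensional_def flip_colours_def orientation_def)
  moreover have "net_flow S' col' c v = k' * (of_bool (v = b) - of_bool (v = a))" if "v \<in> V" for c v
  proof -
    have "net_flow S' col' c v = net_flow S col c v - (of_bool (u = v) - of_bool (w = v))"
      unfolding S'_def col'_def using net_flow_reverse[OF ctx] ends by simp
    then show ?thesis unfolding k net[OF that] by (simp add: algebra_simps)
  qed
  moreover have "orientation D S'" unfolding S'_def by (rule orientation_reverse[OF ctx])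
  ultimately have "(S', col') \<in> flows V D a b k'" by (simp add: flows_def col'_def)
  moreover have "F' \<in> links (V - {a, b}) S'" unfolding S'_def F'_def by (rule links_reverse[OF ctx])
  ultimately show "((S', col'), F') \<in> linked_flows V D a b k'" by (simp add: linked_flows_def)
  show mc: "max_chains F' S' = insert (rev_path p) (max_chains F S - {p})"
    unfolding S'_def F'_def by (rule max_chains_reverse[OF ctx])
  show "rev_path p \<in> segments F' S' w u"
    unfolding segments_def mc using ends \<open>p \<noteq> []\<close> by (simp add: rev_path_ends)
  show "reverse_steps (rev_path p) S' = S" "flip_colours (rev_path p) col' = col"
    "reverse_links (rev_path p) F' = F"
    unfolding S'_def F'_def col'_def
    using reverse_reverse[OF ctx] flip_colours_rev_path by simp_all
qed

text \<open>Each structure of strength 1 spreads unit mass evenly over its segments from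
  \<open>b\<close> to \<open>a\<close>. Reversal carries the marked structures bijectively to
  sourceless ones with a marked segment from \<open>a\<close> to \<open>b\<close>; one with
  \<open>m\<close> such segments receives \<open>m\<close> shares of
  \<open>1 / (m + 1)\<close>.\<close>

lemma card_linked_flows_1:
  assumes ab: "a \<in> V" "b \<in> V" "a \<noteq> b"
  shows "real (card (linked_flows V D a b 1)) =
    (\<Sum>x\<in>linked_flows V D a b 0. real (card (segments (snd x) (fst (fst x)) a b)) /
       (real (card (segments (snd x) (fst (fst x)) a b)) + 1))"
proof -
  let ?L = "linked_flows V D a b"
  define N where "N x u w = segments (snd x) (fst (fst x)) u w"
    for x :: "('v step set \<times> ('v set \<times> nat \<Rightarrow> colour)) \<times> ('v step \<times> 'v step) set" and u w
  define R where "R = (\<lambda>((S, col), F).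
    \<lambda>p. (((reverse_steps p S, flip_colours p col), reverse_links p F), rev_path p)
      :: (('v step set \<times> ('v set \<times> nat \<Rightarrow> colour)) \<times> ('v step \<times> 'v step) set) \<times> _)"
  have xD: "orientation D (fst (fst x))" "snd x \<in> links (V - {a, b}) (fst (fst x))"
    if "x \<in> ?L k" for x k
    using that by (auto simp: linked_flows_def flows_def)
  have finN: "finite (N x u w)" if "x \<in> ?L k" for x k u w
    using finite_max_chains[OF xD[OF that]] by (simp add: N_def segments_def)
  \<comment> \<open>The 2 counts the colours, each carrying \<open>k\<close> units. For
    \<open>k = 1\<close> this guarantees a segment from \<open>b\<close> to \<open>a\<close>, so
    there is something to divide by; for \<open>k = 0\<close> the two numbers of segments
    agree.\<close>
  have count: "int (card (N x b a)) = int (card (N x a b)) + 2 * k" if x: "x \<in> ?L k" for x k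
  proof -
    have "(fst (fst x), snd (fst x)) \<in> flows V D a b k" using x by (auto simp: linked_flows_def)
    then have "int (card {s \<in> fst (fst x). src s = a}) - int (card {s \<in> fst (fst x). tgt s = a}) = - 2 * k"
      using flow_degrees[of "fst (fst x)" "snd (fst x)" a b k a] ab by simp
    then show ?thesis using segment_count[OF xD[OF x] ab] by (simp add: N_def)
  qed
  have k10: "of_bool (b = v) - of_bool (a = v) = (1 - 0) * (of_bool (v = b) - of_bool (v = a) :: int)" for v
    by auto
  have k01: "of_bool (a = v) - of_bool (b = v) = (0 - 1) * (of_bool (v = b) - of_bool (v = a) :: int)" for v
    by auto
  have R1: "fst (R x p) \<in> ?L 0" "snd (R x p) \<in> N (fst (R x p)) a b"
    "R (fst (R x p)) (snd (R x p)) = (x, p)"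
    "N (fst (R x p)) b a = N x b a - {p}"
    if "x \<in> ?L 1" "p \<in> N x b a" for x p
  proof -
    obtain S col F where x: "x = ((S, col), F)" by (metis surj_pair)
    have pre: "((S, col), F) \<in> ?L 1" "p \<in> segments F S b a" using that x by (simp_all add: N_def)
    note r = linked_flows_reverse[OF pre k10]
    show "fst (R x p) \<in> ?L 0" "snd (R x p) \<in> N (fst (R x p)) a b"
      "R (fst (R x p)) (snd (R x p)) = (x, p)"
      using r by (simp_all add: R_def N_def x)
    have "src (hd (rev_path p)) = a" using r(2) by (simp add: segments_def)
    then show "N (fst (R x p)) b a = N x b a - {p}"
      using r(3) ab(3) by (auto simp: R_def N_def x segments_def)
  qed
  have R0: "fst (R x p) \<in> ?L 1" "snd (R x p) \<in> N (fst (R x p)) b a"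
    "R (fst (R x p)) (snd (R x p)) = (x, p)"
    if "x \<in> ?L 0" "p \<in> N x a b" for x p
  proof -
    obtain S col F where x: "x = ((S, col), F)" by (metis surj_pair)
    have pre: "((S, col), F) \<in> ?L 0" "p \<in> segments F S a b" using that x by (simp_all add: N_def)
    note r = linked_flows_reverse[OF pre k01]
    show "fst (R x p) \<in> ?L 1" "snd (R x p) \<in> N (fst (R x p)) b a"
      "R (fst (R x p)) (snd (R x p)) = (x, p)"
      using r by (simp_all add: R_def N_def x)
  qed
  have bij: "bij_betw (\<lambda>(x, p). R x p) (SIGMA x:?L 1. N x b a) (SIGMA x:?L 0. N x a b)"
  proof (rule bij_betw_byWitness[where f' = "\<lambda>(x, p). R x p"])
    have "(fst (R x p), snd (R x p)) \<in> (SIGMA x:?L 0. N x a b)" if "x \<in> ?L 1" "p \<in> N x b a" for x p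
      using R1[OF that] by (intro SigmaI)
    then show "(\<lambda>(x, p). R x p) ` (SIGMA x:?L 1. N x b a) \<subseteq> (SIGMA x:?L 0. N x a b)"
      unfolding prod.collapse by (intro image_subsetI, elim SigmaE) simp
    have "(fst (R x p), snd (R x p)) \<in> (SIGMA x:?L 1. N x b a)" if "x \<in> ?L 0" "p \<in> N x a b" for x p
      using R0[OF that] by (intro SigmaI)
    then show "(\<lambda>(x, p). R x p) ` (SIGMA x:?L 0. N x a b) \<subseteq> (SIGMA x:?L 1. N x b a)"
      unfolding prod.collapse by (intro image_subsetI, elim SigmaE) simp
  qed (use R1(3) R0(3) in \<open>simp_all add: split_beta mem_Sigma_iff\<close>)
  have "real (card (?L 1)) = (\<Sum>x\<in>?L 1. \<Sum>p\<in>N x b a. 1 / real (card (N x b a)))"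
  proof -
    have "1 = (\<Sum>p\<in>N x b a. 1 / real (card (N x b a)))" if "x \<in> ?L 1" for x
    proof -
      have "card (N x b a) > 0" using count[OF that] by simp
      then show ?thesis by simp
    qed
    then have "(\<Sum>x\<in>?L 1. 1) = (\<Sum>x\<in>?L 1. \<Sum>p\<in>N x b a. 1 / real (card (N x b a)))"
      by (rule sum.cong[OF refl])
    then show ?thesis by simp
  qed
  also have "\<dots> = (\<Sum>(x, p)\<in>(SIGMA x:?L 1. N x b a). 1 / real (card (N x b a)))"
    using finite_linked_flows finN by (intro sum.Sigma) auto
  also have "\<dots> = (\<Sum>z\<in>(SIGMA x:?L 1. N x b a).
      (\<lambda>(y, q). 1 / (real (card (N y a b)) + 1)) ((\<lambda>(x, p). R x p) z))"
  proof (rule sum.cong)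
    fix z assume "z \<in> (SIGMA x:?L 1. N x b a)"
    then obtain x p where z: "z = (x, p)" and x: "x \<in> ?L 1" and p: "p \<in> N x b a" by blast
    \<comment> \<open>The image is sourceless, so its segments from \<open>a\<close> to
      \<open>b\<close> are as many as those from \<open>b\<close> to \<open>a\<close>, and the
      latter are the old ones without \<open>p\<close>.\<close>
    have "card (N (fst (R x p)) a b) = card (N x b a - {p})"
      using count[OF R1(1)[OF x p]] R1(4)[OF x p] by simp
    then have "real (card (N (fst (R x p)) a b)) + 1 = real (card (N x b a))"
      using p card_Suc_Diff1[OF finN[OF x] p] by simp
    then show "(case z of (x, p) \<Rightarrow> 1 / real (card (N x b a))) =
        (\<lambda>(y, q). 1 / (real (card (N y a b)) + 1)) ((\<lambda>(x, p). R x p) z)"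
      by (simp add: z split_beta)
  qed simp
  also have "\<dots> = (\<Sum>(y, q)\<in>(SIGMA x:?L 0. N x a b). 1 / (real (card (N y a b)) + 1))"
    by (rule sum.reindex_bij_betw[OF bij])
  also have "\<dots> = (\<Sum>y\<in>?L 0. \<Sum>q\<in>N y a b. 1 / (real (card (N y a b)) + 1))"
    using finite_linked_flows finN by (intro sum.Sigma[symmetric]) auto
  finally show ?thesis by (simp add: N_def)
qed

section \<open>Numbers of linkings in terms of degrees\<close>

definition vdegree :: "'v \<Rightarrow> nat" where
  "vdegree v = card {d \<in> D. v \<in> fst d}"

lemma vdegree_eq:
  assumes or: "orientation D S"
  shows "vdegree v = card {s \<in> S. src s = v} + card {s \<in> S. tgt s = v}"
proof -
  have fin: "finite S" using or by (rule orientationD)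
  have "bij_betw step_edge {s \<in> S. src s = v \<or> tgt s = v} {d \<in> D. v \<in> fst d}"
  proof (rule bij_betw_subset[of step_edge S D])
    show "bij_betw step_edge S D" using or by (simp add: orientation_def bij_betw_def)
    show "step_edge ` {s \<in> S. src s = v \<or> tgt s = v} = {d \<in> D. v \<in> fst d}"
      using or by (auto simp: orientation_def step_edge_def)
  qed simp
  then have "vdegree v = card {s \<in> S. src s = v \<or> tgt s = v}"
    unfolding vdegree_def by (rule bij_betw_same_card[symmetric])
  also have "{s \<in> S. src s = v \<or> tgt s = v} = {s \<in> S. src s = v} \<union> {s \<in> S. tgt s = v}" by blast
  also have "card \<dots> = card {s \<in> S. src s = v} + card {s \<in> S. tgt s = v}"
    using fin orientationD(2)[OF or] by (intro card_Un_disjoint) fastforce+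
  finally show ?thesis .
qed

lemma flow_card_eq:
  assumes x: "(S, col) \<in> flows V D a b k" and "v \<in> V" "k = 0 \<or> v \<notin> {a, b}"
  shows "card {s \<in> S. tgt s = v} = card {s \<in> S. src s = v}"
    and "card {s \<in> S. src s = v} = vdegree v div 2"
proof -
  have or: "orientation D S" using x by (simp add: flows_def)
  show "card {s \<in> S. tgt s = v} = card {s \<in> S. src s = v}"
    using flow_degrees[OF x assms(2)] assms(3) by auto
  then show "card {s \<in> S. src s = v} = vdegree v div 2"
    using vdegree_eq[OF or, of v] by simp
qed

text \<open>Away from \<open>a\<close> and \<open>b\<close> every flow is balanced whatever
  \<open>k\<close> is, so each has the same number of linkings and the factor does not depend on
  \<open>k\<close>.\<close>

lemma card_linked_flows:
  "real (card (linked_flows V D a b k))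
     = (\<Prod>v\<in>V - {a, b}. fact (vdegree v div 2)) * real (card (flows V D a b k))"
proof -
  have "card (links (V - {a, b}) (fst x)) = (\<Prod>v\<in>V - {a, b}. fact (vdegree v div 2))"
    if x: "x \<in> flows V D a b k" for x
  proof -
    obtain S col where x': "x = (S, col)" by (cases x)
    then have or: "orientation D S" using x by (simp add: flows_def)
    note eq = flow_card_eq[OF x[unfolded x']]
    have "card (links (V - {a, b}) S) = (\<Prod>v\<in>V - {a, b}. fact (card {s \<in> S. src s = v}))"
      using finite_V orientationD(1)[OF or] eq(1) by (intro card_links) auto
    also have "\<dots> = (\<Prod>v\<in>V - {a, b}. fact (vdegree v div 2))"
      using eq(2) by (intro prod.cong) auto
    finally show ?thesis by (simp add: x')
  qed
  moreover have "finite (links (V - {a, b}) (fst x))" if "x \<in> flows V D a b k" for x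
    using that by (intro finite_links orientationD) (auto simp: flows_def)
  ultimately have "card (linked_flows V D a b k)
      = card (flows V D a b k) * (\<Prod>v\<in>V - {a, b}. fact (vdegree v div 2))"
    unfolding linked_flows_def using finite_flows by (subst card_SigmaI) auto
  then show ?thesis by simp
qed

text \<open>A full linking is a linking away from \<open>a\<close> and \<open>b\<close> together
  with an independent one at these two vertices. The summand sees only the former, so the latter
  contribute their number.\<close>

lemma sum_links_at:
  fixes \<phi> :: "'v step set \<Rightarrow> ('v step \<times> 'v step) set \<Rightarrow> real"
  assumes ab: "a \<in> V" "b \<in> V" "a \<noteq> b"
  shows "(\<Sum>x\<in>(SIGMA x:flows V D a b 0. links V (fst x)). \<phi> (fst (fst x)) (links_at (V - {a, b}) (snd x)))
    = fact (vdegree a div 2) * fact (vdegree b div 2) *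
      (\<Sum>x\<in>linked_flows V D a b 0. \<phi> (fst (fst x)) (snd x))"
proof -
  let ?W = "V - {a, b}"
  have finl: "finite (links W (fst x))" if "x \<in> flows V D a b 0" for x W
    using that by (intro finite_links orientationD) (auto simp: flows_def)
  have "(\<Sum>F\<in>links V (fst x). \<phi> (fst x) (links_at ?W F))
      = fact (vdegree a div 2) * fact (vdegree b div 2) * (\<Sum>F\<in>links ?W (fst x). \<phi> (fst x) F)"
    if x: "x \<in> flows V D a b 0" for x
  proof -
    obtain S col where x': "x = (S, col)" by (cases x)
    then have or: "orientation D S" using x by (simp add: flows_def)
    note eq = flow_card_eq[OF x[unfolded x']]
    have "card (links {a, b} S) = (\<Prod>v\<in>{a, b}. fact (card {s \<in> S. src s = v}))"
      using orientationD(1)[OF or] eq(1) ab by (intro card_links) auto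
    then have card: "real (card (links {a, b} S)) = fact (vdegree a div 2) * fact (vdegree b div 2)"
      using ab eq(2) by simp
    have V: "?W \<union> {a, b} = V" using ab by blast
    have bij: "bij_betw (\<lambda>F. (links_at ?W F, links_at {a, b} F)) (links V S) (links ?W S \<times> links {a, b} S)"
      using bij_betw_links_Un[of ?W "{a, b}" S] unfolding V by blast
    have "(\<Sum>F\<in>links V S. \<phi> S (links_at ?W F))
        = (\<Sum>F\<in>links V S. (\<lambda>(F, G). \<phi> S F) (links_at ?W F, links_at {a, b} F))" by simp
    also have "\<dots> = (\<Sum>(F, G)\<in>links ?W S \<times> links {a, b} S. \<phi> S F)"
      by (rule sum.reindex_bij_betw[OF bij])
    also have "\<dots> = (\<Sum>F\<in>links ?W S. \<Sum>G\<in>links {a, b} S. \<phi> S F)"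
      by (rule sum.cartesian_product[symmetric])
    also have "\<dots> = real (card (links {a, b} S)) * (\<Sum>F\<in>links ?W S. \<phi> S F)"
      by (simp add: sum_distrib_left)
    finally show ?thesis by (simp add: x' card)
  qed
  then have "(\<Sum>x\<in>flows V D a b 0. \<Sum>F\<in>links V (fst x). \<phi> (fst x) (links_at ?W F))
    = fact (vdegree a div 2) * fact (vdegree b div 2) *
        (\<Sum>x\<in>flows V D a b 0. \<Sum>F\<in>links ?W (fst x). \<phi> (fst x) F)"
    by (simp add: sum_distrib_left)
  then show ?thesis
    unfolding linked_flows_def using finite_flows finl
    by (simp add: sum.Sigma split_beta)
qed

lemma prod_vdegree:
  assumes ab: "a \<in> V" "b \<in> V" "a \<noteq> b"
  shows "(\<Prod>v\<in>V. fact (vdegree v div 2)) =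
    (fact (vdegree a div 2) * fact (vdegree b div 2) * (\<Prod>v\<in>V - {a, b}. fact (vdegree v div 2)) :: real)"
proof -
  have "(\<Prod>v\<in>V. fact (vdegree v div 2)) =
    (\<Prod>v\<in>V - {a, b}. fact (vdegree v div 2)) * (\<Prod>v\<in>{a, b}. fact (vdegree v div 2) :: real)"
    using ab finite_V by (intro prod.subset_diff) auto
  then show ?thesis using ab by simp
qed

lemma sum_linked_flows_0:
  assumes ab: "a \<in> V" "b \<in> V" "a \<noteq> b"
  shows "real (card (SIGMA x:flows V D a b 0. links V (fst x)))
    = (\<Prod>v\<in>V. fact (vdegree v div 2)) * real (card (flows V D a b 0))"
  using sum_links_at[OF ab, of "\<lambda>_ _. 1"] card_linked_flows[of a b 0] prod_vdegree[OF ab] by simp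

text \<open>Flows of strength 1 have no linkings at \<open>a\<close> and \<open>b\<close>; the
  factorials for these vertices come instead from the sourceless linkings, which completes the
  product over all of \<open>V\<close>.\<close>

lemma sum_linked_flows_1:
  assumes ab: "a \<in> V" "b \<in> V" "a \<noteq> b"
  defines "m x \<equiv> real (card (segments (links_at (V - {a, b}) (snd x)) (fst (fst x)) a b))"
  shows "(\<Sum>x\<in>(SIGMA x:flows V D a b 0. links V (fst x)). m x / (m x + 1))
    = (\<Prod>v\<in>V. fact (vdegree v div 2)) * real (card (flows V D a b 1))"
  unfolding m_def
  using sum_links_at[OF ab, of "\<lambda>S F. real (card (segments F S a b)) / (real (card (segments F S a b)) + 1)"]
    card_linked_flows[of a b 1] card_linked_flows_1[OF ab] prod_vdegree[OF ab] by simp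

end

section \<open>Loop configurations on a fixed submultigraph\<close>

lemma finite_graph_finite_edges:
  assumes "finite_graph V E"
  shows "finite E"
proof -
  have "E \<subseteq> Pow V" "finite V" using assms by (auto simp: finite_graph_def)
  then show ?thesis by (meson finite_Pow_iff finite_subset)
qed

lemma medges_Sigma: "submultigraph E M \<Longrightarrow> medges M = (SIGMA e:E. {..<M e})"
  by (force simp: medges_def submultigraph_def)

lemma multigraph_medges:
  assumes G: "finite_graph V E" and M: "submultigraph E M"
  shows "multigraph V (medges M)"
proof
  show "finite V" using G by (simp add: finite_graph_def)
  show "finite (medges M)"
    using finite_graph_finite_edges[OF G] by (simp add: medges_Sigma[OF M])
  show "src s \<in> V \<and> tgt s \<in> V \<and> src s \<noteq> tgt s" if "step_edge s \<in> medges M" for s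
  proof -
    have "{src s, tgt s} \<in> E" using that by (simp add: medges_Sigma[OF M] step_edge_def)
    then obtain v w where "{src s, tgt s} = {v, w}" "v \<in> V" "w \<in> V" "v \<noteq> w"
      using G unfolding finite_graph_def by blast
    then show ?thesis by (auto simp: doubleton_eq_iff)
  qed
qed

lemma vdegree_mdegree:
  assumes G: "finite_graph V E" and M: "submultigraph E M"
  shows "multigraph.vdegree (medges M) v = mdegree E M v"
proof -
  interpret multigraph V "medges M" using multigraph_medges[OF G M] .
  have "{d \<in> medges M. v \<in> fst d} = (SIGMA e:{e. e \<in> E \<and> v \<in> e}. {..<M e})"
    by (auto simp: medges_Sigma[OF M])
  then show ?thesis using finite_graph_finite_edges[OF G] by (simp add: vdegree_def mdegree_def)
qed

definition configs_on :: "'v set \<Rightarrow> 'v set set \<Rightarrow> ('v set \<Rightarrow> nat) \<Rightarrow> 'v loop_config set" where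
  "configs_on V E M = {\<omega> \<in> balanced_configs V E. mult \<omega> = M}"

definition decompose :: "'v loop_config \<Rightarrow>
    ('v step set \<times> ('v set \<times> nat \<Rightarrow> colour)) \<times> ('v step \<times> 'v step) set" where
  "decompose \<omega> = ((\<Union>(steps ` loops \<omega>), colouring \<omega>), successions (loops \<omega>))"

text \<open>Balance of both colours at every vertex is exactly a flow of strength 0 on the
  orientation that the loops induce.\<close>

lemma configs_on_iff:
  assumes G: "finite_graph V E" and M: "submultigraph E M"
  shows "\<omega> \<in> configs_on V E M \<longleftrightarrow> mult \<omega> = M \<and> covering_loops M (loops \<omega>) \<and>
           (\<Union>(steps ` loops \<omega>), colouring \<omega>) \<in> flows V (medges M) a b 0"
proof -
  interpret multigraph V "medges M" using multigraph_medges[OF G M] .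
  let ?S = "\<Union>(steps ` loops \<omega>)"
  have net: "net_flow ?S (colouring \<omega>) c v = int (out_degree \<omega> c v) - int (in_degree \<omega> c v)"
    if "covering_loops M (loops \<omega>)" for c v
    using net_flow_eq[OF orientationD(1)[OF orientation_steps[OF that]], of "colouring \<omega>" c v]
    by (simp add: out_degree_def in_degree_def)
  have all: "(\<forall>c. P c) \<longleftrightarrow> P Red \<and> P Blue" for P by (metis colour.exhaust)
  have "(\<forall>v\<in>V. out_degree \<omega> Red v = in_degree \<omega> Red v \<and> out_degree \<omega> Blue v = in_degree \<omega> Blue v)
      \<longleftrightarrow> (\<forall>v\<in>V. \<forall>c. net_flow ?S (colouring \<omega>) c v = 0)" if "covering_loops M (loops \<omega>)"
    unfolding all net[OF that] by simp
  moreover have "\<omega> \<in> configs_on V E M \<longleftrightarrow> mult \<omega> = M \<and> covering_loops M (loops \<omega>) \<and>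
      colouring \<omega> \<in> medges M \<rightarrow>\<^sub>E UNIV \<and>
      (\<forall>v\<in>V. out_degree \<omega> Red v = in_degree \<omega> Red v \<and> out_degree \<omega> Blue v = in_degree \<omega> Blue v)"
    using M unfolding configs_on_def balanced_configs_def coloured_loop_config_def covering_loops_def
    by blast
  moreover have "orientation (medges M) ?S" if "covering_loops M (loops \<omega>)"
    using that by (rule orientation_steps)
  ultimately show ?thesis by (auto simp: flows_def)
qed

lemma bij_betw_decompose:
  assumes G: "finite_graph V E" and M: "submultigraph E M"
  shows "bij_betw decompose (configs_on V E M) (SIGMA x:flows V (medges M) a b 0. links V (fst x))"
proof (rule bij_betw_imageI)
  interpret multigraph V "medges M" using multigraph_medges[OF G M] .
  have ends: "src s \<in> V \<and> tgt s \<in> V" if "step_edge s \<in> medges M" for s using proper[OF that] by blast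
  note iff = configs_on_iff[OF G M, of _ a b]
  note bij = bij_betw_successions[OF finite_D ends]
  show "inj_on decompose (configs_on V E M)"
  proof (rule inj_onI)
    fix \<omega> \<omega>' :: "'a loop_config"
    assume \<omega>: "\<omega> \<in> configs_on V E M" "\<omega>' \<in> configs_on V E M" and eq: "decompose \<omega> = decompose \<omega>'"
    have "loops \<omega> = loops \<omega>'"
      using bij_betw_imp_inj_on[OF bij] by (rule inj_onD) (use \<omega> eq iff in \<open>auto simp: decompose_def\<close>)
    then show "\<omega> = \<omega>'"
      using \<omega> eq iff by (intro loop_config.equality) (auto simp: decompose_def)
  qed
  show "decompose ` configs_on V E M = (SIGMA x:flows V (medges M) a b 0. links V (fst x))"
  proof (intro equalityI subsetI)
    fix x assume "x \<in> decompose ` configs_on V E M"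
    then obtain \<omega> where \<omega>: "\<omega> \<in> configs_on V E M" "x = decompose \<omega>" by blast
    then show "x \<in> (SIGMA x:flows V (medges M) a b 0. links V (fst x))"
      using iff successions_links[OF _ ends] by (auto simp: decompose_def)
  next
    fix x assume "x \<in> (SIGMA x:flows V (medges M) a b 0. links V (fst x))"
    then obtain S col F where x: "x = ((S, col), F)" "(S, col) \<in> flows V (medges M) a b 0" "F \<in> links V S"
      by auto
    then have "(S, F) \<in> (SIGMA S:{S. orientation (medges M) S}. links V S)" by (simp add: flows_def)
    then obtain L where L: "covering_loops M L" "(S, F) = (\<Union>(steps ` L), successions L)"
      using bij_betw_imp_surj_on[OF bij] by blast
    define \<omega> where "\<omega> = \<lparr>mult = M, colouring = col, loops = L\<rparr>"
    have "\<omega> \<in> configs_on V E M" using L x(2) by (simp add: iff \<omega>_def)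
    moreover have "decompose \<omega> = x" using L(2) by (simp add: decompose_def \<omega>_def x(1))
    ultimately show "x \<in> decompose ` configs_on V E M" by blast
  qed
qed

lemma num_pieces_eq:
  assumes G: "finite_graph V E" and M: "submultigraph E M" and \<omega>: "\<omega> \<in> configs_on V E M"
  shows "num_pieces a b \<omega> = card (segments (links_at (V - {a, b}) (snd (decompose \<omega>)))
           (fst (fst (decompose \<omega>))) a b)"
proof -
  interpret multigraph V "medges M" using multigraph_medges[OF G M] .
  have ends: "src s \<in> V \<and> tgt s \<in> V" if "step_edge s \<in> medges M" for s using proper[OF that] by blast
  have "covering_loops M (loops \<omega>)" using \<omega> configs_on_iff[OF G M] by blast
  then have "pieces a b \<omega> = segments (links_at (V - {a, b}) (snd (decompose \<omega>)))
      (fst (fst (decompose \<omega>))) a b"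
    by (subst pieces_eq_max_chains[OF finite_D ends _ refl]) (simp_all add: segments_def links_at_def decompose_def)
  then show ?thesis by (simp add: num_pieces_def)
qed

definition edge_weight :: "'v set set \<Rightarrow> real \<Rightarrow> ('v set \<Rightarrow> nat) \<Rightarrow> real" where
  "edge_weight E \<beta> M = (\<Prod>e\<in>E. 1 / fact (M e) * (\<beta> / 2) ^ M e)"

context
  fixes V :: "'v set" and E M a b
  assumes G: "finite_graph V E" and M: "submultigraph E M" and ab: "a \<in> V" "b \<in> V" "a \<noteq> b"
begin

lemma finite_configs_on: "finite (configs_on V E M)"
proof -
  interpret multigraph V "medges M" using multigraph_medges[OF G M] .
  have "finite (links V (fst x))" if "x \<in> flows V (medges M) a b 0" for x
    using that by (intro finite_links orientationD) (auto simp: flows_def)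
  then have "finite (SIGMA x:flows V (medges M) a b 0. links V (fst x))"
    using finite_flows by blast
  then show ?thesis using bij_betw_finite[OF bij_betw_decompose[OF G M]] by blast
qed

text \<open>The weight depends only on the multiplicities, so weighted sums over the configurations
  on \<open>M\<close> reduce to counting them.\<close>

lemma loop_weight_eq:
  assumes "\<omega> \<in> configs_on V E M"
  shows "loop_weight V E \<beta> \<omega> = edge_weight E \<beta> M / (\<Prod>v\<in>V. fact (mdegree E M v div 2))"
  using assms by (simp add: loop_weight_def configs_on_def edge_weight_def prod_dividef)

text \<open>The degree factorials in the weight are chosen to cancel the number of linkings of each
  coloured orientation.\<close>

lemma sum_loop_weight:
  "(\<Sum>\<omega>\<in>configs_on V E M. loop_weight V E \<beta> \<omega>)
     = edge_weight E \<beta> M * real (card (flows V (medges M) a b 0))"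
proof -
  interpret multigraph V "medges M" using multigraph_medges[OF G M] .
  have "real (card (configs_on V E M))
      = (\<Prod>v\<in>V. fact (mdegree E M v div 2)) * real (card (flows V (medges M) a b 0))"
    using bij_betw_same_card[OF bij_betw_decompose[OF G M]] sum_linked_flows_0[OF ab]
    by (simp add: vdegree_mdegree[OF G M])
  moreover have "(\<Prod>v\<in>V. fact (mdegree E M v div 2)) \<noteq> (0 :: real)" using finite_V by simp
  ultimately show ?thesis by (simp add: loop_weight_eq)
qed

text \<open>The counterpart at strength 1: after the same cancellation, averaging
  \<open>m / (m + 1)\<close> turns sourceless flows into flows from \<open>b\<close> to
  \<open>a\<close>.\<close>

lemma sum_loop_weight_pieces:
  "(\<Sum>\<omega>\<in>configs_on V E M. loop_weight V E \<beta> \<omega> * (real (num_pieces a b \<omega>) / (real (num_pieces a b \<omega>) + 1)))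
     = edge_weight E \<beta> M * real (card (flows V (medges M) a b 1))"
proof -
  interpret multigraph V "medges M" using multigraph_medges[OF G M] .
  define m where "m x = real (card (segments (links_at (V - {a, b}) (snd x)) (fst (fst x)) a b))"
    for x :: "('v step set \<times> ('v set \<times> nat \<Rightarrow> colour)) \<times> ('v step \<times> 'v step) set"
  let ?c = "edge_weight E \<beta> M / (\<Prod>v\<in>V. fact (mdegree E M v div 2))"
  have "(\<Sum>\<omega>\<in>configs_on V E M. loop_weight V E \<beta> \<omega> * (real (num_pieces a b \<omega>) / (real (num_pieces a b \<omega>) + 1)))
      = (\<Sum>\<omega>\<in>configs_on V E M. ?c * (m (decompose \<omega>) / (m (decompose \<omega>) + 1)))"
    by (intro sum.cong) (simp_all add: loop_weight_eq num_pieces_eq[OF G M] m_def)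
  also have "\<dots> = (\<Sum>x\<in>(SIGMA x:flows V (medges M) a b 0. links V (fst x)). ?c * (m x / (m x + 1)))"
    by (rule sum.reindex_bij_betw[OF bij_betw_decompose[OF G M]])
  also have "\<dots> = ?c * ((\<Prod>v\<in>V. fact (mdegree E M v div 2)) * real (card (flows V (medges M) a b 1)))"
    unfolding sum_distrib_left[symmetric] m_def sum_linked_flows_1[OF ab] vdegree_mdegree[OF G M] ..
  also have "\<dots> = edge_weight E \<beta> M * real (card (flows V (medges M) a b 1))"
    using finite_V by simp
  finally show ?thesis .
qed

end

section \<open>Integrals over the circle\<close>

lemma circle_measure_space [simp]: "space circle_measure = sphere 0 1"
  and circle_measure_sets [simp]: "sets circle_measure = sets (restrict_space borel (sphere 0 1))"
  by (simp_all add: circle_measure_def space_restrict_space)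

lemma cis_measurable: "cis \<in> measurable (uniform_measure lborel A) (restrict_space borel (sphere 0 1))"
proof (rule measurable_restrict_space2)
  have "cis \<in> borel_measurable borel"
    by (intro borel_measurable_continuous_onI continuous_intros)
  then show "cis \<in> borel_measurable (uniform_measure lborel A)" by simp
qed auto

lemma prob_space_circle: "prob_space circle_measure"
  unfolding circle_measure_def
  by (intro prob_space.prob_space_distr prob_space_uniform_measure cis_measurable) auto

text \<open>Orthogonality of characters: for nonzero \<open>n\<close> the antiderivative
  \<open>cis (n t) / (\<i> n)\<close> takes equal values at both ends of a period.\<close>

lemma integral_cis:
  fixes n :: int
  shows "(\<integral>t. cis (of_int n * t) \<partial>uniform_measure lborel {0..<2 * pi}) = of_bool (n = 0)"
proof -
  have m: "(\<lambda>t. cis (of_int n * t)) \<in> borel_measurable borel"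
    by (intro borel_measurable_continuous_onI continuous_intros)
  have "uniform_measure lborel {0..<2 * pi}
      = density lborel (\<lambda>t. ennreal (indicator {0..<2 * pi} t / (2 * pi)))"
    unfolding uniform_measure_def
    by (intro arg_cong[where f = "density lborel"] ext)
       (use divide_ennreal[of 1 "2 * pi"] in \<open>simp add: indicator_def\<close>)
  then have "(\<integral>t. cis (of_int n * t) \<partial>uniform_measure lborel {0..<2 * pi})
      = (\<integral>t. (indicator {0..<2 * pi} t / (2 * pi)) *\<^sub>R cis (of_int n * t) \<partial>lborel)"
    using m by (simp add: integral_density)
  also have "\<dots> = (\<integral>t. of_real (1 / (2 * pi)) * (indicator {0..2 * pi} t *\<^sub>R cis (of_int n * t)) \<partial>lborel)"
  proof (rule integral_cong_AE)
    show "AE t in lborel. (indicator {0..<2 * pi} t / (2 * pi)) *\<^sub>R cis (of_int n * t)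
        = of_real (1 / (2 * pi)) * (indicator {0..2 * pi} t *\<^sub>R cis (of_int n * t))"
      \<comment> \<open>Closing the interval at the null point \<open>2 * pi\<close> allows the
        fundamental theorem of calculus on a compact interval.\<close>
      using AE_lborel_singleton[of "2 * pi"]
      by eventually_elim (auto simp: indicator_def scaleR_conv_of_real)
  qed (use m in measurable)
  also have "\<dots> = of_real (1 / (2 * pi)) * (\<integral>t. indicator {0..2 * pi} t *\<^sub>R cis (of_int n * t) \<partial>lborel)"
    by (rule integral_mult_right_zero)
  also have "(\<integral>t. indicator {0..2 * pi} t *\<^sub>R cis (of_int n * t) \<partial>lborel) = of_bool (n = 0) * (2 * pi)"
  proof (cases "n = 0")
    case True
    have "(\<integral>t. indicator {0..2 * pi} t *\<^sub>R cis (of_int n * t) \<partial>lborel)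
        = (\<integral>t. complex_of_real (indicator {0..2 * pi} t) \<partial>lborel)"
      using True by (simp add: of_real_def)
    also have "\<dots> = of_real (2 * pi)" by (subst integral_complex_of_real) simp
    finally show ?thesis using True by simp
  next
    case False
    define F where "F t = cis (of_int n * t) / (\<i> * of_int n)" for t
    have "(\<integral>t. indicator {0..2 * pi} t *\<^sub>R cis (of_int n * t) \<partial>lborel) = F (2 * pi) - F 0"
    proof (rule integral_FTC_Icc)
      fix t :: real
      have "((\<lambda>t. exp (\<i> * of_int n * of_real t) / (\<i> * of_int n)) has_vector_derivative
          exp (\<i> * of_int n * of_real t)) (at t within {0..2 * pi})"
        using False
        by (auto intro!: derivative_eq_intros has_vector_derivative_real_field simp: field_simps)
      then show "(F has_vector_derivative cis (of_int n * t)) (at t within {0..2 * pi})"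
        by (simp add: F_def[abs_def] cis_conv_exp mult.assoc)
    next
      show "continuous_on {0..2 * pi} (\<lambda>t. cis (of_int n * t))" by (intro continuous_intros)
    qed simp
    also have "cis (of_int n * (2 * pi)) = 1"
      using cis_multiple_2pi[of "of_int n"] by (simp add: mult.commute)
    then have "F (2 * pi) - F 0 = 0" by (simp add: F_def)
    finally show ?thesis using False by simp
  qed
  finally show ?thesis by simp
qed

lemma integral_circle_measure:
  "(\<integral>z. z ^ p * cnj z ^ q \<partial>circle_measure) = of_bool (p = q)"
proof -
  have "(\<lambda>z. z ^ p * cnj z ^ q) \<in> borel_measurable (restrict_space borel (sphere 0 1))"
    by (intro measurable_restrict_space1 borel_measurable_continuous_onI continuous_intros)
  then have "(\<integral>z. z ^ p * cnj z ^ q \<partial>circle_measure)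
      = (\<integral>t. cis t ^ p * cnj (cis t) ^ q \<partial>uniform_measure lborel {0..<2 * pi})"
    unfolding circle_measure_def by (intro integral_distr cis_measurable)
  also have "cis t ^ p * cnj (cis t) ^ q = cis (of_int (int p - int q) * t)" for t
    by (simp add: Complex.DeMoivre cis_cnj cis_mult left_diff_distrib)
  then have "(\<integral>t. cis t ^ p * cnj (cis t) ^ q \<partial>uniform_measure lborel {0..<2 * pi})
      = (\<integral>t. cis (of_int (int p - int q) * t) \<partial>uniform_measure lborel {0..<2 * pi})"
    by simp
  also have "\<dots> = of_bool (p = q)" unfolding integral_cis by simp
  finally show ?thesis .
qed

lemma integrable_circle_measure: "integrable circle_measure (\<lambda>z. z ^ p * cnj z ^ q)"
proof (rule finite_measure.integrable_const_bound[where B = 1])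
  show "finite_measure circle_measure"
    using prob_space_circle by (rule prob_space.finite_measure)
  show "AE z in circle_measure. norm (z ^ p * cnj z ^ q) \<le> 1"
    by (rule AE_I2) (simp add: norm_mult norm_power)
  have "(\<lambda>z. z ^ p * cnj z ^ q) \<in> borel_measurable (restrict_space borel (sphere 0 1))"
    by (intro measurable_restrict_space1 borel_measurable_continuous_onI continuous_intros)
  then show "(\<lambda>z. z ^ p * cnj z ^ q) \<in> borel_measurable circle_measure"
    by (simp cong: measurable_cong_sets)
qed

section \<open>The product measure of the spins\<close>

abbreviation spins :: "'v set \<Rightarrow> ('v \<Rightarrow> complex) measure" where
  "spins V \<equiv> \<Pi>\<^sub>M v\<in>V. circle_measure"

lemma prob_space_spins: "prob_space (spins V)"
  by (intro prob_space_PiM prob_space_circle)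

lemma spin_measurable: "v \<in> V \<Longrightarrow> (\<lambda>\<sigma>. \<sigma> v) \<in> borel_measurable (spins V)"
proof -
  assume "v \<in> V"
  then have "(\<lambda>\<sigma>. \<sigma> v) \<in> measurable (spins V) circle_measure" by (rule measurable_component_singleton)
  then have "(\<lambda>\<sigma>. \<sigma> v) \<in> measurable (spins V) (restrict_space borel (sphere 0 1))"
    by (simp cong: measurable_cong_sets)
  then show ?thesis by (rule measurable_restrict_space2_iff[THEN iffD1, THEN conjunct1])
qed

lemma norm_spin: "\<sigma> \<in> space (spins V) \<Longrightarrow> v \<in> V \<Longrightarrow> norm (\<sigma> v) = 1"
  by (auto simp: space_PiM PiE_def)

lemma integral_spin_monomial:
  assumes "finite V"
  shows "(\<integral>\<sigma>. (\<Prod>v\<in>V. \<sigma> v ^ p v * cnj (\<sigma> v) ^ q v) \<partial>spins V) = of_bool (\<forall>v\<in>V. p v = q v)"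
proof -
  interpret product_sigma_finite "\<lambda>_. circle_measure"
    unfolding product_sigma_finite_def
    using prob_space_imp_sigma_finite prob_space_circle by blast
  have "(\<integral>\<sigma>. (\<Prod>v\<in>V. \<sigma> v ^ p v * cnj (\<sigma> v) ^ q v) \<partial>spins V)
      = (\<Prod>v\<in>V. \<integral>z. z ^ p v * cnj z ^ q v \<partial>circle_measure)"
    using assms by (intro product_integral_prod integrable_circle_measure)
  also have "\<dots> = (\<Prod>v\<in>V. of_bool (p v = q v))" by (simp add: integral_circle_measure)
  also have "\<dots> = of_bool (\<forall>v\<in>V. p v = q v)"
    using assms by (auto simp: of_bool_def intro: prod_zero)
  finally show ?thesis .
qed

text \<open>Used twice for two independent copies: to write a squared spin integral as one integral,
  and to split an integral of a red times a blue monomial.\<close>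

lemma integral_pair_product:
  fixes f g :: "'a \<Rightarrow> complex"
  assumes "prob_space P" "f \<in> borel_measurable P" "g \<in> borel_measurable P"
    and "\<And>x. x \<in> space P \<Longrightarrow> norm (f x) \<le> B" "\<And>x. x \<in> space P \<Longrightarrow> norm (g x) \<le> C"
  shows "(\<integral>z. f (fst z) * g (snd z) \<partial>(P \<Otimes>\<^sub>M P)) = (\<integral>x. f x \<partial>P) * (\<integral>y. g y \<partial>P)"
proof -
  interpret P: prob_space P by fact
  interpret PP: pair_prob_space P P ..
  have "norm (f (fst z) * g (snd z)) \<le> B * C" if "z \<in> space (P \<Otimes>\<^sub>M P)" for z
  proof -
    have "fst z \<in> space P" "snd z \<in> space P" using that by (auto simp: space_pair_measure)
    then show ?thesis
      unfolding norm_mult using assms(4)[of "fst z"] assms(5)[of "snd z"]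
      by (intro mult_mono) (auto intro: order_trans[OF norm_ge_zero])
  qed
  then have "integrable (P \<Otimes>\<^sub>M P) (\<lambda>z. f (fst z) * g (snd z))"
    using measurable_compose[OF measurable_fst assms(2)] measurable_compose[OF measurable_snd assms(3)]
    by (intro PP.integrable_const_bound[where B = "B * C"] AE_I2 borel_measurable_times) simp_all
  then have "(\<integral>z. f (fst z) * g (snd z) \<partial>(P \<Otimes>\<^sub>M P)) = (\<integral>x. (\<integral>y. f x * g y \<partial>P) \<partial>P)"
    by (subst PP.integral_fst'[symmetric]) simp_all
  then show ?thesis by simp
qed

section \<open>Expansion of the Gibbs weight\<close>

text \<open>Fubini for counting measure times \<open>Q\<close>. The summable bound \<open>c\<close>
  dominates uniformly in \<open>x\<close>, and \<open>Q\<close> has total mass 1, so the double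
  integral converges absolutely.\<close>

lemma integral_infsetsum:
  fixes h :: "'i \<Rightarrow> 'a \<Rightarrow> complex"
  assumes Q: "prob_space Q" and A: "countable A"
    and meas: "\<And>i. i \<in> A \<Longrightarrow> h i \<in> borel_measurable Q"
    and bound: "\<And>i x. i \<in> A \<Longrightarrow> x \<in> space Q \<Longrightarrow> norm (h i x) \<le> c i"
    and c: "integrable (count_space A) c"
  shows "(\<integral>x. infsetsum (\<lambda>i. h i x) A \<partial>Q) = infsetsum (\<lambda>i. \<integral>x. h i x \<partial>Q) A"
proof -
  interpret Q: prob_space Q by fact
  interpret C: sigma_finite_measure "count_space A"
    using A by (rule sigma_finite_measure_count_space_countable)
  interpret pair_sigma_finite "count_space A" Q ..
  have int: "integrable Q (h i)" if "i \<in> A" for i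
    using that meas bound by (intro Q.integrable_const_bound[where B = "c i"] AE_I2) auto
  have norm_int: "(\<integral>x. norm (h i x) \<partial>Q) \<le> c i" if "i \<in> A" for i
  proof -
    have "(\<integral>x. norm (h i x) \<partial>Q) \<le> (\<integral>x. c i \<partial>Q)"
      using int[OF that] bound[OF that] by (intro integral_mono) auto
    then show ?thesis by (simp add: Q.prob_space)
  qed
  have "integrable (count_space A \<Otimes>\<^sub>M Q) (case_prod h)"
  proof (rule Fubini_integrable)
    show "case_prod h \<in> borel_measurable (count_space A \<Otimes>\<^sub>M Q)"
      using A meas by (intro measurable_pair_measure_countable1) simp_all
    show "integrable (count_space A) (\<lambda>i. \<integral>x. norm (case (i, x) of (i, x) \<Rightarrow> h i x) \<partial>Q)"
      by (rule Bochner_Integration.integrable_bound[OF c]) (use norm_int in \<open>auto intro!: AE_I2 order_trans[OF norm_int]\<close>)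
    show "AE i in count_space A. integrable Q (\<lambda>x. case (i, x) of (i, x) \<Rightarrow> h i x)"
      using int by (auto intro!: AE_I2)
  qed
  then show ?thesis unfolding infsetsum_def by (rule Fubini_integral)
qed

text \<open>Submultigraphs are total functions vanishing outside \<open>E\<close>, whereas products
  of infinite sums expand over extensional functions on \<open>E\<close>; this translates between
  the two.\<close>

lemma bij_betw_submultigraph:
  "bij_betw (\<lambda>f e. if e \<in> E then f e else 0) (E \<rightarrow>\<^sub>E UNIV) {M. submultigraph E M}"
  by (rule bij_betw_byWitness[where f' = "\<lambda>M. restrict M E"])
     (auto simp: submultigraph_def PiE_def extensional_def restrict_def fun_eq_iff)

lemma countable_submultigraph:
  assumes "finite E"
  shows "countable {M. submultigraph E M}"
proof -
  have "countable (E \<rightarrow>\<^sub>E (UNIV :: nat set))" using assms by (intro countable_PiE) auto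
  then show ?thesis
    unfolding bij_betw_imp_surj_on[OF bij_betw_submultigraph, symmetric] by (rule countable_image)
qed

lemma prod_sum_submultigraph:
  fixes f :: "'e set \<Rightarrow> nat \<Rightarrow> 'c :: {real_normed_field, banach, second_countable_topology}"
  assumes E: "finite E" and f: "\<And>e. e \<in> E \<Longrightarrow> integrable (count_space UNIV) (f e)"
  shows "integrable (count_space {M. submultigraph E M}) (\<lambda>M. \<Prod>e\<in>E. f e (M e))"
    and "infsetsum (\<lambda>M. \<Prod>e\<in>E. f e (M e)) {M. submultigraph E M} = (\<Prod>e\<in>E. infsetsum (f e) UNIV)"
proof -
  let ?g = "\<lambda>f e. if e \<in> E then f e else (0 :: nat)"
  have eq: "(\<Prod>e\<in>E. f e (?g h e)) = (\<Prod>e\<in>E. f e (h e))" for h by (rule prod.cong) auto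
  have f': "Infinite_Set_Sum.abs_summable_on (f e) UNIV" if "e \<in> E" for e
    using f[OF that] by (simp add: Infinite_Set_Sum.abs_summable_on_def)
  have "Infinite_Set_Sum.abs_summable_on (\<lambda>h. \<Prod>e\<in>E. f e (h e)) (E \<rightarrow>\<^sub>E UNIV)"
    using E f' by (intro Infinite_Set_Sum.abs_summable_on_prod_PiE) auto
  then show "integrable (count_space {M. submultigraph E M}) (\<lambda>M. \<Prod>e\<in>E. f e (M e))"
    using Infinite_Set_Sum.abs_summable_on_reindex_bij_betw
      [OF bij_betw_submultigraph, of "\<lambda>M. \<Prod>e\<in>E. f e (M e)" E]
    by (simp add: eq Infinite_Set_Sum.abs_summable_on_def)
  have "infsetsum (\<lambda>h. \<Prod>e\<in>E. f e (h e)) (E \<rightarrow>\<^sub>E UNIV) = (\<Prod>e\<in>E. infsetsum (f e) UNIV)"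
    using E f' by (intro infsetsum_prod_PiE) auto
  then show "infsetsum (\<lambda>M. \<Prod>e\<in>E. f e (M e)) {M. submultigraph E M} = (\<Prod>e\<in>E. infsetsum (f e) UNIV)"
    using infsetsum_reindex_bij_betw[OF bij_betw_submultigraph, of "\<lambda>M. \<Prod>e\<in>E. f e (M e)" E]
    by (simp add: eq)
qed

lemma exp_infsetsum:
  fixes x :: "'a :: {real_normed_field, banach, second_countable_topology}"
  shows "integrable (count_space UNIV) (\<lambda>n. x ^ n / fact n)"
    and "infsetsum (\<lambda>n. x ^ n / fact n) UNIV = exp x"
proof -
  have eq: "x ^ n / fact n = x ^ n /\<^sub>R fact n" for n by (simp add: scaleR_conv_of_real divide_inverse mult.commute)
  have abs: "Infinite_Set_Sum.abs_summable_on (\<lambda>n. x ^ n / fact n) UNIV"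
    unfolding abs_summable_on_nat_iff' eq by (rule summable_norm_exp)
  then show "integrable (count_space UNIV) (\<lambda>n. x ^ n / fact n)"
    by (simp add: Infinite_Set_Sum.abs_summable_on_def)
  show "infsetsum (\<lambda>n. x ^ n / fact n) UNIV = exp x"
    using infsetsum_nat'[OF abs] by (simp add: eq exp_def)
qed

text \<open>The product over the edges of the exponential series of
  \<open>\<beta> / 2 * x e\<close>, whose term of order \<open>M e\<close> belongs to
  \<open>M e\<close> parallel copies.\<close>

lemma edge_weight_expansion:
  fixes x :: "'v set \<Rightarrow> 'a :: {real_normed_field, banach, second_countable_topology}"
  assumes E: "finite E"
  shows "integrable (count_space {M. submultigraph E M}) (\<lambda>M. of_real (edge_weight E \<beta> M) * (\<Prod>e\<in>E. x e ^ M e))"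
    and "infsetsum (\<lambda>M. of_real (edge_weight E \<beta> M) * (\<Prod>e\<in>E. x e ^ M e)) {M. submultigraph E M}
           = exp (of_real (\<beta> / 2) * (\<Sum>e\<in>E. x e))"
proof -
  define f :: "'v set \<Rightarrow> nat \<Rightarrow> 'a" where "f e n = (of_real (\<beta> / 2) * x e) ^ n / fact n" for e n
  have eq: "of_real (edge_weight E \<beta> M) * (\<Prod>e\<in>E. x e ^ M e) = (\<Prod>e\<in>E. f e (M e))" for M
    unfolding edge_weight_def of_real_prod prod.distrib[symmetric] f_def
    by (intro prod.cong) (simp_all add: power_mult_distrib power_divide)
  have f: "integrable (count_space UNIV) (f e)" for e unfolding f_def by (rule exp_infsetsum)
  have f_exp: "infsetsum (f e) UNIV = exp (of_real (\<beta> / 2) * x e)" for e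
    unfolding f_def by (rule exp_infsetsum)
  show "integrable (count_space {M. submultigraph E M}) (\<lambda>M. of_real (edge_weight E \<beta> M) * (\<Prod>e\<in>E. x e ^ M e))"
    unfolding eq using E f by (rule prod_sum_submultigraph)
  show "infsetsum (\<lambda>M. of_real (edge_weight E \<beta> M) * (\<Prod>e\<in>E. x e ^ M e)) {M. submultigraph E M}
           = exp (of_real (\<beta> / 2) * (\<Sum>e\<in>E. x e))"
    unfolding eq prod_sum_submultigraph(2)[OF E f] f_exp
    by (simp add: exp_sum[OF E, symmetric] sum_distrib_left)
qed

section \<open>The interaction along an edge\<close>

definition interaction :: "'v set \<Rightarrow> ('v \<Rightarrow> complex) \<Rightarrow> complex" where
  "interaction e \<sigma> = (\<Sum>(v, w) | {v, w} = e. \<sigma> v * cnj (\<sigma> w))"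

lemma interaction_real: "of_real (Re (interaction e \<sigma>)) = interaction e \<sigma>"
proof -
  have "bij_betw prod.swap {(v, w). {v, w} = e} {(v, w). {v, w} = e}"
    by (rule bij_betw_byWitness[where f' = prod.swap]) (auto simp: insert_commute)
  then have "(\<Sum>x\<in>{(v, w). {v, w} = e}. (\<lambda>(v, w). \<sigma> v * cnj (\<sigma> w)) (prod.swap x)) = interaction e \<sigma>"
    unfolding interaction_def by (rule sum.reindex_bij_betw)
  moreover have "(\<Sum>x\<in>{(v, w). {v, w} = e}. (\<lambda>(v, w). \<sigma> v * cnj (\<sigma> w)) (prod.swap x)) = cnj (interaction e \<sigma>)"
    unfolding interaction_def cnj_sum by (intro sum.cong) (auto simp: mult.commute)
  ultimately have "cnj (interaction e \<sigma>) = interaction e \<sigma>" by simp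
  then show ?thesis by (simp add: complex_eq_iff)
qed

lemma interaction_pair:
  assumes "v \<noteq> w"
  shows "interaction {v, w} \<sigma> = \<sigma> v * cnj (\<sigma> w) + \<sigma> w * cnj (\<sigma> v)"
proof -
  have "{(x, y). {x, y} = {v, w}} = {(v, w), (w, v)}" by (auto simp: doubleton_eq_iff)
  then show ?thesis using assms by (simp add: interaction_def)
qed

text \<open>The two terms of the interaction correspond to the two directions in which a copy can be
  traversed; this is the origin of orientations.\<close>

lemma interaction_steps:
  "interaction (fst d) \<sigma> = (\<Sum>s | step_edge s = d. \<sigma> (src s) * cnj (\<sigma> (tgt s)))"
proof -
  have "bij_betw (\<lambda>(v, w). Step v w (snd d)) {(v, w). {v, w} = fst d} {s. step_edge s = d}"
  proof (rule bij_betw_byWitness[where f' = "\<lambda>s. (src s, tgt s)"])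
    show "\<forall>s\<in>{s. step_edge s = d}. (\<lambda>(v, w). Step v w (snd d)) (src s, tgt s) = s"
      by (auto simp: step_edge_def)
    show "(\<lambda>s. (src s, tgt s)) ` {s. step_edge s = d} \<subseteq> {(v, w). {v, w} = fst d}"
      by (auto simp: step_edge_def)
  qed (auto simp: step_edge_def)
  from sum.reindex_bij_betw[OF this, of "\<lambda>s. \<sigma> (src s) * cnj (\<sigma> (tgt s))"]
  show ?thesis by (simp add: interaction_def split_beta)
qed

section \<open>Integrals of spin monomials\<close>

text \<open>Colours name the copies of the model: red reads the first spin configuration and blue
  the second.\<close>

definition spin_of :: "colour \<Rightarrow> 'a \<times> 'a \<Rightarrow> 'a" where
  "spin_of c z = (case c of Red \<Rightarrow> fst z | Blue \<Rightarrow> snd z)"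

lemma spin_of_simps [simp]: "spin_of Red z = fst z" "spin_of Blue z = snd z"
  by (simp_all add: spin_of_def)

definition step_term :: "('v \<Rightarrow> complex) \<Rightarrow> 'v step \<Rightarrow> complex" where
  "step_term \<sigma> s = \<sigma> (src s) * cnj (\<sigma> (tgt s))"

context multigraph
begin

lemma finite_steps: "d \<in> D \<Longrightarrow> finite {s. step_edge s = d}"
proof (rule finite_subset)
  assume d: "d \<in> D"
  show "{s. step_edge s = d} \<subseteq> (\<lambda>(v, w). Step v w (snd d)) ` (V \<times> V)"
  proof
    fix s assume "s \<in> {s. step_edge s = d}"
    then have s: "step_edge s = d" by simp
    then have "s = Step (src s) (tgt s) (snd d)" by (auto simp: step_edge_def)
    then show "s \<in> (\<lambda>(v, w). Step v w (snd d)) ` (V \<times> V)"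
      using proper[of s] s d by (intro image_eqI[of _ _ "(src s, tgt s)"]) auto
  qed
  show "finite ((\<lambda>(v, w). Step v w (snd d)) ` (V \<times> V))" using finite_V by simp
qed

text \<open>Choosing a direction and a colour separately for every copy is the same as choosing an
  orientation and a colouring. The inverse looks up the unique step of \<open>S\<close> over each
  copy.\<close>

lemma bij_betw_choices:
  "bij_betw (\<lambda>h. ((fst \<circ> h) ` D, restrict (snd \<circ> h) D))
     (PiE D (\<lambda>d. {s. step_edge s = d} \<times> UNIV)) coloured_orientations"
proof (rule bij_betw_byWitness[where f' = "\<lambda>(S, col). \<lambda>d\<in>D. (the_inv_into S step_edge d, col d)"])
  let ?H = "PiE D (\<lambda>d. {s. step_edge s = d} \<times> (UNIV :: colour set))"
  have edge: "step_edge (fst (h d)) = d" if "h \<in> ?H" "d \<in> D" for h d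
    using PiE_mem[OF that] by (auto simp: mem_Times_iff)
  have or: "orientation D ((fst \<circ> h) ` D)" if h: "h \<in> ?H" for h
    unfolding orientation_def using edge[OF h] by (auto simp: inj_on_def image_image)
  show "(\<lambda>h. ((fst \<circ> h) ` D, restrict (snd \<circ> h) D)) ` ?H \<subseteq> coloured_orientations"
    using or by (auto simp: coloured_orientations_def)
  show "\<forall>h\<in>?H. (case ((fst \<circ> h) ` D, restrict (snd \<circ> h) D) of
      (S, col) \<Rightarrow> \<lambda>d\<in>D. (the_inv_into S step_edge d, col d)) = h"
  proof
    fix h assume h: "h \<in> ?H"
    have "the_inv_into ((fst \<circ> h) ` D) step_edge d = fst (h d)" if "d \<in> D" for d
      using or[OF h] edge[OF h that] that
      by (intro the_inv_into_f_eq) (auto simp: orientation_def)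
    then show "(case ((fst \<circ> h) ` D, restrict (snd \<circ> h) D) of
        (S, col) \<Rightarrow> \<lambda>d\<in>D. (the_inv_into S step_edge d, col d)) = h"
      using h by (auto simp: fun_eq_iff PiE_def extensional_def restrict_def)
  qed
  show "\<forall>x\<in>coloured_orientations. (\<lambda>h. ((fst \<circ> h) ` D, restrict (snd \<circ> h) D))
      ((\<lambda>(S, col). \<lambda>d\<in>D. (the_inv_into S step_edge d, col d)) x) = x"
  proof
    fix x assume "x \<in> coloured_orientations"
    then obtain S col where x: "x = (S, col)" "orientation D S" "col \<in> D \<rightarrow>\<^sub>E UNIV"
      by (auto simp: coloured_orientations_def)
    then have inj: "inj_on step_edge S" "step_edge ` S = D" by (auto simp: orientation_def)
    have "(\<lambda>d. the_inv_into S step_edge d) ` D = S"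
      using bij_betw_the_inv_into[of step_edge S D] inj by (simp add: bij_betw_def)
    then show "(\<lambda>h. ((fst \<circ> h) ` D, restrict (snd \<circ> h) D))
      ((\<lambda>(S, col). \<lambda>d\<in>D. (the_inv_into S step_edge d, col d)) x) = x"
      using x by (auto simp: fun_eq_iff PiE_def extensional_def restrict_def image_image)
  qed
  show "(\<lambda>(S, col). \<lambda>d\<in>D. (the_inv_into S step_edge d, col d)) ` coloured_orientations \<subseteq> ?H"
  proof (intro image_subsetI)
    fix x assume "x \<in> coloured_orientations"
    then obtain S col where x: "x = (S, col)" "orientation D S" by (auto simp: coloured_orientations_def)
    then have "step_edge (the_inv_into S step_edge d) = d" if "d \<in> D" for d
      using that by (intro f_the_inv_into_f) (auto simp: orientation_def)
    then show "(\<lambda>(S, col). \<lambda>d\<in>D. (the_inv_into S step_edge d, col d)) x \<in> ?H" by (auto simp: x(1))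
  qed
qed

text \<open>Multiplying out: each copy contributes four terms, one for each direction and
  colour.\<close>

lemma prod_interactions:
  "(\<Prod>d\<in>D. interaction (fst d) (fst z) + interaction (fst d) (snd z))
     = (\<Sum>(S, col)\<in>coloured_orientations. \<Prod>s\<in>S. step_term (spin_of (col (step_edge s)) z) s)"
proof -
  let ?B = "\<lambda>d. {s. step_edge s = d} \<times> (UNIV :: colour set)"
  define F where "F x = (\<Prod>s\<in>fst x. step_term (spin_of (snd x (step_edge s)) z) s)"
    for x :: "'v step set \<times> ('v set \<times> nat \<Rightarrow> colour)"
  have "interaction (fst d) (fst z) + interaction (fst d) (snd z)
      = (\<Sum>y\<in>?B d. step_term (spin_of (snd y) z) (fst y))" for d
  proof -
    have "(\<Sum>y\<in>?B d. step_term (spin_of (snd y) z) (fst y))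
        = (\<Sum>s | step_edge s = d. \<Sum>c\<in>UNIV. step_term (spin_of c z) s)"
      by (simp add: sum.cartesian_product split_beta)
    also have "\<dots> = (\<Sum>s | step_edge s = d. step_term (fst z) s + step_term (snd z) s)"
      by (simp add: UNIV_colour)
    finally show ?thesis by (simp add: interaction_steps step_term_def sum.distrib)
  qed
  then have "(\<Prod>d\<in>D. interaction (fst d) (fst z) + interaction (fst d) (snd z))
      = (\<Prod>d\<in>D. \<Sum>y\<in>?B d. step_term (spin_of (snd y) z) (fst y))" by simp
  also have "\<dots> = (\<Sum>h\<in>PiE D ?B. \<Prod>d\<in>D. step_term (spin_of (snd (h d)) z) (fst (h d)))"
    using finite_D finite_steps by (intro prod_sum_PiE) (auto simp: UNIV_colour)
  also have "\<dots> = (\<Sum>h\<in>PiE D ?B. F ((fst \<circ> h) ` D, restrict (snd \<circ> h) D))"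
  proof (rule sum.cong)
    fix h assume h: "h \<in> PiE D ?B"
    have edge: "step_edge (fst (h d)) = d" if "d \<in> D" for d
      using PiE_mem[OF h that] by (auto simp: mem_Times_iff)
    then have "inj_on (fst \<circ> h) D" by (intro inj_on_inverseI[of _ step_edge]) simp
    then show "(\<Prod>d\<in>D. step_term (spin_of (snd (h d)) z) (fst (h d)))
        = F ((fst \<circ> h) ` D, restrict (snd \<circ> h) D)"
      unfolding F_def fst_conv snd_conv by (subst prod.reindex) (auto simp: edge intro!: prod.cong)
  qed simp
  also have "\<dots> = (\<Sum>x\<in>coloured_orientations. F x)"
    by (rule sum.reindex_bij_betw[OF bij_betw_choices])
  finally show ?thesis by (simp add: F_def split_beta)
qed

lemma prod_image_card:
  fixes f :: "'v \<Rightarrow> complex"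
  assumes "finite T" "g ` T \<subseteq> V"
  shows "(\<Prod>s\<in>T. f (g s)) = (\<Prod>v\<in>V. f v ^ card {s \<in> T. g s = v})"
proof -
  have "(\<Prod>s\<in>T. f (g s)) = (\<Prod>v\<in>V. \<Prod>s\<in>{s \<in> T. g s = v}. f (g s))"
    using assms finite_V by (intro prod.group[symmetric])
  also have "\<dots> = (\<Prod>v\<in>V. f v ^ card {s \<in> T. g s = v})" by (intro prod.cong) simp_all
  finally show ?thesis .
qed

section \<open>Monomials attached to a coloured orientation\<close>

context
  fixes a b :: 'v and k :: nat and S :: "'v step set" and col :: "'v set \<times> nat \<Rightarrow> colour"
  assumes ab: "a \<in> V" "b \<in> V" and or: "orientation D S" and col: "col \<in> D \<rightarrow>\<^sub>E UNIV"
begin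

definition monomial :: "colour \<Rightarrow> ('v \<Rightarrow> complex) \<Rightarrow> complex" where
  "monomial c \<sigma> = (\<sigma> a * cnj (\<sigma> b)) ^ k * (\<Prod>s\<in>{s \<in> S. col (step_edge s) = c}. step_term \<sigma> s)"

definition out_power where
  "out_power c v = (if v = a then k else 0) + card {s \<in> S. src s = v \<and> col (step_edge s) = c}"

definition in_power where
  "in_power c v = (if v = b then k else 0) + card {s \<in> S. tgt s = v \<and> col (step_edge s) = c}"

text \<open>A step leaving \<open>v\<close> contributes the spin at \<open>v\<close> and a step
  entering \<open>v\<close> its conjugate. Inserting the two-point term acts like \<open>k\<close>
  extra departures from \<open>a\<close> and \<open>k\<close> extra arrivals at
  \<open>b\<close>.\<close>

lemma monomial_eq: "monomial c \<sigma> = (\<Prod>v\<in>V. \<sigma> v ^ out_power c v * cnj (\<sigma> v) ^ in_power c v)"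
proof -
  let ?T = "{s \<in> S. col (step_edge s) = c}"
  have fin: "finite ?T" using orientationD(1)[OF or] by simp
  have V: "src ` ?T \<subseteq> V" "tgt ` ?T \<subseteq> V" using orientationD(2)[OF or] by auto
  have delta: "f x ^ k = (\<Prod>v\<in>V. f v ^ (if v = x then k else 0))" if "x \<in> V" for x and f :: "'v \<Rightarrow> complex"
  proof -
    have "(\<Prod>v\<in>V. f v ^ (if v = x then k else 0)) = (\<Prod>v\<in>V. if v = x then f v ^ k else 1)"
      by (intro prod.cong) auto
    then show ?thesis using that finite_V by (simp add: prod.delta)
  qed
  have "monomial c \<sigma> = \<sigma> a ^ k * cnj (\<sigma> b) ^ k * ((\<Prod>s\<in>?T. \<sigma> (src s)) * (\<Prod>s\<in>?T. cnj (\<sigma> (tgt s))))"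
    by (simp add: monomial_def step_term_def prod.distrib power_mult_distrib)
  also have "\<dots> = (\<Prod>v\<in>V. \<sigma> v ^ (if v = a then k else 0)) * (\<Prod>v\<in>V. cnj (\<sigma> v) ^ (if v = b then k else 0)) *
      ((\<Prod>v\<in>V. \<sigma> v ^ card {s \<in> ?T. src s = v}) * (\<Prod>v\<in>V. cnj (\<sigma> v) ^ card {s \<in> ?T. tgt s = v}))"
    using delta[OF ab(1), of \<sigma>] delta[OF ab(2), of "\<lambda>v. cnj (\<sigma> v)"]
      prod_image_card[OF fin V(1), of \<sigma>] prod_image_card[OF fin V(2), of "\<lambda>v. cnj (\<sigma> v)"] by simp
  also have "\<dots> = (\<Prod>v\<in>V. \<sigma> v ^ out_power c v * cnj (\<sigma> v) ^ in_power c v)"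
  proof -
    have "{s \<in> ?T. src s = v} = {s \<in> S. src s = v \<and> col (step_edge s) = c}"
      "{s \<in> ?T. tgt s = v} = {s \<in> S. tgt s = v \<and> col (step_edge s) = c}" for v
      by auto
    then show ?thesis
      unfolding prod.distrib[symmetric] out_power_def in_power_def power_add
      by (simp only: mult_ac)
  qed
  finally show ?thesis .
qed

lemma monomial_measurable: "monomial c \<in> borel_measurable (spins V)"
proof -
  have cnj: "cnj \<in> borel_measurable borel"
    by (intro borel_measurable_continuous_onI continuous_intros)
  have "(\<lambda>\<sigma>. \<Prod>v\<in>V. \<sigma> v ^ out_power c v * cnj (\<sigma> v) ^ in_power c v) \<in> borel_measurable (spins V)"
    by (intro borel_measurable_prod borel_measurable_times borel_measurable_power
        measurable_compose[OF spin_measurable cnj] spin_measurable)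
  then show ?thesis unfolding monomial_eq[abs_def] .
qed

lemma monomial_norm: "\<sigma> \<in> space (spins V) \<Longrightarrow> norm (monomial c \<sigma>) \<le> 1"
  by (simp add: monomial_eq prod_norm[symmetric] norm_mult norm_power norm_spin)

text \<open>A monomial survives integration only if the powers of each spin and of its conjugate
  agree. The insertion adds \<open>k\<close> to the outgoing side at \<open>a\<close> and to the
  incoming side at \<open>b\<close>, so the steps themselves must carry \<open>k\<close> units from
  \<open>b\<close> to \<open>a\<close>.\<close>

lemma integral_monomial:
  "(\<integral>z. monomial Red (fst z) * monomial Blue (snd z) \<partial>(spins V \<Otimes>\<^sub>M spins V))
     = of_bool ((S, col) \<in> flows V D a b (int k))"
proof -
  have "(\<integral>z. monomial Red (fst z) * monomial Blue (snd z) \<partial>(spins V \<Otimes>\<^sub>M spins V))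
      = (\<integral>\<sigma>. monomial Red \<sigma> \<partial>spins V) * (\<integral>\<sigma>. monomial Blue \<sigma> \<partial>spins V)"
    using monomial_measurable monomial_norm
    by (intro integral_pair_product[where B = 1 and C = 1] prob_space_spins)
  also have "\<dots> = of_bool (\<forall>v\<in>V. out_power Red v = in_power Red v)
      * of_bool (\<forall>v\<in>V. out_power Blue v = in_power Blue v)"
    unfolding monomial_eq integral_spin_monomial[OF finite_V] ..
  also have "\<dots> = of_bool (\<forall>v\<in>V. \<forall>c. out_power c v = in_power c v)"
  proof -
    have "(\<forall>c. P c) \<longleftrightarrow> P Red \<and> P Blue" for P by (metis colour.exhaust)
    then show ?thesis by (auto simp: of_bool_def)
  qed
  also have "out_power c v = in_power c v \<longleftrightarrow>
      net_flow S col c v = int k * (of_bool (v = b) - of_bool (v = a))" for c v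
  proof -
    have "int (out_power c v) - int (in_power c v)
        = net_flow S col c v - int k * (of_bool (v = b) - of_bool (v = a))"
      unfolding net_flow_eq[OF orientationD(1)[OF or]] out_power_def in_power_def by simp
    then show ?thesis by linarith
  qed
  then have "(\<forall>v\<in>V. \<forall>c. out_power c v = in_power c v) \<longleftrightarrow> (S, col) \<in> flows V D a b (int k)"
    using or col by (simp add: flows_def)
  finally show ?thesis by simp
qed

lemma monomial_split:
  "monomial Red (fst z) * monomial Blue (snd z) =
     (fst z a * cnj (fst z b)) ^ k * (snd z a * cnj (snd z b)) ^ k *
       (\<Prod>s\<in>S. step_term (spin_of (col (step_edge s)) z) s)"
proof -
  let ?T = "\<lambda>c. {s \<in> S. col (step_edge s) = c}"
  have S: "S = ?T Red \<union> ?T Blue" by (auto intro: colour.exhaust)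
  have fin: "finite S" using or by (rule orientationD)
  have "(\<Prod>s\<in>?T Red \<union> ?T Blue. step_term (spin_of (col (step_edge s)) z) s)
    = (\<Prod>s\<in>?T Red. step_term (spin_of (col (step_edge s)) z) s) *
      (\<Prod>s\<in>?T Blue. step_term (spin_of (col (step_edge s)) z) s)"
    using fin by (intro prod.union_disjoint) auto
  then show ?thesis unfolding S[symmetric] by (simp add: monomial_def)
qed

end

lemma integral_interactions:
  assumes ab: "a \<in> V" "b \<in> V"
  shows "(\<integral>z. (fst z a * cnj (fst z b)) ^ k * (snd z a * cnj (snd z b)) ^ k *
      (\<Prod>d\<in>D. interaction (fst d) (fst z) + interaction (fst d) (snd z)) \<partial>(spins V \<Otimes>\<^sub>M spins V))
    = of_nat (card (flows V D a b (int k)))"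
proof -
  let ?Q = "spins V \<Otimes>\<^sub>M spins V"
  let ?m = "\<lambda>x z. monomial a b k (fst x) (snd x) Red (fst z) * monomial a b k (fst x) (snd x) Blue (snd z)"
  interpret P: prob_space "spins V" by (rule prob_space_spins)
  interpret PP: pair_prob_space "spins V" "spins V" ..
  have x: "orientation D (fst x)" "snd x \<in> D \<rightarrow>\<^sub>E UNIV" if "x \<in> coloured_orientations" for x
    using that by (auto simp: coloured_orientations_def)
  have int: "integrable ?Q (?m x)" if "x \<in> coloured_orientations" for x
  proof (rule PP.integrable_const_bound[where B = 1])
    show "?m x \<in> borel_measurable ?Q"
      using measurable_compose[OF measurable_fst monomial_measurable[OF ab x[OF that]]]
        measurable_compose[OF measurable_snd monomial_measurable[OF ab x[OF that]]]
      by (intro borel_measurable_times)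
    show "AE z in ?Q. norm (?m x z) \<le> 1"
    proof (rule AE_I2)
      fix z assume "z \<in> space ?Q"
      then have "fst z \<in> space (spins V)" "snd z \<in> space (spins V)" by (auto simp: space_pair_measure)
      then show "norm (?m x z) \<le> 1"
        unfolding norm_mult using monomial_norm[OF ab x[OF that]] by (intro mult_le_one) auto
    qed
  qed
  have "(fst z a * cnj (fst z b)) ^ k * (snd z a * cnj (snd z b)) ^ k *
      (\<Prod>d\<in>D. interaction (fst d) (fst z) + interaction (fst d) (snd z))
      = (\<Sum>x\<in>coloured_orientations. ?m x z)" for z
    unfolding prod_interactions sum_distrib_left
    by (intro sum.cong) (auto simp: monomial_split[OF ab x])
  then have "(\<integral>z. (fst z a * cnj (fst z b)) ^ k * (snd z a * cnj (snd z b)) ^ k *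
      (\<Prod>d\<in>D. interaction (fst d) (fst z) + interaction (fst d) (snd z)) \<partial>?Q)
    = (\<integral>z. (\<Sum>x\<in>coloured_orientations. ?m x z) \<partial>?Q)" by simp
  also have "\<dots> = (\<Sum>x\<in>coloured_orientations. \<integral>z. ?m x z \<partial>?Q)"
    using int by (rule Bochner_Integration.integral_sum)
  also have "\<dots> = (\<Sum>x\<in>coloured_orientations. of_bool (x \<in> flows V D a b (int k)))"
    by (intro sum.cong refl) (simp add: integral_monomial[OF ab x])
  also have "\<dots> = of_nat (card (flows V D a b (int k)))"
  proof -
    have "flows V D a b (int k) \<subseteq> coloured_orientations"
      by (auto simp: flows_def coloured_orientations_def)
    then have "coloured_orientations \<inter> flows V D a b (int k) = flows V D a b (int k)" by blast
    then show ?thesis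
      using finite_coloured_orientations by (simp add: of_bool_def sum.If_cases)
  qed
  finally show ?thesis .
qed

end

section \<open>The two measures\<close>

text \<open>Shared by both models: \<open>f\<close> may be complex for the spins and real for the
  loops. A positive finite total mass makes the normalisation a rescaling by its inverse.\<close>

lemma normalised_density:
  fixes d :: "'a \<Rightarrow> real" and f :: "'a \<Rightarrow> 'b :: {banach, second_countable_topology}"
  assumes d: "integrable M d" "\<And>x. x \<in> space M \<Longrightarrow> 0 \<le> d x" and pos: "0 < (\<integral>x. d x \<partial>M)"
  shows prob_space_normalised_density: "prob_space (normalised (density M (\<lambda>x. ennreal (d x))))"
    and integral_normalised_density: "f \<in> borel_measurable M \<Longrightarrow> integrable M (\<lambda>x. d x *\<^sub>R f x) \<Longrightarrow>
      (\<integral>x. f x \<partial>normalised (density M (\<lambda>x. ennreal (d x)))) = (\<integral>x. d x *\<^sub>R f x \<partial>M) /\<^sub>R (\<integral>x. d x \<partial>M)"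
proof -
  let ?N = "density M (\<lambda>x. ennreal (d x))" and ?Z = "\<integral>x. d x \<partial>M"
  have meas: "d \<in> borel_measurable M" using d(1) by (rule borel_measurable_integrable)
  have Z: "emeasure ?N (space ?N) = ennreal ?Z"
  proof -
    have "emeasure ?N (space ?N) = (\<integral>\<^sup>+x. ennreal (d x) * indicator (space M) x \<partial>M)"
      using meas by (subst emeasure_density) auto
    also have "\<dots> = (\<integral>\<^sup>+x. ennreal (d x) \<partial>M)" by (intro nn_integral_cong) simp
    also have "\<dots> = ennreal ?Z" using d by (intro nn_integral_eq_integral AE_I2)
    finally show ?thesis .
  qed
  show "prob_space (normalised ?N)"
    unfolding normalised_def using Z pos by (intro prob_space_uniform_measure) auto
  assume f: "f \<in> borel_measurable M" and int: "integrable M (\<lambda>x. d x *\<^sub>R f x)"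
  have "normalised ?N = density ?N (\<lambda>x. ennreal (1 / ?Z))"
    unfolding normalised_def uniform_measure_def Z using pos divide_ennreal[of 1 ?Z]
    by (intro density_cong AE_I2) auto
  then have "(\<integral>x. f x \<partial>normalised ?N) = (\<integral>x. (1 / ?Z) *\<^sub>R f x \<partial>?N)"
    using f pos by (simp add: integral_density)
  also have "\<dots> = (\<integral>x. d x *\<^sub>R (1 / ?Z) *\<^sub>R f x \<partial>M)"
    using f meas d(2) by (intro integral_density AE_I2) auto
  also have "\<dots> = (\<integral>x. (1 / ?Z) *\<^sub>R d x *\<^sub>R f x \<partial>M)" by (simp add: mult.commute)
  also have "\<dots> = (1 / ?Z) *\<^sub>R (\<integral>x. d x *\<^sub>R f x \<partial>M)" by (intro integral_scaleR_right int)
  finally show "(\<integral>x. f x \<partial>normalised ?N) = (\<integral>x. d x *\<^sub>R f x \<partial>M) /\<^sub>R ?Z"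
    by (simp add: inverse_eq_divide)
qed

lemma prod_medges:
  fixes u :: "'v set \<Rightarrow> complex"
  assumes "finite E" "submultigraph E M"
  shows "(\<Prod>e\<in>E. u e ^ M e) = (\<Prod>d\<in>medges M. u (fst d))"
proof -
  have "(\<Prod>e\<in>E. u e ^ M e) = (\<Prod>e\<in>E. \<Prod>i\<in>{..<M e}. u e)" by simp
  also have "\<dots> = (\<Prod>(e, i)\<in>(SIGMA e:E. {..<M e}). u e)" using assms(1) by (intro prod.Sigma) auto
  finally show ?thesis by (simp add: medges_Sigma[OF assms(2)] split_beta)
qed

section \<open>Squared spin integrals as sums over flows\<close>

context
  fixes V :: "'v set" and E :: "'v set set" and \<beta> :: real and a b :: 'v
  assumes G: "finite_graph V E" and \<beta>: "\<beta> > 0" and ab: "a \<in> V" "b \<in> V"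
begin

lemma finite_E: "finite E"
  using G by (rule finite_graph_finite_edges)

lemma edge_cases:
  assumes "e \<in> E"
  obtains v w where "e = {v, w}" "v \<in> V" "w \<in> V" "v \<noteq> w"
proof -
  have "e \<in> {{v, w} | v w. v \<in> V \<and> w \<in> V \<and> v \<noteq> w}" using G assms unfolding finite_graph_def by blast
  then show ?thesis using that by blast
qed

lemma edge_weight_nonneg: "0 \<le> edge_weight E \<beta> M"
  unfolding edge_weight_def using \<beta> by (intro prod_nonneg) simp

lemma cnj_spin_measurable: "v \<in> V \<Longrightarrow> (\<lambda>\<sigma>. cnj (\<sigma> v)) \<in> borel_measurable (spins V)"
  by (rule measurable_compose[OF spin_measurable])
     (auto intro!: borel_measurable_continuous_onI continuous_intros)

lemma interaction_measurable:
  assumes "e \<in> E"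
  shows "interaction e \<in> borel_measurable (spins V)"
proof -
  obtain v w where e: "e = {v, w}" "v \<in> V" "w \<in> V" "v \<noteq> w" using assms by (rule edge_cases)
  show ?thesis
    unfolding e(1) interaction_pair[OF e(4), abs_def] using e(2,3)
    by (intro borel_measurable_add borel_measurable_times spin_measurable cnj_spin_measurable)
qed

lemma interaction_norm:
  assumes "e \<in> E" "\<sigma> \<in> space (spins V)"
  shows "norm (interaction e \<sigma>) \<le> 2"
proof -
  obtain v w where e: "e = {v, w}" "v \<in> V" "w \<in> V" "v \<noteq> w" using assms(1) by (rule edge_cases)
  have "norm (interaction e \<sigma>) \<le> norm (\<sigma> v * cnj (\<sigma> w)) + norm (\<sigma> w * cnj (\<sigma> v))"
    unfolding e(1) interaction_pair[OF e(4)] by (rule norm_triangle_ineq)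
  also have "\<dots> = 2" using e(2,3) assms(2) by (simp add: norm_mult norm_spin)
  finally show ?thesis .
qed

text \<open>\<open>gibbs 0\<close> is the density and \<open>gibbs 1\<close> the density times the
  observable, taken complex so that numerator and partition function are treated together.\<close>

definition gibbs :: "nat \<Rightarrow> ('v \<Rightarrow> complex) \<Rightarrow> complex" where
  "gibbs k \<sigma> = (\<sigma> a * cnj (\<sigma> b)) ^ k * exp (of_real (\<beta> / 2) * (\<Sum>e\<in>E. interaction e \<sigma>))"

lemma exp_borel: "(exp :: complex \<Rightarrow> complex) \<in> borel_measurable borel"
  by (intro borel_measurable_continuous_onI continuous_intros)

lemma gibbs_measurable: "gibbs k \<in> borel_measurable (spins V)"
proof -
  have "(\<lambda>\<sigma>. exp (of_real (\<beta> / 2) * (\<Sum>e\<in>E. interaction e \<sigma>))) \<in> borel_measurable (spins V)"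
    by (intro measurable_compose[OF _ exp_borel] borel_measurable_times borel_measurable_sum
        interaction_measurable) auto
  then show ?thesis
    unfolding gibbs_def[abs_def] using ab
    by (intro borel_measurable_times borel_measurable_power spin_measurable cnj_spin_measurable)
qed

lemma gibbs_norm:
  assumes "\<sigma> \<in> space (spins V)"
  shows "norm (gibbs k \<sigma>) \<le> exp (\<beta> * card E)"
proof -
  have "norm (\<Sum>e\<in>E. interaction e \<sigma>) \<le> (\<Sum>e\<in>E. 2)"
    using interaction_norm assms by (intro sum_norm_le) auto
  then have "norm (of_real (\<beta> / 2) * (\<Sum>e\<in>E. interaction e \<sigma>)) \<le> \<beta> / 2 * (2 * card E)"
    unfolding norm_mult using \<beta> by (intro mult_mono) auto
  then have "norm (exp (of_real (\<beta> / 2) * (\<Sum>e\<in>E. interaction e \<sigma>))) \<le> exp (\<beta> * card E)"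
    by (intro order_trans[OF norm_exp]) simp
  then show ?thesis
    using assms ab by (simp add: gibbs_def norm_mult norm_power norm_spin)
qed

lemma gibbs_integrable: "integrable (spins V) (gibbs k)"
proof -
  interpret P: prob_space "spins V" by (rule prob_space_spins)
  show ?thesis
    using gibbs_measurable gibbs_norm by (intro P.integrable_const_bound[where B = "exp (\<beta> * card E)"] AE_I2)
qed

lemma gibbs_0: "gibbs 0 \<sigma> = of_real (xy_density E \<beta> \<sigma>)"
proof -
  have "of_real (Re (\<Sum>e\<in>E. interaction e \<sigma>)) = (\<Sum>e\<in>E. interaction e \<sigma>)"
    by (simp add: interaction_real)
  then show ?thesis
    by (simp add: gibbs_def xy_density_def interaction_def[symmetric] exp_of_real[symmetric])
qed

lemma gibbs_1: "gibbs 1 \<sigma> = xy_density E \<beta> \<sigma> *\<^sub>R (\<sigma> a * cnj (\<sigma> b))"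
  using gibbs_0[of \<sigma>] by (simp add: gibbs_def scaleR_conv_of_real mult.commute)

definition flow_weight :: "nat \<Rightarrow> ('v set \<Rightarrow> nat) \<Rightarrow> real" where
  "flow_weight k M = edge_weight E \<beta> M * real (card (flows V (medges M) a b (int k)))"

text \<open>In the product of two copies the exponents add, so one expansion over multiplicities
  serves both. The interchange with the integral rests on a summable bound that also yields the
  summability of the flow weights.\<close>

lemma square_gibbs_integral:
  shows "integrable (count_space {M. submultigraph E M}) (flow_weight k)"
    and "(\<integral>\<sigma>. gibbs k \<sigma> \<partial>spins V)\<^sup>2 = of_real (infsetsum (flow_weight k) {M. submultigraph E M})"
proof -
  let ?\<M> = "{M. submultigraph E M}" and ?Q = "spins V \<Otimes>\<^sub>M spins V"
  interpret P: prob_space "spins V" by (rule prob_space_spins)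
  interpret PP: pair_prob_space "spins V" "spins V" ..
  define U where "U e z = interaction e (fst z) + interaction e (snd z)" for e and z :: "('v \<Rightarrow> complex) \<times> ('v \<Rightarrow> complex)"
  define g where "g z = (fst z a * cnj (fst z b)) ^ k * (snd z a * cnj (snd z b)) ^ k"
    for z :: "('v \<Rightarrow> complex) \<times> ('v \<Rightarrow> complex)"
  define h where "h M z = g z * (of_real (edge_weight E \<beta> M) * (\<Prod>e\<in>E. U e z ^ M e))" for M z
  \<comment> \<open>The 4 bounds \<open>U e z\<close>, a sum of two interactions of norm at most 2.
    The bound is again an exponential expansion, with all \<open>x e = 4\<close>, hence
    summable.\<close>
  define c where "c M = edge_weight E \<beta> M * (\<Prod>e\<in>E. 4 ^ M e)" for M
  have space: "fst z \<in> space (spins V)" "snd z \<in> space (spins V)" if "z \<in> space ?Q" for z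
    using that by (auto simp: space_pair_measure)
  have U_meas: "U e \<in> borel_measurable ?Q" if "e \<in> E" for e
    unfolding U_def[abs_def] using interaction_measurable[OF that]
    by (intro borel_measurable_add measurable_compose[OF measurable_fst] measurable_compose[OF measurable_snd])
  have U_norm: "norm (U e z) \<le> 4" if "e \<in> E" "z \<in> space ?Q" for e z
    using interaction_norm[OF that(1) space(1)[OF that(2)]] interaction_norm[OF that(1) space(2)[OF that(2)]]
    unfolding U_def by norm
  have g_meas: "g \<in> borel_measurable ?Q"
    unfolding g_def[abs_def] using spin_measurable ab cnj_spin_measurable
    by (intro borel_measurable_times borel_measurable_power)
       (auto intro!: measurable_compose[OF measurable_fst] measurable_compose[OF measurable_snd])
  have g_norm: "norm (g z) = 1" if "z \<in> space ?Q" for z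
    using space[OF that] ab by (simp add: g_def norm_mult norm_power norm_spin)
  have h_meas: "h M \<in> borel_measurable ?Q" for M
    unfolding h_def[abs_def] using g_meas U_meas
    by (intro borel_measurable_times borel_measurable_prod borel_measurable_power) auto
  have h_norm: "norm (h M z) \<le> c M" if "z \<in> space ?Q" for M z
  proof -
    have "(\<Prod>e\<in>E. norm (U e z) ^ M e) \<le> (\<Prod>e\<in>E. 4 ^ M e)"
      using U_norm that by (intro prod_mono conjI power_mono) auto
    then show ?thesis
      unfolding h_def c_def norm_mult g_norm[OF that]
      using edge_weight_nonneg[of M] by (simp add: prod_norm[symmetric] norm_power mult_left_mono)
  qed
  have c_int: "integrable (count_space ?\<M>) c"
    unfolding c_def[abs_def] using edge_weight_expansion(1)[OF finite_E, of \<beta> "\<lambda>_. 4 :: real"] by simp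
  have h_int: "(\<integral>z. h M z \<partial>?Q) = of_real (flow_weight k M)" if M: "M \<in> ?\<M>" for M
  proof -
    interpret multigraph V "medges M" using multigraph_medges[OF G] M by simp
    have "h M z = of_real (edge_weight E \<beta> M) * (g z * (\<Prod>d\<in>medges M. U (fst d) z))" for z
      unfolding h_def using M prod_medges[OF finite_E, of M "\<lambda>e. U e z"] by simp
    then have "(\<integral>z. h M z \<partial>?Q) = of_real (edge_weight E \<beta> M) * (\<integral>z. g z * (\<Prod>d\<in>medges M. U (fst d) z) \<partial>?Q)"
      by simp
    then show ?thesis
      unfolding g_def U_def integral_interactions[OF ab] by (simp add: flow_weight_def)
  qed
  have fw_norm: "norm (flow_weight k M) \<le> c M" if "M \<in> ?\<M>" for M
  proof -
    have "integrable ?Q (h M)"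
      using h_meas h_norm by (intro PP.integrable_const_bound[where B = "c M"] AE_I2)
    then have "(\<integral>z. norm (h M z) \<partial>?Q) \<le> (\<integral>z. c M \<partial>?Q)"
      using h_norm by (intro integral_mono) auto
    with integral_norm_bound have "norm (\<integral>z. h M z \<partial>?Q) \<le> (\<integral>z. c M \<partial>?Q)"
      by (rule order_trans)
    then show ?thesis unfolding h_int[OF that] by (simp add: PP.prob_space)
  qed
  show fw: "integrable (count_space ?\<M>) (flow_weight k)"
    by (rule Bochner_Integration.integrable_bound[OF c_int])
       (use fw_norm in \<open>auto intro!: AE_I2 order_trans[OF fw_norm[unfolded real_norm_def]]\<close>)
  have "(\<integral>\<sigma>. gibbs k \<sigma> \<partial>spins V)\<^sup>2 = (\<integral>z. gibbs k (fst z) * gibbs k (snd z) \<partial>?Q)"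
    unfolding power2_eq_square
    using integral_pair_product[OF prob_space_spins gibbs_measurable gibbs_measurable gibbs_norm gibbs_norm] by simp
  also have "\<dots> = (\<integral>z. infsetsum (\<lambda>M. h M z) ?\<M> \<partial>?Q)"
  proof (rule Bochner_Integration.integral_cong[OF refl])
    fix z
    note exp = edge_weight_expansion[OF finite_E, of \<beta> "\<lambda>e. U e z"]
    have "gibbs k (fst z) * gibbs k (snd z) = g z * exp (of_real (\<beta> / 2) * (\<Sum>e\<in>E. U e z))"
      unfolding gibbs_def g_def U_def sum.distrib distrib_left exp_add by (simp only: mult_ac)
    also have "\<dots> = infsetsum (\<lambda>M. h M z) ?\<M>"
      unfolding exp(2)[symmetric] h_def using exp(1)
      by (intro infsetsum_cmult_right[symmetric]) (simp add: Infinite_Set_Sum.abs_summable_on_def)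
    finally show "gibbs k (fst z) * gibbs k (snd z) = infsetsum (\<lambda>M. h M z) ?\<M>" .
  qed
  also have "\<dots> = infsetsum (\<lambda>M. \<integral>z. h M z \<partial>?Q) ?\<M>"
    using h_meas h_norm c_int countable_submultigraph[OF finite_E] PP.prob_space_axioms
    by (intro integral_infsetsum)
  also have "\<dots> = infsetsum (\<lambda>M. of_real (flow_weight k M)) ?\<M>"
    using h_int by (intro infsetsum_cong) auto
  also have "\<dots> = of_real (infsetsum (flow_weight k) ?\<M>)"
    by (rule infsetsum_of_real)
  finally show "(\<integral>\<sigma>. gibbs k \<sigma> \<partial>spins V)\<^sup>2 = of_real (infsetsum (flow_weight k) ?\<M>)" .
qed

text \<open>For positivity, the exponent is at least \<open>- (\<beta> * card E)\<close>: each edge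
  interaction is at least -2 and is multiplied by \<open>\<beta> / 2\<close>.\<close>

lemma xy_density_integrable: "integrable (spins V) (xy_density E \<beta>)"
  and xy_density_integral_pos: "0 < (\<integral>\<sigma>. xy_density E \<beta> \<sigma> \<partial>spins V)"
proof -
  interpret P: prob_space "spins V" by (rule prob_space_spins)
  have "integrable (spins V) (\<lambda>\<sigma>. Re (gibbs 0 \<sigma>))" by (intro integrable_Re gibbs_integrable)
  then show int: "integrable (spins V) (xy_density E \<beta>)" by (simp add: gibbs_0)
  have "exp (- (\<beta> * card E)) \<le> xy_density E \<beta> \<sigma>" if "\<sigma> \<in> space (spins V)" for \<sigma>
  proof -
    have "norm (\<Sum>e\<in>E. interaction e \<sigma>) \<le> (\<Sum>e\<in>E. 2)"
      using interaction_norm that by (intro sum_norm_le) auto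
    then have "- (2 * card E) \<le> Re (\<Sum>e\<in>E. interaction e \<sigma>)"
      using abs_Re_le_cmod[of "\<Sum>e\<in>E. interaction e \<sigma>"] by simp
    then have "\<beta> / 2 * - (2 * card E) \<le> \<beta> / 2 * Re (\<Sum>e\<in>E. interaction e \<sigma>)"
      using \<beta> by (intro mult_left_mono) auto
    then show ?thesis by (simp add: xy_density_def interaction_def[symmetric])
  qed
  then have "(\<integral>\<sigma>. exp (- (\<beta> * card E)) \<partial>spins V) \<le> (\<integral>\<sigma>. xy_density E \<beta> \<sigma> \<partial>spins V)"
    using int by (intro integral_mono) auto
  then show "0 < (\<integral>\<sigma>. xy_density E \<beta> \<sigma> \<partial>spins V)"
    using exp_gt_zero[of "- (\<beta> * card E)"] by (simp add: P.prob_space del: exp_gt_zero) 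
qed

definition flow_sum :: "nat \<Rightarrow> real" where
  "flow_sum k = infsetsum (flow_weight k) {M. submultigraph E M}"

text \<open>It is the square of the positive XY partition function. As the total loop weight turns
  out to be \<open>flow_sum 0\<close>, this makes the loop measure normalisable.\<close>

lemma flow_sum_0_pos: "0 < flow_sum 0"
proof -
  have "of_real (flow_sum 0) = (complex_of_real (\<integral>\<sigma>. xy_density E \<beta> \<sigma> \<partial>spins V))\<^sup>2"
    using square_gibbs_integral(2)[of 0] by (simp add: flow_sum_def gibbs_0)
  then have "flow_sum 0 = (\<integral>\<sigma>. xy_density E \<beta> \<sigma> \<partial>spins V)\<^sup>2"
    by (simp flip: of_real_power)
  then show ?thesis using xy_density_integral_pos by simp
qed

lemma xy_expectation_square:
  "(xy_expectation V E \<beta> (\<lambda>\<sigma>. \<sigma> a * cnj (\<sigma> b)))\<^sup>2 = of_real (flow_sum 1 / flow_sum 0)"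
proof -
  let ?Z = "\<integral>\<sigma>. xy_density E \<beta> \<sigma> \<partial>spins V"
  have "(\<lambda>\<sigma>. \<sigma> a * cnj (\<sigma> b)) \<in> borel_measurable (spins V)"
    using ab by (intro borel_measurable_times spin_measurable cnj_spin_measurable)
  then have "xy_expectation V E \<beta> (\<lambda>\<sigma>. \<sigma> a * cnj (\<sigma> b)) = (\<integral>\<sigma>. gibbs 1 \<sigma> \<partial>spins V) /\<^sub>R ?Z"
    unfolding xy_expectation_def xy_measure_def gibbs_1
    using gibbs_integrable[of 1, unfolded gibbs_1]
    by (intro integral_normalised_density xy_density_integrable xy_density_integral_pos)
       (simp_all add: xy_density_def)
  then have "(xy_expectation V E \<beta> (\<lambda>\<sigma>. \<sigma> a * cnj (\<sigma> b)))\<^sup>2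
      = (\<integral>\<sigma>. gibbs 1 \<sigma> \<partial>spins V)\<^sup>2 / (complex_of_real ?Z)\<^sup>2"
    by (simp add: scaleR_conv_of_real power_mult_distrib power_inverse divide_inverse mult.commute)
  also have "complex_of_real ?Z = (\<integral>\<sigma>. gibbs 0 \<sigma> \<partial>spins V)" by (simp add: gibbs_0)
  finally show ?thesis unfolding square_gibbs_integral(2) flow_sum_def by simp
qed

section \<open>The loop measure and the comparison of the two models\<close>

context
  assumes neq: "a \<noteq> b"
begin

lemma loop_weight_nonneg: "0 \<le> loop_weight V E \<beta> \<omega>"
  unfolding loop_weight_def using \<beta> by (intro mult_nonneg_nonneg prod_nonneg) auto

lemma bij_betw_configs:
  "bij_betw snd (SIGMA M:{M. submultigraph E M}. configs_on V E M) (balanced_configs V E)"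
proof (rule bij_betw_byWitness[where f' = "\<lambda>\<omega>. (mult \<omega>, \<omega>)"])
  have "submultigraph E (mult \<omega>)" if "\<omega> \<in> balanced_configs V E" for \<omega>
    using that by (simp add: balanced_configs_def coloured_loop_config_def)
  then show "(\<lambda>\<omega>. (mult \<omega>, \<omega>)) ` balanced_configs V E
      \<subseteq> (SIGMA M:{M. submultigraph E M}. configs_on V E M)"
    by (auto simp: configs_on_def)
qed (auto simp: configs_on_def)

text \<open>The configurations split into finite fibres over countably many multiplicities. With
  \<open>\<phi>\<close> between 0 and 1, which covers both the total weight and the piece ratio,
  each fibre sum is at most \<open>flow_weight 0 M\<close>, and these are summable by the spin
  side.\<close>

lemma loop_sum:
  assumes \<phi>: "\<And>\<omega>. 0 \<le> \<phi> \<omega>" "\<And>\<omega>. \<phi> \<omega> \<le> 1"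
  shows "integrable (count_space (balanced_configs V E)) (\<lambda>\<omega>. loop_weight V E \<beta> \<omega> * \<phi> \<omega>)"
    and "(\<integral>\<omega>. loop_weight V E \<beta> \<omega> * \<phi> \<omega> \<partial>count_space (balanced_configs V E)) =
      infsetsum (\<lambda>M. \<Sum>\<omega>\<in>configs_on V E M. loop_weight V E \<beta> \<omega> * \<phi> \<omega>) {M. submultigraph E M}"
proof -
  let ?\<M> = "{M. submultigraph E M}" and ?u = "\<lambda>\<omega>. loop_weight V E \<beta> \<omega> * \<phi> \<omega>"
  have cM: "countable ?\<M>" using finite_E by (rule countable_submultigraph)
  have fin: "finite (configs_on V E M)" if "M \<in> ?\<M>" for M
    using that finite_configs_on[OF G _ ab neq] by simp
  have empty: "configs_on V E M = {}" if "M \<notin> ?\<M>" for M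
    using that by (auto simp: configs_on_def balanced_configs_def coloured_loop_config_def)
  have cfg: "countable (configs_on V E M)" for M
    using fin empty by (cases "M \<in> ?\<M>") (auto intro: countable_finite)
  have "norm (infsetsum (\<lambda>\<omega>. norm (?u \<omega>)) (configs_on V E M)) \<le> flow_weight 0 M" if "M \<in> ?\<M>" for M
  proof -
    have "(\<Sum>\<omega>\<in>configs_on V E M. ?u \<omega>) \<le> (\<Sum>\<omega>\<in>configs_on V E M. loop_weight V E \<beta> \<omega>)"
      using \<phi> loop_weight_nonneg by (intro sum_mono mult_left_le) auto
    also have "\<dots> = flow_weight 0 M"
      using sum_loop_weight[OF G _ ab neq] that by (simp add: flow_weight_def)
    finally show ?thesis
      using fin[OF that] \<phi>(1) loop_weight_nonneg by (simp add: abs_mult sum_nonneg)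
  qed
  then have "integrable (count_space ?\<M>) (\<lambda>M. infsetsum (\<lambda>\<omega>. norm (?u \<omega>)) (configs_on V E M))"
    using square_gibbs_integral(1)[of 0]
    by (intro Bochner_Integration.integrable_bound[OF square_gibbs_integral(1)[of 0]] AE_I2)
       (force intro: order_trans)+
  then have "Infinite_Set_Sum.abs_summable_on (\<lambda>x. ?u (snd x)) (Sigma ?\<M> (configs_on V E))"
    using cM cfg fin by (subst Infinite_Set_Sum.abs_summable_on_Sigma_iff)
      (auto simp: Infinite_Set_Sum.abs_summable_on_def[of _ "?\<M>"])
  then have abs: "Infinite_Set_Sum.abs_summable_on (\<lambda>(M, \<omega>). ?u \<omega>) (Sigma ?\<M> (configs_on V E))"
    and "Infinite_Set_Sum.abs_summable_on ?u (balanced_configs V E)"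
    using Infinite_Set_Sum.abs_summable_on_reindex_bij_betw[OF bij_betw_configs, of ?u]
    by (simp_all add: split_beta)
  then show "integrable (count_space (balanced_configs V E)) ?u"
    by (simp add: Infinite_Set_Sum.abs_summable_on_def)
  have "(\<integral>\<omega>. ?u \<omega> \<partial>count_space (balanced_configs V E)) = infsetsum (\<lambda>x. ?u (snd x)) (Sigma ?\<M> (configs_on V E))"
    unfolding infsetsum_def[symmetric] by (rule infsetsum_reindex_bij_betw[OF bij_betw_configs, symmetric])
  also have "\<dots> = infsetsum (\<lambda>M. infsetsum ?u (configs_on V E M)) ?\<M>"
    using infsetsum_Sigma'[OF cM cfg abs] by (simp add: split_beta)
  also have "\<dots> = infsetsum (\<lambda>M. \<Sum>\<omega>\<in>configs_on V E M. ?u \<omega>) ?\<M>"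
    using fin by (intro infsetsum_cong) auto
  finally show "(\<integral>\<omega>. ?u \<omega> \<partial>count_space (balanced_configs V E)) =
      infsetsum (\<lambda>M. \<Sum>\<omega>\<in>configs_on V E M. ?u \<omega>) ?\<M>" .
qed

lemma loop_weight_integrable:
  "integrable (count_space (balanced_configs V E)) (loop_weight V E \<beta>)"
  using loop_sum(1)[of "\<lambda>_. 1"] by simp

lemma loop_weight_integral:
  "(\<integral>\<omega>. loop_weight V E \<beta> \<omega> \<partial>count_space (balanced_configs V E)) = flow_sum 0"
proof -
  have "infsetsum (\<lambda>M. \<Sum>\<omega>\<in>configs_on V E M. loop_weight V E \<beta> \<omega>) {M. submultigraph E M} = flow_sum 0"
    unfolding flow_sum_def flow_weight_def
    by (intro infsetsum_cong) (simp_all add: sum_loop_weight[OF G _ ab neq])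
  then show ?thesis using loop_sum(2)[of "\<lambda>_. 1"] by simp
qed

lemma prob_space_loop_measure: "prob_space (loop_measure V E \<beta>)"
  unfolding loop_measure_def
  by (intro prob_space_normalised_density loop_weight_integrable loop_weight_nonneg)
     (simp add: loop_weight_integral flow_sum_0_pos)

lemma loop_expectation:
  "(\<integral>\<omega>. real (num_pieces a b \<omega>) / (real (num_pieces a b \<omega>) + 1) \<partial>loop_measure V E \<beta>)
     = flow_sum 1 / flow_sum 0"
proof -
  let ?\<phi> = "\<lambda>\<omega>. real (num_pieces a b \<omega>) / (real (num_pieces a b \<omega>) + 1)"
  have "(\<integral>\<omega>. ?\<phi> \<omega> \<partial>loop_measure V E \<beta>)
      = (\<integral>\<omega>. loop_weight V E \<beta> \<omega> *\<^sub>R ?\<phi> \<omega> \<partial>count_space (balanced_configs V E)) /\<^sub>R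
        (\<integral>\<omega>. loop_weight V E \<beta> \<omega> \<partial>count_space (balanced_configs V E))"
    unfolding loop_measure_def
    using loop_sum(1)[of ?\<phi>]
    by (intro integral_normalised_density loop_weight_integrable loop_weight_nonneg)
       (simp_all add: loop_weight_integral flow_sum_0_pos)
  also have "(\<integral>\<omega>. loop_weight V E \<beta> \<omega> *\<^sub>R ?\<phi> \<omega> \<partial>count_space (balanced_configs V E))
      = infsetsum (\<lambda>M. \<Sum>\<omega>\<in>configs_on V E M. loop_weight V E \<beta> \<omega> * ?\<phi> \<omega>) {M. submultigraph E M}"
    unfolding real_scaleR_def by (rule loop_sum(2)) simp_all
  also have "\<dots> = flow_sum 1"
    unfolding flow_sum_def flow_weight_def
  proof (rule infsetsum_cong)
    fix M assume "M \<in> {M. submultigraph E M}"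
    then show "(\<Sum>\<omega>\<in>configs_on V E M. loop_weight V E \<beta> \<omega> * ?\<phi> \<omega>)
        = edge_weight E \<beta> M * real (card (flows V (medges M) a b (int 1)))"
      using sum_loop_weight_pieces[OF G _ ab neq, of M \<beta>] by simp
  qed simp
  finally show ?thesis by (simp add: loop_weight_integral divide_inverse mult.commute)
qed

lemma sets_loop_measure: "sets (loop_measure V E \<beta>) = Pow (balanced_configs V E)"
  by (simp add: loop_measure_def normalised_def)

text \<open>For a natural number \<open>m\<close> the ratio \<open>m / (m + 1)\<close> vanishes at 0
  and lies between 1/2 and 1 from 1 on, so it is squeezed between half the indicator of
  \<open>m > 0\<close> and that indicator.\<close>

lemma loop_expectation_bounds:
  defines "p \<equiv> \<P>(\<omega> in loop_measure V E \<beta>. num_pieces a b \<omega> > 0)"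
    and "m \<equiv> \<integral>\<omega>. real (num_pieces a b \<omega>) / (real (num_pieces a b \<omega>) + 1) \<partial>loop_measure V E \<beta>"
  shows "1/2 * p \<le> m" and "m \<le> p"
proof -
  let ?L = "loop_measure V E \<beta>" and ?\<phi> = "\<lambda>\<omega>. real (num_pieces a b \<omega>) / (real (num_pieces a b \<omega>) + 1)"
  interpret prob_space ?L by (rule prob_space_loop_measure)
  let ?A = "{\<omega> \<in> space ?L. num_pieces a b \<omega> > 0}"
  have meas: "f \<in> borel_measurable ?L" for f :: "'v loop_config \<Rightarrow> real"
    by (simp add: loop_measure_def normalised_def)
  have A: "?A \<in> sets ?L" using sets.top[of ?L] by (auto simp: sets_loop_measure)
  have p: "p = (\<integral>\<omega>. indicator ?A \<omega> \<partial>?L)" using A by (simp add: p_def)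
  have int: "integrable ?L ?\<phi>" "integrable ?L (indicator ?A :: _ \<Rightarrow> real)"
    by (rule integrable_const_bound[where B = 1]; use meas in \<open>auto simp: indicator_def\<close>)+
  have "1/2 * indicator ?A \<omega> \<le> ?\<phi> \<omega>" for \<omega> by (auto simp: indicator_def field_simps)
  then have "(\<integral>\<omega>. 1/2 * indicator ?A \<omega> \<partial>?L) \<le> m"
    unfolding m_def using int by (intro integral_mono) auto
  then show "1/2 * p \<le> m" unfolding p by simp
  have "?\<phi> \<omega> \<le> indicator ?A \<omega>" if "\<omega> \<in> space ?L" for \<omega>
    using that by (auto simp: indicator_def field_simps)
  then show "m \<le> p" unfolding p m_def using int by (intro integral_mono) auto
qed

end

end

theorem proposition18:
  fixes V :: "'v set" and E :: "'v set set" and \<beta> :: real and a b :: 'v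
  assumes "finite_graph V E" and "\<beta> > 0" and "a \<in> V" and "b \<in> V" and "a \<noteq> b"
  shows "(xy_expectation V E \<beta> (\<lambda>\<sigma>. \<sigma> a * cnj (\<sigma> b)))\<^sup>2 =
           complex_of_real (\<integral>\<omega>. real (num_pieces a b \<omega>) / (real (num_pieces a b \<omega>) + 1)
             \<partial>loop_measure V E \<beta>)
       \<and> 1/2 * \<P>(\<omega> in loop_measure V E \<beta>. num_pieces a b \<omega> > 0)
           \<le> Re ((xy_expectation V E \<beta> (\<lambda>\<sigma>. \<sigma> a * cnj (\<sigma> b)))\<^sup>2)
       \<and> Re ((xy_expectation V E \<beta> (\<lambda>\<sigma>. \<sigma> a * cnj (\<sigma> b)))\<^sup>2)
           \<le> \<P>(\<omega> in loop_measure V E \<beta>. num_pieces a b \<omega> > 0)"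
  \<comment> \<open>The squared correlation and the loop expectation are the same quotient
    \<open>flow_sum 1 / flow_sum 0\<close>; being real, it passes through \<open>Re\<close> in the
    two bounds.\<close>
  unfolding xy_expectation_square[OF assms(1-4)] loop_expectation[OF assms, symmetric] Re_complex_of_real
  using loop_expectation_bounds[OF assms] by simp

end
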